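(* Let $\tau=(\tau_{ij})_{i,j\in V}\in \mathrm{MRDS}(\mathrm{Rat}_+)$ be a mean stable system, with associated directed graph $(V,E)$ and induced graph directed Markov system $S_\tau$. Then all of the following hold. (i) There exists a constant $c\in(0,1)$ such that for each $z\in\widehat{\mathbb C}$ there exists a Borel subset $\mathfrak F$ of $(\mathrm{Rat}_+\times E)^{\mathbb N}$ with $\tilde\tau(\mathfrak F)=1$ such that for every $(f_n,e_n)_{n=1}^\infty\in\mathfrak F$ there exist $r=r(z,(f_n,e_n)_{n=1}^\infty)>0$ and $K=K(z,(f_n,e_n)_{n=1}^\infty)>0$ such that $\operatorname{diam} f_n\circ\dots\circ f_1(B(z,r))\le Kc^n$ for every $n\in\mathbb N$. (ii) For each $z\in\widehat{\mathbb C}$ there exists a Borel subset $\mathfrak F$ of $(\mathrm{Rat}_+\times E)^{\mathbb N}$ with $\tilde\tau(\mathfrak F)=1$ such that for every $(f_n,e_n)_{n=1}^\infty\in\mathfrak F$ there exists an attracting minimal set $(L_i)_{i\in V}$ of $S_\tau$ such that $d(f_n\circ\dots\circ f_1(z),L_{t(e_n)})\to0$ as $n\to\infty$. (iii) For every $i\in V$, the kernel Julia set $J_{\ker,i}(S_\tau):=\bigcap_{j\in V}\bigcap_{h\in H_i^j(S_\tau)}h^{-1}(J_j(S_\tau))$ at $i$ is empty. (iv) There exists a Borel subset $\mathfrak G$ of $(\mathrm{Rat}_+\times E)^{\mathbb N}$ with $\tilde\tau(\mathfrak G)=1$ such that for every $\xi=(f_n,e_n)_{n=1}^\infty\in\mathfrak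 G$ the ($2$-dimensional) Lebesgue measure of the Julia set $J_\xi$ is zero. Here $J_\xi$ is the complement of the set of all points $z\in\widehat{\mathbb C}$ for which there exists a neighborhood $U$ of $z$ in $\widehat{\mathbb C}$ such that the family $\{f_n\circ\dots\circ f_1\}_{n=1}^\infty$ is equicontinuous on $U$. (v) There exist at most finitely many minimal sets of $S_\tau$. Moreover, each minimal set of $S_\tau$ is attracting. Also, for every minimal set $\mathbb L=(L_i)_{i\in V}$ of $S_\tau$, define $\mathbb T_{\mathbb L}:\widehat{\mathbb C}\times V\to[0,1]$ by $$\mathbb T_{\mathbb L}(z,i):=\tilde\tau_i\big(\{\xi=(f_n,e_n)_{n\in\mathbb N};\ d(f_n\circ\dots\circ f_1(z),L_{t(e_n)})\to0\ (n\to\infty)\}\big)$$ for every $(z,i)\in\widehat{\mathbb C}\times V$. Then $\mathbb T_{\mathbb L}$ is continuous on $\widehat{\mathbb C}\times V$. Also, the averaged function $T_{\mathbb L}(z):=\sum_{i\in V}p_i\mathbb T_{\mathbb L}(z,i)$ is continuous on $\widehat{\mathbb C}$. (vi) Suppose $\tau$ has exactly $\ell$ minimal sets $\mathbb L_1,\mathbb L_2,\dots,\mathbb L_\ell$. Then $T_{\mathbb L_1}(z)+T_{\mathbb L_2}(z)+\dots+T_{\mathbb L_\ell}(z)=1$ for every $z\in\widehat{\mathbb C}$.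
   Context: Let $d$ be the spherical distance on the Riemann sphere $\widehat{\mathbb C}$, $B(z,r)$ the $d$-ball, and $\operatorname{diam}A=\sup_{x,y\in A}d(x,y)$. $\mathrm{Rat}_+$ is the space of all rational maps $\widehat{\mathbb C}\to\widehat{\mathbb C}$ of degree two or more, with metric $\kappa(f,g)=\sup_{z\in\widehat{\mathbb C}}d(f(z),g(z))$. Markov random dynamical system (MRDS): for some $q\in\mathbb N$, a family $\tau=(\tau_{ij})_{i,j=1,\dots,q}$ of regular Borel measures on $\mathrm{Rat}_+$ with $\sum_{j=1}^q\tau_{ij}(\mathrm{Rat}_+)=1$ for all $i$. Its associated directed graph $(V,E)$ has $V=\{1,\dots,q\}$ and $E=\{(i,j)\in V\times V;\tau_{ij}(\mathrm{Rat}_+)>0\}$; for $e=(i,j)\in E$ put $i(e)=i$ (initial vertex), $t(e)=j$ (terminal vertex), $\tau_e=\tau_{ij}$, $\Gamma_e=\operatorname{supp}\tau_e$ (topological support). $S_\tau=(V,E,(\Gamma_e)_{e\in E})$ is the graph directed Markov system (GDMS) induced by $\tau$. $\tau$ is irreducible if $(V,E)$ is strongly connected. For $X\subset\mathrm{Rat}_+$, $\mathrm{MRDS}(X)$ is the set of all irreducible MRDSs $\tau$ such that $\operatorname{supp}\tau_e$ is compact and contained in $X$ for every $e\in E$. A word $e=(e_1,\dots,e_N)\in E^N$ is admissible if $t(e_n)=i(e_{n+1})$ for $n=1,\dots,N-1$; put $i(e)=i(e_1)$, $t(e)=t(e_N)$. $H_i^j(S_\tau)$ is the set of all compositions $f_N\circ\dots\circ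 f_1$ with $N\in\mathbb N$, $f_n\in\Gamma_{e_n}$, $(e_1,\dots,e_N)$ admissible, $i(e_1)=i$, $t(e_N)=j$. The Fatou set $F_i(S_\tau)$ at $i$ is the set of $z\in\widehat{\mathbb C}$ having a neighborhood on which $\bigcup_{j\in V}H_i^j(S_\tau)$ is equicontinuous; $J_i(S_\tau)=\widehat{\mathbb C}\setminus F_i(S_\tau)$ is the Julia set at $i$. Mean stable: there exist $N\in\mathbb N$ and families of non-empty open sets $(U_i)_{i\in V}$, $(W_i)_{i\in V}$ such that (I) $U_i\subset\overline{U_i}\subset W_i\subset\overline{W_i}\subset F_i(S_\tau)$ for each $i$; (II) for each admissible word $e=(e_1,\dots,e_N)$ of length $N$ and all $f_n\in\Gamma_{e_n}$, $\overline{f_N\circ\dots\circ f_1(W_{i(e)})}\subset U_{t(e)}$; (III) for each $z\in\widehat{\mathbb C}$ and $i\in V$ there exist $j\in V$ and $h\in H_i^j(S_\tau)$ with $h(z)\in W_j$. Minimal set: a family $(L_i)_{i\in V}$ of subsets of $\widehat{\mathbb C}$ is forward invariant if $f(L_{i(e)})\subset L_{t(e)}$ for all $e\in E$, $f\in\Gamma_e$. A minimal set of $S_\tau$ (equivalently of $\tau$) is a minimal element, with respect to componentwise inclusion, among the forward invariant families $(L_i)_{i\in V}$ with every $L_i$ non-empty and compact. A minimal set $(L_i)_{i\in V}$ is attracting if there exist $N\in\mathbb N$ and open sets $(U_i)_{i\in V},(W_i)_{i\in V}$ with $L_i\subset U_i\subset\overline{U_i}\subset W_i\subset\overline{W_i}\subset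 F_i(S_\tau)$ for each $i$, and $\overline{f_N\circ\dots\circ f_1(W_{i(e)})}\subset U_{t(e)}$ for each admissible word $e=(e_1,\dots,e_N)$ of length $N$ and all $f_n\in\Gamma_{e_n}$. Measures: for irreducible $\tau$ put $P=(\tau_{ij}(\mathrm{Rat}_+))_{i,j\in V}$; $p=(p_1,\dots,p_q)$ is the unique vector with $pP=p$, $\sum_ip_i=1$, $p_i>0$. For $i\in V$, $\tilde\tau_i$ is the Borel probability measure on $(\mathrm{Rat}_+\times E)^{\mathbb N}$ such that for all $N$, Borel sets $A_1,\dots,A_N\subset\mathrm{Rat}_+$ and $(e_1,\dots,e_N)\in E^N$, the cylinder $(A_1\times\{e_1\})\times\dots\times(A_N\times\{e_N\})\times\prod_{N+1}^\infty(\mathrm{Rat}_+\times E)$ has measure $\tau_{e_1}(A_1)\cdots\tau_{e_N}(A_N)$ if $(e_1,\dots,e_N)$ is admissible with $i(e_1)=i$, and $0$ otherwise. $\tilde\tau=\sum_{i\in V}p_i\tilde\tau_i$. *)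

theory Defs
  imports "HOL-Probability.Probability" "HOL-Computational_Algebra.Polynomial"
begin

section \<open>The Riemann sphere with the spherical distance\<close>

datatype riemann_sphere = Finite complex | Infinity

text \<open>Inverse stereographic projection onto the unit sphere of \<open>\<complex> \<times> \<real>\<close>.\<close>

fun stereo :: "riemann_sphere \<Rightarrow> complex \<times> real" where
  "stereo (Finite z) =
     ((2 / (1 + (cmod z)\<^sup>2)) *\<^sub>R z, ((cmod z)\<^sup>2 - 1) / ((cmod z)\<^sup>2 + 1))"
| "stereo Infinity = (0, 1)"

lemma norm_stereo: "norm (stereo x) = 1"
proof (cases x)
  case (Finite z)
  define s where "s = (cmod z)\<^sup>2"
  have s: "1 + s > 0" "s + 1 \<noteq> 0" unfolding s_def by (auto simp: add_pos_nonneg add_nonneg_eq_0_iff)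
  have "(norm (stereo x))\<^sup>2 = (2 / (1 + s))\<^sup>2 * s + ((s - 1) / (s + 1))\<^sup>2"
    unfolding Finite by (simp add: norm_Pair s_def power_mult_distrib power_divide)
  also have "\<dots> = (4 * s + (s - 1)\<^sup>2) / (s + 1)\<^sup>2"
    using s by (simp add: power_divide add_divide_distrib add.commute)
  also have "4 * s + (s - 1)\<^sup>2 = (s + 1)\<^sup>2"
    by (simp add: power2_eq_square algebra_simps)
  finally have "(norm (stereo x))\<^sup>2 = 1"
    using s by simp
  then show ?thesis
    by (simp add: power2_eq_1_iff) (smt (verit) norm_ge_zero)
qed (simp add: norm_Pair)

lemma stereo_inject: "stereo x = stereo y \<longleftrightarrow> x = y"
proof
  have key: "1 - snd (stereo (Finite z)) = 2 / (1 + (cmod z)\<^sup>2)"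
    "1 - snd (stereo (Finite z)) \<noteq> 0"
    "fst (stereo (Finite z)) = (1 - snd (stereo (Finite z))) *\<^sub>R z" for z
  proof -
    have p: "1 + (cmod z)\<^sup>2 > 0" by (simp add: add_pos_nonneg)
    show a: "1 - snd (stereo (Finite z)) = 2 / (1 + (cmod z)\<^sup>2)"
      using p by (simp add: field_simps)
    show "1 - snd (stereo (Finite z)) \<noteq> 0" using a p by simp
    show "fst (stereo (Finite z)) = (1 - snd (stereo (Finite z))) *\<^sub>R z"
      unfolding a by simp
  qed
  assume eq: "stereo x = stereo y"
  show "x = y"
  proof (cases x; cases y)
    fix z w assume "x = Finite z" "y = Finite w"
    with eq key[of z] key[of w] show "x = y"
      by (metis scaleR_cancel_left)
  next
    fix z assume "x = Finite z" "y = Infinity"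
    with eq key(2)[of z] show "x = y" by auto
  next
    fix z assume "x = Infinity" "y = Finite z"
    with eq[symmetric] key(2)[of z] show "x = y" by auto
  qed auto
qed simp

lemma arccos_inner_triangle:
  fixes x y z :: "'a::real_inner"
  assumes n: "norm x = 1" "norm y = 1" "norm z = 1"
  shows "arccos (x \<bullet> z) \<le> arccos (x \<bullet> y) + arccos (y \<bullet> z)"
proof -
  have b: "\<bar>u \<bullet> v\<bar> \<le> 1" if "norm u = 1" "norm v = 1" for u v :: 'a
    using Cauchy_Schwarz_ineq2[of u v] that by simp
  have i: "x \<bullet> x = 1" "y \<bullet> y = 1" "z \<bullet> z = 1"
    using n by (auto simp: dot_square_norm)
  define a where "a = x \<bullet> y"
  define c where "c = y \<bullet> z"
  have a1: "\<bar>a\<bar> \<le> 1" and c1: "\<bar>c\<bar> \<le> 1" and xz: "\<bar>x \<bullet> z\<bar> \<le> 1"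
    unfolding a_def c_def using b n by auto
  define u where "u = x - a *\<^sub>R y"
  define v where "v = z - c *\<^sub>R y"
  have uu: "u \<bullet> u = 1 - a\<^sup>2" unfolding u_def
    using i by (simp add: inner_diff_left inner_diff_right a_def inner_commute power2_eq_square)
  have vv: "v \<bullet> v = 1 - c\<^sup>2" unfolding v_def
    using i by (simp add: inner_diff_left inner_diff_right c_def inner_commute power2_eq_square)
  have uv: "u \<bullet> v = x \<bullet> z - a * c" unfolding u_def v_def
    using i by (simp add: inner_diff_left inner_diff_right c_def a_def inner_commute)
  have "\<bar>u \<bullet> v\<bar> \<le> norm u * norm v" by (rule Cauchy_Schwarz_ineq2)
  then have "\<bar>x \<bullet> z - a * c\<bar> \<le> sqrt (1 - a\<^sup>2) * sqrt (1 - c\<^sup>2)"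
    by (simp add: norm_eq_sqrt_inner uu vv uv)
  then have "a * c - sqrt (1 - a\<^sup>2) * sqrt (1 - c\<^sup>2) \<le> x \<bullet> z"
    by linarith
  moreover have "cos (arccos a + arccos c) = a * c - sqrt (1 - a\<^sup>2) * sqrt (1 - c\<^sup>2)"
    using a1 c1 by (simp add: cos_add cos_arccos_abs sin_arccos_abs)
  ultimately have le: "cos (arccos a + arccos c) \<le> x \<bullet> z" by simp
  have nn: "0 \<le> arccos a" "0 \<le> arccos c" "arccos (x \<bullet> z) \<le> pi"
    using a1 c1 xz by (auto intro!: arccos_lbound arccos_ubound simp: abs_le_iff)
  show ?thesis
  proof (cases "arccos a + arccos c \<le> pi")
    case True
    have "arccos (x \<bullet> z) \<le> arccos (cos (arccos a + arccos c))"
      using le xz by (intro arccos_le_arccos) auto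
    also have "\<dots> = arccos a + arccos c"
      using nn True by (intro arccos_cos) auto
    finally show ?thesis by (simp add: a_def c_def)
  next
    case False
    with nn show ?thesis by (simp add: a_def c_def)
  qed
qed

text \<open>
  The distance is the length of the shortest great-circle arc, i.e. the geodesic distance of the
  metric $2|dz|/(1+|z|^2)$.
\<close>

instantiation riemann_sphere :: metric_space
begin

definition dist_riemann_sphere :: "riemann_sphere \<Rightarrow> riemann_sphere \<Rightarrow> real" where
  "dist_riemann_sphere x y = arccos (stereo x \<bullet> stereo y)"

definition uniformity_riemann_sphere :: "(riemann_sphere \<times> riemann_sphere) filter" where
  "uniformity_riemann_sphere = (INF e\<in>{0 <..}. principal {(x, y). dist x y < e})"

definition open_riemann_sphere :: "riemann_sphere set \<Rightarrow> bool" where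
  "open_riemann_sphere U = (\<forall>x\<in>U. \<forall>\<^sub>F (x', y) in uniformity. x' = x \<longrightarrow> y \<in> U)"

instance
proof
  fix x y z :: riemann_sphere
  have ii: "stereo w \<bullet> stereo w = 1" for w
    using norm_stereo[of w] by (simp add: dot_square_norm)
  have b: "\<bar>stereo x \<bullet> stereo y\<bar> \<le> 1"
    using Cauchy_Schwarz_ineq2[of "stereo x" "stereo y"] by (simp add: norm_stereo)
  show "dist x y = 0 \<longleftrightarrow> x = y"
  proof
    assume "dist x y = 0"
    then have "cos (arccos (stereo x \<bullet> stereo y)) = 1"
      by (simp add: dist_riemann_sphere_def)
    then have "stereo x \<bullet> stereo y = 1" using b by (simp add: cos_arccos_abs)
    then have "(stereo x - stereo y) \<bullet> (stereo x - stereo y) = 0"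
      using ii by (simp add: inner_diff_left inner_diff_right inner_commute)
    then show "x = y" by (simp add: stereo_inject)
  qed (simp add: dist_riemann_sphere_def ii)
  show "dist x y \<le> dist x z + dist y z"
    using arccos_inner_triangle[of "stereo x" "stereo z" "stereo y"]
    by (simp add: dist_riemann_sphere_def norm_stereo inner_commute)
qed (rule uniformity_riemann_sphere_def open_riemann_sphere_def)+

end

lemma dist_riemann_sphere_le_pi: "dist x y \<le> pi" for x y :: riemann_sphere
proof -
  have "\<bar>stereo x \<bullet> stereo y\<bar> \<le> 1"
    using Cauchy_Schwarz_ineq2[of "stereo x" "stereo y"] by (simp add: norm_stereo)
  then show ?thesis
    unfolding dist_riemann_sphere_def by (intro arccos_ubound) auto
qed

text \<open>Two-dimensional Lebesgue measure on the sphere, with its density in the affine chart.\<close>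

definition sphere_area :: "riemann_sphere measure" where
  "sphere_area = distr (density lborel (\<lambda>z. ennreal (4 / (1 + (cmod z)\<^sup>2)\<^sup>2))) borel Finite"


section \<open>Rational maps\<close>

definition proj_ratio :: "complex \<Rightarrow> complex \<Rightarrow> riemann_sphere" where
  "proj_ratio a b = (if b = 0 then Infinity else Finite (a / b))"

text \<open>
  At infinity the map takes the value \<open>[a : b]\<close>, where \<open>a\<close>, \<open>b\<close> are the coefficients of
  \<open>P\<close>, \<open>Q\<close> in degree \<open>max (degree P) (degree Q)\<close>.
\<close>

fun rational_fun :: "complex poly \<Rightarrow> complex poly \<Rightarrow> riemann_sphere \<Rightarrow> riemann_sphere" where
  "rational_fun P Q (Finite z) = proj_ratio (poly P z) (poly Q z)"
| "rational_fun P Q Infinity =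
     (let d = max (degree P) (degree Q) in proj_ratio (coeff P d) (coeff Q d))"

definition rational_map_of_degree :: "nat \<Rightarrow> (riemann_sphere \<Rightarrow> riemann_sphere) \<Rightarrow> bool" where
  "rational_map_of_degree d f \<longleftrightarrow>
     (\<exists>P Q. coprime P Q \<and> max (degree P) (degree Q) = d \<and> f = rational_fun P Q)"

typedef rat_plus = "{f. \<exists>d\<ge>2. rational_map_of_degree d f}"
  morphisms app Abs_rat_plus
proof -
  have "rational_map_of_degree 2 (rational_fun [:0, 0, 1:] 1)"
    unfolding rational_map_of_degree_def
    by (intro exI[of _ "[:0, 0, 1:]"] exI[of _ 1]) simp
  then show ?thesis by blast
qed

instantiation rat_plus :: metric_space
begin

definition dist_rat_plus :: "rat_plus \<Rightarrow> rat_plus \<Rightarrow> real" where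
  "dist_rat_plus f g = (SUP z. dist (app f z) (app g z))"

definition uniformity_rat_plus :: "(rat_plus \<times> rat_plus) filter" where
  "uniformity_rat_plus = (INF e\<in>{0 <..}. principal {(f, g). dist f g < e})"

definition open_rat_plus :: "rat_plus set \<Rightarrow> bool" where
  "open_rat_plus U = (\<forall>f\<in>U. \<forall>\<^sub>F (f', g) in uniformity. f' = f \<longrightarrow> g \<in> U)"

instance
proof
  fix f g h :: rat_plus
  have le: "dist (app f z) (app g z) \<le> dist f g" for f g z
    unfolding dist_rat_plus_def
    by (rule cSUP_upper) (auto intro!: bdd_aboveI2 dist_riemann_sphere_le_pi)
  show "dist f g = 0 \<longleftrightarrow> f = g"
  proof
    assume "dist f g = 0"
    then have "dist (app f z) (app g z) = 0" for z
      using le[of f z g] zero_le_dist[of "app f z" "app g z"] by linarith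
    then have "app f = app g" by auto
    then show "f = g" by (simp add: app_inject)
  qed (simp add: dist_rat_plus_def)
  show "dist f g \<le> dist f h + dist g h"
    unfolding dist_rat_plus_def[of f g]
  proof (rule cSUP_least)
    fix z
    show "dist (app f z) (app g z) \<le> dist f h + dist g h"
      using dist_triangle2[of "app f z" "app g z" "app h z"] le[of f z h] le[of g z h] by linarith
  qed simp
qed (rule uniformity_rat_plus_def open_rat_plus_def)+

end


section \<open>Graph directed Markov systems\<close>

text \<open>
  The vertex set is the universe of a finite type. Edges are ordered pairs of vertices, so
  \<open>fst\<close> and \<open>snd\<close> give the initial and the terminal vertex.
\<close>

record 'v gdms =
  edges :: "('v \<times> 'v) set"
  gens :: "'v \<times> 'v \<Rightarrow> rat_plus set"

definition admissible :: "'v gdms \<Rightarrow> ('v \<times> 'v) list \<Rightarrow> bool" where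
  "admissible S es \<longleftrightarrow> es \<noteq> [] \<and> set es \<subseteq> edges S \<and>
     (\<forall>n. Suc n < length es \<longrightarrow> snd (es ! n) = fst (es ! Suc n))"

text \<open>\<open>comp_list [f\<^sub>1, \<dots>, f\<^sub>N]\<close> is \<open>f\<^sub>N \<circ> \<dots> \<circ> f\<^sub>1\<close>.\<close>

definition comp_list :: "rat_plus list \<Rightarrow> riemann_sphere \<Rightarrow> riemann_sphere" where
  "comp_list fs = fold (\<lambda>f h. app f \<circ> h) fs id"

definition admissible_maps :: "'v gdms \<Rightarrow> ('v \<times> 'v) list \<Rightarrow> rat_plus list \<Rightarrow> bool" where
  "admissible_maps S es fs \<longleftrightarrow> admissible S es \<and> list_all2 (\<lambda>f e. f \<in> gens S e) fs es"

definition word_maps :: "'v gdms \<Rightarrow> 'v \<Rightarrow> 'v \<Rightarrow> (riemann_sphere \<Rightarrow> riemann_sphere) set" where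
  "word_maps S i j = {comp_list fs | es fs.
     admissible_maps S es fs \<and> fst (hd es) = i \<and> snd (last es) = j}"

definition equicontinuous_on ::
  "'a::metric_space set \<Rightarrow> ('a \<Rightarrow> 'b::metric_space) set \<Rightarrow> bool" where
  "equicontinuous_on U \<F> \<longleftrightarrow>
     (\<forall>x\<in>U. \<forall>\<epsilon>>0. \<exists>\<delta>>0. \<forall>y\<in>U. dist x y < \<delta> \<longrightarrow> (\<forall>f\<in>\<F>. dist (f x) (f y) < \<epsilon>))"

definition fatou_set ::
  "(riemann_sphere \<Rightarrow> riemann_sphere) set \<Rightarrow> riemann_sphere set" where
  "fatou_set \<F> = {z. \<exists>U. open U \<and> z \<in> U \<and> equicontinuous_on U \<F>}"

definition fatou :: "'v gdms \<Rightarrow> 'v \<Rightarrow> riemann_sphere set" where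
  "fatou S i = fatou_set (\<Union>j. word_maps S i j)"

definition julia :: "'v gdms \<Rightarrow> 'v \<Rightarrow> riemann_sphere set" where
  "julia S i = - fatou S i"

definition kernel_julia :: "'v gdms \<Rightarrow> 'v \<Rightarrow> riemann_sphere set" where
  "kernel_julia S i = (\<Inter>j. \<Inter>h\<in>word_maps S i j. h -` julia S j)"

definition mean_stable :: "'v gdms \<Rightarrow> bool" where
  "mean_stable S \<longleftrightarrow> (\<exists>N\<ge>1. \<exists>U W.
     (\<forall>i. open (U i) \<and> U i \<noteq> {} \<and> open (W i) \<and> W i \<noteq> {}) \<and>
     (\<forall>i. closure (U i) \<subseteq> W i \<and> closure (W i) \<subseteq> fatou S i) \<and>
     (\<forall>es fs. admissible_maps S es fs \<and> length es = N \<longrightarrow>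
        closure (comp_list fs ` W (fst (hd es))) \<subseteq> U (snd (last es))) \<and>
     (\<forall>z i. \<exists>j. \<exists>h\<in>word_maps S i j. h z \<in> W j))"

definition forward_invariant :: "'v gdms \<Rightarrow> ('v \<Rightarrow> riemann_sphere set) \<Rightarrow> bool" where
  "forward_invariant S L \<longleftrightarrow>
     (\<forall>e\<in>edges S. \<forall>f\<in>gens S e. app f ` L (fst e) \<subseteq> L (snd e))"

definition compact_invariant :: "'v gdms \<Rightarrow> ('v \<Rightarrow> riemann_sphere set) \<Rightarrow> bool" where
  "compact_invariant S L \<longleftrightarrow> forward_invariant S L \<and> (\<forall>i. L i \<noteq> {} \<and> compact (L i))"

definition minimal_set :: "'v gdms \<Rightarrow> ('v \<Rightarrow> riemann_sphere set) \<Rightarrow> bool" where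
  "minimal_set S L \<longleftrightarrow> compact_invariant S L \<and>
     (\<forall>K. compact_invariant S K \<and> (\<forall>i. K i \<subseteq> L i) \<longrightarrow> K = L)"

definition attracting :: "'v gdms \<Rightarrow> ('v \<Rightarrow> riemann_sphere set) \<Rightarrow> bool" where
  "attracting S L \<longleftrightarrow> (\<exists>N\<ge>1. \<exists>U W.
     (\<forall>i. open (U i) \<and> open (W i)) \<and>
     (\<forall>i. L i \<subseteq> U i \<and> closure (U i) \<subseteq> W i \<and> closure (W i) \<subseteq> fatou S i) \<and>
     (\<forall>es fs. admissible_maps S es fs \<and> length es = N \<longrightarrow>
        closure (comp_list fs ` W (fst (hd es))) \<subseteq> U (snd (last es))))"


section \<open>Markov random dynamical systems\<close>

definition regular_borel_measure :: "'a::topological_space measure \<Rightarrow> bool" where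
  "regular_borel_measure M \<longleftrightarrow> sets M = sets borel \<and>
     (\<forall>B\<in>sets borel.
        emeasure M B = (INF U\<in>{U. B \<subseteq> U \<and> open U}. emeasure M U) \<and>
        emeasure M B = (SUP K\<in>{K. K \<subseteq> B \<and> compact K}. emeasure M K))"

definition topological_support :: "'a::topological_space measure \<Rightarrow> 'a set" where
  "topological_support M = {x. \<forall>U. open U \<and> x \<in> U \<longrightarrow> emeasure M U > 0}"

definition markov_rds :: "('v::finite \<Rightarrow> 'v \<Rightarrow> rat_plus measure) \<Rightarrow> bool" where
  "markov_rds \<tau> \<longleftrightarrow> (\<forall>i j. regular_borel_measure (\<tau> i j)) \<and>
     (\<forall>i. (\<Sum>j\<in>UNIV. emeasure (\<tau> i j) UNIV) = 1)"

definition mrds_edges :: "('v \<Rightarrow> 'v \<Rightarrow> rat_plus measure) \<Rightarrow> ('v \<times> 'v) set" where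
  "mrds_edges \<tau> = {(i, j). emeasure (\<tau> i j) UNIV > 0}"

definition induced_gdms :: "('v \<Rightarrow> 'v \<Rightarrow> rat_plus measure) \<Rightarrow> 'v gdms" where
  "induced_gdms \<tau> = \<lparr>edges = mrds_edges \<tau>, gens = (\<lambda>(i, j). topological_support (\<tau> i j))\<rparr>"

definition irreducible_mrds :: "('v \<Rightarrow> 'v \<Rightarrow> rat_plus measure) \<Rightarrow> bool" where
  "irreducible_mrds \<tau> \<longleftrightarrow> (\<forall>i j. (i, j) \<in> (mrds_edges \<tau>)\<^sup>*)"

definition MRDS :: "rat_plus set \<Rightarrow> ('v::finite \<Rightarrow> 'v \<Rightarrow> rat_plus measure) set" where
  "MRDS X = {\<tau>. markov_rds \<tau> \<and> irreducible_mrds \<tau> \<and>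
     (\<forall>(i, j)\<in>mrds_edges \<tau>. compact (topological_support (\<tau> i j)) \<and> topological_support (\<tau> i j) \<subseteq> X)}"


section \<open>Path measures\<close>

text \<open>
  A path is a sequence \<open>\<xi>\<close> with \<open>\<xi> n = (f\<^sub>n\<^sub>+\<^sub>1, e\<^sub>n\<^sub>+\<^sub>1)\<close>; the index is shifted by one. The
  path space carries the Borel \<open>\<sigma>\<close>-algebra of the product topology, with discrete topology on
  the edge set.
\<close>

type_synonym 'v path = "nat \<Rightarrow> rat_plus \<times> 'v \<times> 'v"

definition path_topology :: "('v \<Rightarrow> 'v \<Rightarrow> rat_plus measure) \<Rightarrow> 'v path topology" where
  "path_topology \<tau> =
     product_topology (\<lambda>_. prod_topology euclidean (discrete_topology (mrds_edges \<tau>))) UNIV"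

definition path_borel :: "('v \<Rightarrow> 'v \<Rightarrow> rat_plus measure) \<Rightarrow> 'v path measure" where
  "path_borel \<tau> = sigma (topspace (path_topology \<tau>)) {U. openin (path_topology \<tau>) U}"

definition cylinder ::
  "('v \<Rightarrow> 'v \<Rightarrow> rat_plus measure) \<Rightarrow> rat_plus set list \<Rightarrow> ('v \<times> 'v) list \<Rightarrow> 'v path set" where
  "cylinder \<tau> As es = {\<xi> \<in> space (path_borel \<tau>).
     \<forall>n<length es. fst (\<xi> n) \<in> As ! n \<and> snd (\<xi> n) = es ! n}"

definition path_measure_from ::
  "('v \<Rightarrow> 'v \<Rightarrow> rat_plus measure) \<Rightarrow> 'v \<Rightarrow> 'v path measure" where
  "path_measure_from \<tau> i = (THE M. prob_space M \<and> sets M = sets (path_borel \<tau>) \<and>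
     (\<forall>As es. es \<noteq> [] \<and> length As = length es \<and> set As \<subseteq> sets borel \<and> set es \<subseteq> mrds_edges \<tau> \<longrightarrow>
        emeasure M (cylinder \<tau> As es) =
          (if admissible (induced_gdms \<tau>) es \<and> fst (hd es) = i
           then \<Prod>n<length es. emeasure (\<tau> (fst (es ! n)) (snd (es ! n))) (As ! n)
           else 0)))"

definition stationary_vector :: "('v::finite \<Rightarrow> 'v \<Rightarrow> rat_plus measure) \<Rightarrow> 'v \<Rightarrow> real" where
  "stationary_vector \<tau> = (THE p.
     (\<forall>j. (\<Sum>i\<in>UNIV. p i * measure (\<tau> i j) UNIV) = p j) \<and>
     (\<Sum>i\<in>UNIV. p i) = 1 \<and> (\<forall>i. p i > 0))"

definition path_measure :: "('v::finite \<Rightarrow> 'v \<Rightarrow> rat_plus measure) \<Rightarrow> 'v path measure" where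
  "path_measure \<tau> = measure_of (space (path_borel \<tau>)) (sets (path_borel \<tau>))
     (\<lambda>A. \<Sum>i\<in>UNIV. ennreal (stationary_vector \<tau> i) * emeasure (path_measure_from \<tau> i) A)"

text \<open>\<open>traj \<xi> n\<close> is \<open>f\<^sub>n \<circ> \<dots> \<circ> f\<^sub>1\<close>.\<close>

primrec traj :: "'v path \<Rightarrow> nat \<Rightarrow> riemann_sphere \<Rightarrow> riemann_sphere" where
  "traj \<xi> 0 = id"
| "traj \<xi> (Suc n) = app (fst (\<xi> n)) \<circ> traj \<xi> n"

text \<open>
  \<open>tends_to \<xi> z L\<close> says that $d(f_n\circ\dots\circ f_1(z), L_{t(e_n)}) \to 0$; the term with
  index \<open>n\<close> below is the one for \<open>n + 1\<close>.
\<close>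

definition tends_to :: "'v path \<Rightarrow> riemann_sphere \<Rightarrow> ('v \<Rightarrow> riemann_sphere set) \<Rightarrow> bool" where
  "tends_to \<xi> z L \<longleftrightarrow>
     (\<lambda>n. infdist (traj \<xi> (Suc n) z) (L (snd (snd (\<xi> n))))) \<longlonglongrightarrow> 0"

definition path_julia :: "'v path \<Rightarrow> riemann_sphere set" where
  "path_julia \<xi> = - fatou_set {traj \<xi> n | n. n \<ge> 1}"

definition TT :: "('v \<Rightarrow> 'v \<Rightarrow> rat_plus measure) \<Rightarrow> ('v \<Rightarrow> riemann_sphere set) \<Rightarrow>
    riemann_sphere \<Rightarrow> 'v \<Rightarrow> real" where
  "TT \<tau> L z i =
     measure (path_measure_from \<tau> i) {\<xi> \<in> space (path_borel \<tau>). tends_to \<xi> z L}"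

definition TT_avg :: "('v::finite \<Rightarrow> 'v \<Rightarrow> rat_plus measure) \<Rightarrow> ('v \<Rightarrow> riemann_sphere set) \<Rightarrow>
    riemann_sphere \<Rightarrow> real" where
  "TT_avg \<tau> L z = (\<Sum>i\<in>UNIV. stationary_vector \<tau> i * TT \<tau> L z i)"

end

theory Submission
  imports Defs "HOL-Complex_Analysis.Complex_Analysis" "HOL-Computational_Algebra.Fundamental_Theorem_Algebra"
begin

text \<open>
  Mean stability is first improved to a trapping region \<open>U \<subset> W\<close> that is forward invariant under
  single steps, by adding to the given one its first \<open>N\<close> full preimages. Since the degrees of the
  iterates of a map along a cycle are unbounded while uniformly close rational maps have the same
  degree, no Fatou set is the whole sphere; so after a rotation every \<open>W i\<close> is a bounded domain of
  the plane, and the Earle--Hamilton argument gives a uniform exponential contraction near \<open>U\<close>.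
  All minimal sets lie in \<open>U\<close>, hence are attracting, finite in number and pairwise disjoint, and every
  orbit closure contains one of them. Therefore a path enters a small neighbourhood of some minimal
  set with positive probability from anywhere, and by compactness and the Markov property it does so
  almost surely. From then on everything contracts towards that minimal set, which yields the almost
  sure statements; the continuity of \<open>TT\<close> follows by dominated convergence and the nullity of the
  Julia sets by Fubini.
\<close>



section \<open>Geometry of the sphere\<close>

text \<open>Mean stability speaks of words of length N only, whereas random paths must be controlled
  at every time; single-step invariance of the enlarged region bridges this, and equicontinuity on
  the Fatou sets takes care of the fewer than N maps left over. The regions \<open>W i\<close> may
  be disconnected, so hyperbolic metrics are avoided: once a point outside the closure of
  \<open>W i\<close> is moved to infinity, boundedness and Cauchy's estimate are enough. That all
  degrees are at least two matters at one place, in showing that no Fatou set is everything. The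
  target of the random paths is a neighbourhood of the minimal sets rather than \<open>U\<close>,
  since an entry then decides the limit as well as the contraction. The path measures and the
  stationary vector are given by definite descriptions, so existence and uniqueness have to be
  proved before anything can be said about them. A path is realized as a function of independent
  random choice functions, one for each time, which turns the Markov property into a splitting of an
  infinite product.\<close>

lemma stereo_proj_ratio:
  assumes "(a, b) \<noteq> (0, 0)"
  shows "stereo (proj_ratio a b) =
    ((2 / ((cmod a)\<^sup>2 + (cmod b)\<^sup>2)) *\<^sub>R (a * cnj b),
     ((cmod a)\<^sup>2 - (cmod b)\<^sup>2) / ((cmod a)\<^sup>2 + (cmod b)\<^sup>2))"
proof (cases "b = 0")
  case True
  with assms show ?thesis by (simp add: proj_ratio_def zero_prod_def)
next
  case False
  define A where "A = (cmod a)\<^sup>2"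
  define B where "B = (cmod b)\<^sup>2"
  have B: "B > 0" and A: "A \<ge> 0" using False by (auto simp: B_def A_def)
  have "(2 / (1 + (cmod (a / b))\<^sup>2)) *\<^sub>R (a / b) = (2 / (A + B)) *\<^sub>R (a * cnj b)"
  proof -
    have "a / b = (a * cnj b) / of_real B"
      using False by (simp add: B_def complex_norm_square field_simps del: of_real_power)
    moreover have "(cmod (a / b))\<^sup>2 = A / B" by (simp add: norm_divide power_divide A_def B_def)
    ultimately have "(2 / (1 + (cmod (a / b))\<^sup>2)) *\<^sub>R (a / b) = (2 / (1 + A / B)) *\<^sub>R ((1 / B) *\<^sub>R (a * cnj b))"
      by (simp only: scaleR_conv_of_real) simp
    also have "\<dots> = (2 / (A + B)) *\<^sub>R (a * cnj b)"
      using A B by (simp add: field_simps)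
    finally show ?thesis .
  qed
  moreover have "((cmod (a / b))\<^sup>2 - 1) / ((cmod (a / b))\<^sup>2 + 1) = (A - B) / (A + B)"
  proof -
    have "((cmod (a / b))\<^sup>2 - 1) / ((cmod (a / b))\<^sup>2 + 1) = (A / B - 1) / (A / B + 1)"
      by (simp add: norm_divide power_divide A_def B_def)
    also have "\<dots> = (A - B) / (A + B)" using A B by (simp add: divide_simps)
    finally show ?thesis .
  qed
  ultimately show ?thesis using False by (simp add: proj_ratio_def A_def B_def)
qed

lemma homogeneous_norm_pos: "(a, b) \<noteq> (0, 0) \<Longrightarrow> (cmod a)\<^sup>2 + (cmod b)\<^sup>2 > 0" for a b :: complex
  by (cases "a = 0") (auto intro: add_pos_nonneg)

text \<open>Homogeneous coordinates spare a separate case for infinity. The fraction is twice the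
  squared Hermitian product of two vectors of C^2 over their squared norms (Fubini--Study): unitary
  maps preserve it, and the total value -1, that is antipodality, means orthogonality.\<close>

lemma inner_stereo_proj_ratio:
  assumes "(a, b) \<noteq> (0, 0)" "(c, d) \<noteq> (0, 0)"
  shows "stereo (proj_ratio a b) \<bullet> stereo (proj_ratio c d) =
    2 * (cmod (a * cnj c + b * cnj d))\<^sup>2 /
      (((cmod a)\<^sup>2 + (cmod b)\<^sup>2) * ((cmod c)\<^sup>2 + (cmod d)\<^sup>2)) - 1"
proof -
  define M N where "M = (cmod a)\<^sup>2 + (cmod b)\<^sup>2" and "N = (cmod c)\<^sup>2 + (cmod d)\<^sup>2"
  have pos: "M > 0" "N > 0" using homogeneous_norm_pos assms by (auto simp: M_def N_def)
  have "stereo (proj_ratio a b) \<bullet> stereo (proj_ratio c d) =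
     (4 * ((a * cnj b) \<bullet> (c * cnj d)) + ((cmod a)\<^sup>2 - (cmod b)\<^sup>2) * ((cmod c)\<^sup>2 - (cmod d)\<^sup>2)) / (M * N)"
    using assms pos by (simp add: stereo_proj_ratio M_def[symmetric] N_def[symmetric] field_simps)
  also have "4 * ((a * cnj b) \<bullet> (c * cnj d)) + ((cmod a)\<^sup>2 - (cmod b)\<^sup>2) * ((cmod c)\<^sup>2 - (cmod d)\<^sup>2)
      = 2 * (cmod (a * cnj c + b * cnj d))\<^sup>2 - M * N"
    unfolding M_def N_def inner_complex_def cmod_power2 by simp algebra
  also have "\<dots> / (M * N) = 2 * (cmod (a * cnj c + b * cnj d))\<^sup>2 / (M * N) - 1"
    using pos by (simp add: diff_divide_distrib)
  finally show ?thesis by (simp add: M_def N_def)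
qed

lemma proj_ratio_scale: "s \<noteq> 0 \<Longrightarrow> proj_ratio (s * a) (s * b) = proj_ratio a b"
  by (simp add: proj_ratio_def)

lemma proj_ratio_cases:
  obtains (Finite) z where "x = Finite z" "x = proj_ratio z 1"
  | (Infinity) "x = Infinity" "x = proj_ratio 1 0"
  by (cases x) (auto simp: proj_ratio_def)

lemma proj_ratio_surj:
  obtains a b where "(a, b) \<noteq> (0, 0)" "x = proj_ratio a b"
proof (cases x rule: proj_ratio_cases)
  case (Finite z)
  with that[of z 1] show thesis by simp
next
  case Infinity
  with that[of 1 0] show thesis by simp
qed

lemma abs_inner_stereo_le: "\<bar>stereo x \<bullet> stereo y\<bar> \<le> 1"
  using Cauchy_Schwarz_ineq2[of "stereo x" "stereo y"] by (simp add: norm_stereo)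

lemma cos_dist_sphere: "cos (dist x y) = stereo x \<bullet> stereo y"
  by (simp add: dist_riemann_sphere_def cos_arccos_abs abs_inner_stereo_le)

lemma norm_stereo_diff: "(norm (stereo x - stereo y))\<^sup>2 = 2 - 2 * cos (dist x y)"
proof -
  have "stereo w \<bullet> stereo w = 1" for w
    using norm_stereo[of w] by (simp add: dot_square_norm)
  then show ?thesis
    by (simp add: power2_norm_eq_inner inner_diff_left inner_diff_right inner_commute cos_dist_sphere)
qed

text \<open>The slope 1/2 is the cosine of pi/3: up to there sin x - x/2 increases, and beyond it
  sin x > 0.85 while x/2 is at most pi/4 < 0.8.\<close>

lemma sin_ge_half:
  fixes x :: real
  assumes "0 \<le> x" "x \<le> pi / 2"
  shows "x / 2 \<le> sin x"
proof (cases "x \<le> pi / 3")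
  case True
  have "sin 0 - 0 / 2 \<le> sin x - x / 2"
  proof (rule DERIV_nonneg_imp_nondecreasing[OF assms(1)])
    fix t assume t: "0 \<le> t" "t \<le> x"
    have "cos (pi / 3) \<le> cos t" using t True by (intro cos_monotone_0_pi_le) auto
    then show "\<exists>y. ((\<lambda>x. sin x - x / 2) has_real_derivative y) (at t) \<and> 0 \<le> y"
      by (intro exI[of _ "cos t - 1/2"] conjI derivative_eq_intros) (auto simp: cos_60)
  qed
  then show ?thesis by simp
next
  case False
  have "sin (pi / 3) \<le> sin x" using False assms by (intro sin_monotone_2pi_le) auto
  moreover have "sin (pi/3) \<ge> (0.85::real)"
    unfolding sin_60 using real_le_rsqrt[of "1.7" 3] by (simp add: power2_eq_square)
  moreover have "x / 2 \<le> 0.8" using assms pi_less_4 pi_approx by simp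
  ultimately show ?thesis by simp
qed

text \<open>The chord under an arc of length t is 2 sin(t/2). Together with
  \<open>dist_sphere_le\<close> this makes arc length and chord bi-Lipschitz equivalent, so
  topological questions can be settled after applying \<open>stereo\<close>.\<close>

lemma norm_stereo_diff_le: "norm (stereo x - stereo y) \<le> dist x y"
proof -
  have "(norm (stereo x - stereo y))\<^sup>2 = (2 * sin (dist x y / 2))\<^sup>2"
    unfolding norm_stereo_diff using cos_double_sin[of "dist x y / 2"] by (simp add: power2_eq_square)
  then have "sqrt ((norm (stereo x - stereo y))\<^sup>2) = sqrt ((2 * sin (dist x y / 2))\<^sup>2)" by (rule arg_cong)
  then have "norm (stereo x - stereo y) = \<bar>2 * sin (dist x y / 2)\<bar>"
    unfolding real_sqrt_abs by simp
  also have "\<dots> \<le> dist x y" using abs_sin_x_le_abs_x[of "dist x y / 2"] by simp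
  finally show ?thesis .
qed

lemma dist_sphere_le: "dist x y \<le> 2 * norm (stereo x - stereo y)"
proof -
  have "dist x y / 4 \<le> sin (dist x y / 2)"
    using sin_ge_half[of "dist x y / 2"] dist_riemann_sphere_le_pi[of x y] by simp
  moreover have "(norm (stereo x - stereo y))\<^sup>2 = (2 * sin (dist x y / 2))\<^sup>2"
    unfolding norm_stereo_diff using cos_double_sin[of "dist x y / 2"] by (simp add: power2_eq_square)
  then have "sqrt ((norm (stereo x - stereo y))\<^sup>2) = sqrt ((2 * sin (dist x y / 2))\<^sup>2)" by (rule arg_cong)
  then have "norm (stereo x - stereo y) = \<bar>2 * sin (dist x y / 2)\<bar>"
    unfolding real_sqrt_abs by simp
  ultimately show ?thesis by simp
qed

section \<open>Topology of the sphere, transported from the unit sphere\<close>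

lemma tendsto_stereo_iff: "((\<lambda>x. stereo (f x)) \<longlongrightarrow> stereo l) F \<longleftrightarrow> (f \<longlongrightarrow> l) F"
proof
  assume "((\<lambda>x. stereo (f x)) \<longlongrightarrow> stereo l) F"
  then have "((\<lambda>x. 2 *\<^sub>R stereo (f x)) \<longlongrightarrow> 2 *\<^sub>R stereo l) F"
    by (intro tendsto_intros)
  moreover have "dist (f x) l \<le> dist (2 *\<^sub>R stereo (f x)) (2 *\<^sub>R stereo l)" for x
    using dist_sphere_le[of "f x" l] by (simp add: dist_norm scaleR_diff_right[symmetric] del: scaleR_diff_right)
  ultimately show "(f \<longlongrightarrow> l) F" by (rule metric_tendsto_imp_tendsto[OF _ always_eventually[OF allI]])
next
  assume "(f \<longlongrightarrow> l) F"
  moreover have "dist (stereo (f x)) (stereo l) \<le> dist (f x) l" for x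
    using norm_stereo_diff_le[of "f x" l] by (simp add: dist_norm)
  ultimately show "((\<lambda>x. stereo (f x)) \<longlongrightarrow> stereo l) F"
    by (rule metric_tendsto_imp_tendsto[OF _ always_eventually[OF allI]])
qed

lemma stereo_surj: "norm p = 1 \<Longrightarrow> \<exists>x. stereo x = p"
proof (cases "snd p = 1")
  case True
  moreover assume n: "norm p = 1"
  ultimately have "fst p = 0"
    by (cases p) (auto simp: norm_Pair real_sqrt_eq_1_iff)
  with True show ?thesis by (intro exI[of _ Infinity]) (simp add: prod_eq_iff)
next
  case False
  assume n: "norm p = 1"
  obtain w t where p: "p = (w, t)" by (cases p)
  have wt: "(cmod w)\<^sup>2 + t\<^sup>2 = 1" using n p by (simp add: norm_Pair real_sqrt_eq_1_iff)
  have t: "1 - t \<noteq> 0" using False p by simp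
  have "t\<^sup>2 \<le> 1" using wt zero_le_power2[of "cmod w"] by linarith
  then have t': "1 - t > 0" using t by (simp add: power2_le_iff_abs_le abs_square_le_1)
  have c: "(cmod (w / of_real (1 - t)))\<^sup>2 = (1 + t) / (1 - t)"
  proof -
    have "(cmod (w / of_real (1 - t)))\<^sup>2 = (1 - t\<^sup>2) / (1 - t)\<^sup>2"
      using wt by (simp add: norm_divide power_divide eq_diff_eq del: of_real_diff)
    also have "\<dots> = (1 + t) / (1 - t)" using t by (simp add: power2_eq_square divide_simps) algebra
    finally show ?thesis .
  qed
  have c1: "1 + (1 + t) / (1 - t) = 2 / (1 - t)" using t by (simp add: divide_simps)
  have c2: "((1 + t) / (1 - t) - 1) / ((1 + t) / (1 - t) + 1) = t" using t by (simp add: divide_simps)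
  have "stereo (Finite (w / of_real (1 - t))) = p"
    unfolding stereo.simps c c1 c2 p using t by (simp add: scaleR_conv_of_real)
  then show ?thesis by blast
qed

text \<open>The inverse of \<open>stereo\<close> is continuous on the unit sphere because limits may
  be tested after \<open>stereo\<close>; its image is everything.\<close>

lemma compact_UNIV_sphere: "compact (UNIV :: riemann_sphere set)"
proof -
  define g where "g = (\<lambda>p. SOME x. stereo x = p)"
  have g: "stereo (g p) = p" if "norm p = 1" for p
    unfolding g_def using someI_ex[OF stereo_surj[OF that]] .
  have "continuous_on (sphere 0 1) g"
    unfolding continuous_on_def
  proof
    fix p :: "complex \<times> real" assume p: "p \<in> sphere 0 1"
    have "((\<lambda>q. stereo (g q)) \<longlongrightarrow> stereo (g p)) (at p within sphere 0 1)"
    proof (rule Lim_transform_eventually)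
      show "((\<lambda>q. q) \<longlongrightarrow> stereo (g p)) (at p within sphere 0 1)"
        using g[of p] p by (simp add: tendsto_ident_at)
      show "\<forall>\<^sub>F q in at p within sphere 0 1. q = stereo (g q)"
        unfolding eventually_at_filter by (intro always_eventually) (auto simp: g)
    qed
    then show "(g \<longlongrightarrow> g p) (at p within sphere 0 1)" by (simp add: tendsto_stereo_iff)
  qed
  then have "compact (g ` sphere 0 1)" by (intro compact_continuous_image) auto
  moreover have "g ` sphere 0 1 = UNIV"
  proof -
    have "x \<in> g ` sphere 0 1" for x
    proof
      show "x = g (stereo x)" using g[of "stereo x"] norm_stereo[of x] by (simp add: stereo_inject)
    qed (simp add: norm_stereo)
    then show ?thesis by blast
  qed
  ultimately show ?thesis by simp
qed

instance riemann_sphere :: heine_borel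
proof
  fix f :: "nat \<Rightarrow> riemann_sphere"
  have "seq_compact (UNIV :: riemann_sphere set)"
    using compact_UNIV_sphere by (simp add: compact_eq_seq_compact_metric)
  then show "\<exists>l r. strict_mono (r::nat\<Rightarrow>nat) \<and> (f \<circ> r) \<longlonglongrightarrow> l"
    by (rule seq_compactE[of _ f]) auto
qed

lemma compact_sphere_iff: "compact A \<longleftrightarrow> closed A" for A :: "riemann_sphere set"
  using closed_Int_compact[OF _ compact_UNIV_sphere, of A] compact_imp_closed by auto

text \<open>Serves both second-countability instances, that of the sphere and that of the space of
  rational maps.\<close>

lemma countable_dense_imp_basis:
  fixes D :: "'a::metric_space set"
  assumes "countable D" "\<And>x e. e > 0 \<Longrightarrow> \<exists>y\<in>D. dist x y < e"
  shows "\<exists>B::'a set set. countable B \<and> open = generate_topology B"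
proof -
  define B where "B = (\<lambda>(y, n). ball y (1 / Suc n)) ` (D \<times> UNIV)"
  have "topological_basis B"
  proof (rule topological_basisI)
    fix A x assume A: "open (A::'a set)" "x \<in> A"
    then obtain e where e: "e > 0" "ball x e \<subseteq> A" by (meson openE)
    obtain n where n: "1 / Suc n < e / 2" using e nat_approx_posE[of "e/2"] by auto
    obtain y where y: "y \<in> D" "dist x y < 1 / Suc n" using assms(2)[of "1 / Suc n" x] by auto
    have "ball y (1 / Suc n) \<subseteq> ball x e"
    proof
      fix z assume "z \<in> ball y (1 / Suc n)"
      then have "dist y z < 1 / Suc n" by simp
      with y n dist_triangle[of x z y] show "z \<in> ball x e" by (simp add: dist_commute)
    qed
    with y e show "\<exists>B'\<in>B. x \<in> B' \<and> B' \<subseteq> A"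
      by (intro bexI[of _ "ball y (1 / Suc n)"]) (auto simp: B_def dist_commute)
  qed (auto simp: B_def)
  moreover have "countable B" unfolding B_def using assms(1) by auto
  ultimately show ?thesis using topological_basis_imp_subbasis by blast
qed

lemma sphere_finite_net:
  assumes "e > 0"
  obtains X :: "riemann_sphere set" where "finite X" "\<And>x. \<exists>y\<in>X. dist x y < e"
proof -
  obtain X where X: "finite X" "(UNIV::riemann_sphere set) \<subseteq> (\<Union>y\<in>X. ball y e)"
    using compact_UNIV_sphere assms unfolding compact_eq_totally_bounded by blast
  show thesis
  proof (rule that[OF X(1)])
    fix x show "\<exists>y\<in>X. dist x y < e" using X(2) by (auto simp: dist_commute dest!: subsetD[of UNIV _ x])
  qed
qed

instance riemann_sphere :: second_countable_topology
proof
  have "\<exists>X. finite X \<and> (\<forall>x::riemann_sphere. \<exists>y\<in>X. dist x y < 1 / Suc n)" for n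
    using sphere_finite_net[of "1 / Suc n"] by (metis zero_less_divide_1_iff of_nat_0_less_iff zero_less_Suc)
  then obtain X where X: "\<And>n. finite (X n)" "\<And>n (x::riemann_sphere). \<exists>y\<in>X n. dist x y < 1 / Suc n"
    by metis
  show "\<exists>B::riemann_sphere set set. countable B \<and> open = generate_topology B"
  proof (rule countable_dense_imp_basis)
    show "countable (\<Union>n. X n)" using X by (auto intro: countable_finite)
    fix x :: riemann_sphere and e :: real assume "e > 0"
    then obtain n where "1 / Suc n < e" using nat_approx_posE by blast
    with X(2)[of n x] show "\<exists>y\<in>(\<Union>n. X n). dist x y < e" by force
  qed
qed

lemma tendsto_proj_ratio:
  assumes "(f \<longlongrightarrow> a) F" "(g \<longlongrightarrow> b) F" "(a, b) \<noteq> (0, 0)"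
  shows "((\<lambda>x. proj_ratio (f x) (g x)) \<longlongrightarrow> proj_ratio a b) F"
proof -
  have pos: "(cmod a)\<^sup>2 + (cmod b)\<^sup>2 > 0" using homogeneous_norm_pos[OF assms(3)] .
  have lim: "((\<lambda>x. (cmod (f x))\<^sup>2 + (cmod (g x))\<^sup>2) \<longlongrightarrow> (cmod a)\<^sup>2 + (cmod b)\<^sup>2) F"
    by (intro tendsto_intros assms)
  then have ev: "\<forall>\<^sub>F x in F. (cmod (f x))\<^sup>2 + (cmod (g x))\<^sup>2 > 0"
    using pos by (rule order_tendstoD)
  have "((\<lambda>x. ((2 / ((cmod (f x))\<^sup>2 + (cmod (g x))\<^sup>2)) *\<^sub>R (f x * cnj (g x)),
     ((cmod (f x))\<^sup>2 - (cmod (g x))\<^sup>2) / ((cmod (f x))\<^sup>2 + (cmod (g x))\<^sup>2))) \<longlongrightarrow> stereo (proj_ratio a b)) F"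
    unfolding stereo_proj_ratio[OF assms(3)] using pos by (intro tendsto_intros assms) auto
  then have "((\<lambda>x. stereo (proj_ratio (f x) (g x))) \<longlongrightarrow> stereo (proj_ratio a b)) F"
  proof (rule Lim_transform_eventually)
    show "\<forall>\<^sub>F x in F. ((2 / ((cmod (f x))\<^sup>2 + (cmod (g x))\<^sup>2)) *\<^sub>R (f x * cnj (g x)),
     ((cmod (f x))\<^sup>2 - (cmod (g x))\<^sup>2) / ((cmod (f x))\<^sup>2 + (cmod (g x))\<^sup>2)) = stereo (proj_ratio (f x) (g x))"
      using ev by eventually_elim (subst stereo_proj_ratio, auto)
  qed
  then show ?thesis by (simp add: tendsto_stereo_iff)
qed

lemma continuous_on_Finite: "continuous_on A Finite"
proof -
  have "((\<lambda>x. proj_ratio x 1) \<longlongrightarrow> proj_ratio z 1) (at z within A)" for z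
    by (intro tendsto_proj_ratio tendsto_intros) auto
  then show ?thesis unfolding continuous_on_def by (simp add: proj_ratio_def)
qed

text \<open>Carries Euclidean estimates in a chart over to the sphere. By Lagrange's identity the
  squared chord is 4|z-w|^2 divided by (1+|z|^2)(1+|w|^2); passing from chord to arc costs another
  factor 2.\<close>

lemma dist_Finite_le: "dist (Finite z) (Finite w) \<le> 4 * cmod (z - w)"
proof -
  define M N where "M = 1 + (cmod z)\<^sup>2" and "N = 1 + (cmod w)\<^sup>2"
  have pos: "M \<ge> 1" "N \<ge> 1" by (auto simp: M_def N_def)
  have "(norm (stereo (Finite z) - stereo (Finite w)))\<^sup>2 = 4 - 4 * (cmod (z * cnj w + 1))\<^sup>2 / (M * N)"
    using inner_stereo_proj_ratio[of z 1 w 1] unfolding norm_stereo_diff cos_dist_sphere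
    by (simp add: proj_ratio_def M_def N_def add.commute)
  also have "\<dots> = 4 * (M * N - (cmod (z * cnj w + 1))\<^sup>2) / (M * N)"
    using pos by (simp add: field_simps)
  also have "M * N - (cmod (z * cnj w + 1))\<^sup>2 = (cmod (z - w))\<^sup>2"
    unfolding M_def N_def cmod_power2 by simp algebra
  also have "4 * (cmod (z - w))\<^sup>2 / (M * N) \<le> 4 * (cmod (z - w))\<^sup>2"
  proof -
    have "1 \<le> M * N" using pos mult_mono[of 1 M 1 N] by simp
    then show ?thesis by (intro divide_le_eq[THEN iffD2]) (auto simp: mult_le_cancel_left1 intro: mult_nonneg_nonneg)
  qed
  also have "\<dots> = (2 * cmod (z - w))\<^sup>2" by (simp add: power2_eq_square)
  finally have "norm (stereo (Finite z) - stereo (Finite w)) \<le> 2 * cmod (z - w)"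
    by (rule power2_le_imp_le) simp
  with dist_sphere_le[of "Finite z" "Finite w"] show ?thesis by simp
qed

section \<open>The two affine charts of the sphere\<close>

definition fin_coord :: "riemann_sphere \<Rightarrow> complex" where
  "fin_coord x = fst (stereo x) / of_real (1 - snd (stereo x))"

text \<open>The coordinate 1/z around infinity. Both charts are expressed through
  \<open>stereo\<close>, from which they inherit continuity; at the point that a chart omits,
  division by zero gives the value 0.\<close>

definition inf_coord :: "riemann_sphere \<Rightarrow> complex" where
  "inf_coord x = cnj (fst (stereo x)) / of_real (1 + snd (stereo x))"

lemma fin_coord_Finite [simp]: "fin_coord (Finite z) = z"
proof -
  have p: "1 + (cmod z)\<^sup>2 > 0" by (simp add: add_pos_nonneg)
  have a: "1 - snd (stereo (Finite z)) = 2 / (1 + (cmod z)\<^sup>2)"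
    using p by (simp add: field_simps)
  show ?thesis unfolding fin_coord_def a using p
    by (simp add: scaleR_conv_of_real del: of_real_add of_real_divide)
qed

lemma snd_stereo_eq_1: "snd (stereo x) = 1 \<longleftrightarrow> x = Infinity"
proof (cases x)
  case (Finite z)
  have "1 + (cmod z)\<^sup>2 > 0" by (simp add: add_pos_nonneg)
  then show ?thesis using Finite by (auto simp: field_simps)
qed auto

lemma snd_stereo_eq_minus_1: "1 + snd (stereo x) = 0 \<longleftrightarrow> x = Finite 0"
proof (cases x)
  case (Finite z)
  have "1 + (cmod z)\<^sup>2 > 0" by (simp add: add_pos_nonneg)
  then show ?thesis using Finite by (auto simp: field_simps)
qed auto

lemma continuous_fin_coord: "x \<noteq> Infinity \<Longrightarrow> isCont fin_coord x"
  unfolding fin_coord_def isCont_def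
  using snd_stereo_eq_1[of x] tendsto_stereo_iff[of "\<lambda>x. x" x "at x"]
  by (intro tendsto_intros) auto

lemma continuous_inf_coord: "x \<noteq> Finite 0 \<Longrightarrow> isCont inf_coord x"
  unfolding inf_coord_def isCont_def
  using snd_stereo_eq_minus_1[of x] tendsto_stereo_iff[of "\<lambda>x. x" x "at x"]
  by (intro tendsto_intros) (simp_all del: of_real_add)

lemma proj_ratio_fin_coord: "x \<noteq> Infinity \<Longrightarrow> proj_ratio (fin_coord x) 1 = x"
  by (cases x) (auto simp: proj_ratio_def)

lemma proj_ratio_inf_coord: "x \<noteq> Finite 0 \<Longrightarrow> proj_ratio 1 (inf_coord x) = x"
proof (cases x)
  case (Finite z)
  assume "x \<noteq> Finite 0"
  with Finite have z: "z \<noteq> 0" by auto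
  have p: "1 + (cmod z)\<^sup>2 > 0" by (simp add: add_pos_nonneg)
  have a: "1 + snd (stereo (Finite z)) = 2 * (cmod z)\<^sup>2 / (1 + (cmod z)\<^sup>2)"
    using p by (simp add: field_simps)
  have "inf_coord x = ((2 / (1 + (cmod z)\<^sup>2)) / (2 * (cmod z)\<^sup>2 / (1 + (cmod z)\<^sup>2))) *\<^sub>R cnj z"
    unfolding inf_coord_def Finite a
    by (simp only: stereo.simps fst_conv scaleR_conv_of_real complex_cnj_mult complex_cnj_complex_of_real of_real_divide times_divide_eq_left complex_cnj_divide)
  also have "(2 / (1 + (cmod z)\<^sup>2)) / (2 * (cmod z)\<^sup>2 / (1 + (cmod z)\<^sup>2)) = 1 / (cmod z)\<^sup>2"
    using p z by (simp add: divide_simps)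
  also have "(1 / (cmod z)\<^sup>2) *\<^sub>R cnj z = 1 / z"
    using z by (simp add: scaleR_conv_of_real complex_norm_square field_simps del: of_real_power)
  finally show ?thesis using z Finite by (simp add: proj_ratio_def)
qed (simp add: inf_coord_def proj_ratio_def)

lemma open_Compl_Infinity: "open (- {Infinity})" "open (- {Finite 0})"
  by auto


section \<open>Rational maps in homogeneous coordinates\<close>

text \<open>The homogenization of \<open>p\<close>. The degree \<open>d\<close> is an argument of
  its own because numerator and denominator must be homogenized to the same degree.\<close>

definition hom_poly :: "nat \<Rightarrow> complex poly \<Rightarrow> complex \<Rightarrow> complex \<Rightarrow> complex" where
  "hom_poly d p x y = (\<Sum>k\<le>d. coeff p k * x ^ k * y ^ (d - k))"

lemma hom_poly_nz:
  assumes "y \<noteq> 0" "degree p \<le> d"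
  shows "hom_poly d p x y = y ^ d * poly p (x / y)"
proof -
  have "poly p (x / y) = (\<Sum>k\<le>d. coeff p k * (x / y) ^ k)"
    unfolding poly_altdef using assms(2)
    by (intro sum.mono_neutral_left) (auto simp: coeff_eq_0)
  also have "y ^ d * \<dots> = (\<Sum>k\<le>d. coeff p k * x ^ k * y ^ (d - k))"
    unfolding sum_distrib_left
    by (intro sum.cong refl) (use assms(1) in \<open>simp add: power_divide power_diff\<close>)
  finally show ?thesis by (simp add: hom_poly_def)
qed

lemma hom_poly_1: "degree p \<le> d \<Longrightarrow> hom_poly d p x 1 = poly p x"
  by (simp add: hom_poly_nz)

lemma hom_poly_0: "hom_poly d p x 0 = coeff p d * x ^ d"
proof -
  have "hom_poly d p x 0 = (\<Sum>k\<le>d. if k = d then coeff p k * x ^ k else 0)"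
    unfolding hom_poly_def by (intro sum.cong) (auto simp: power_0_left)
  then show ?thesis by simp
qed

lemma tendsto_hom_poly:
  "(f \<longlongrightarrow> a) F \<Longrightarrow> (g \<longlongrightarrow> b) F \<Longrightarrow> ((\<lambda>x. hom_poly d p (f x) (g x)) \<longlongrightarrow> hom_poly d p a b) F"
  unfolding hom_poly_def by (intro tendsto_intros)

text \<open>Having no common zero in C^2 outside the origin expresses two things at once: a common
  factor would be a zero (z, 1), and a \<open>d\<close> larger than both degrees would make (1, 0) a
  zero.\<close>

definition hom_pair :: "nat \<Rightarrow> complex poly \<Rightarrow> complex poly \<Rightarrow> bool" where
  "hom_pair d P Q \<longleftrightarrow> degree P \<le> d \<and> degree Q \<le> d \<and>
     (\<forall>x y. (x, y) \<noteq> (0, 0) \<longrightarrow> (hom_poly d P x y, hom_poly d Q x y) \<noteq> (0, 0))"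

lemma hom_pairD:
  assumes "hom_pair d P Q"
  shows "degree P \<le> d" "degree Q \<le> d"
    "(x, y) \<noteq> (0, 0) \<Longrightarrow> (hom_poly d P x y, hom_poly d Q x y) \<noteq> (0, 0)"
  using assms by (auto simp: hom_pair_def)

lemma hom_pair_of_coprime:
  assumes "coprime P Q" "max (degree P) (degree Q) = d"
  shows "hom_pair d P Q"
  unfolding hom_pair_def
proof (intro conjI allI impI)
  show deg: "degree P \<le> d" "degree Q \<le> d" using assms(2) by auto
  fix x y :: complex assume xy: "(x, y) \<noteq> (0, 0)"
  show "(hom_poly d P x y, hom_poly d Q x y) \<noteq> (0, 0)"
  proof (cases "y = 0")
    case False
    with coprime_poly_0[OF assms(1), of "x / y"] show ?thesis by (auto simp: hom_poly_nz deg)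
  next
    case True
    have "coeff P d \<noteq> 0 \<or> coeff Q d \<noteq> 0"
    proof (cases "d = 0")
      case True
      with assms(2) have "degree P = 0" "degree Q = 0" by auto
      then obtain a b where "P = [:a:]" "Q = [:b:]" by (auto elim!: degree_eq_zeroE)
      with assms(1) show ?thesis using True by auto
    next
      case False
      have "degree P = d \<or> degree Q = d" using assms(2) by (auto simp: max_def split: if_splits)
      then show ?thesis using False leading_coeff_0_iff[of P] leading_coeff_0_iff[of Q] by auto
    qed
    with True xy show ?thesis by (auto simp: hom_poly_0)
  qed
qed

text \<open>The point (1, 0) fixes the degree and the points (z, 1) exclude common roots; over the
  complex numbers a nonconstant common divisor would have a root.\<close>

lemma hom_pair_imp_coprime:
  assumes "hom_pair d P Q"
  shows "coprime P Q" "max (degree P) (degree Q) = d"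
proof -
  have "coeff P d \<noteq> 0 \<or> coeff Q d \<noteq> 0"
    using hom_pairD(3)[OF assms, of 1 0] by (auto simp: hom_poly_0)
  then show "max (degree P) (degree Q) = d"
    using le_degree[of P d] le_degree[of Q d] hom_pairD(1,2)[OF assms] by auto
  have nr: "\<not> (poly P z = 0 \<and> poly Q z = 0)" for z
    using hom_pairD(3)[OF assms, of z 1] hom_pairD(1,2)[OF assms] by (auto simp: hom_poly_1)
  show "coprime P Q"
  proof (rule coprimeI)
    fix g assume g: "g dvd P" "g dvd Q"
    have "\<not> (\<exists>z. poly g z = 0)" using nr g by (meson dvd_trans poly_eq_0_iff_dvd)
    then have "degree g = 0" using alg_closed_imp_poly_has_root[of g] by auto
    then obtain c where c: "g = [:c:]" by (auto elim: degree_eq_zeroE)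
    with \<open>\<not> (\<exists>z. poly g z = 0)\<close> have "c \<noteq> 0" by auto
    then show "is_unit g" unfolding c by (simp add: is_unit_const_poly_iff dvd_field_iff)
  qed
qed

lemma rational_map_of_degree_iff:
  "rational_map_of_degree d f \<longleftrightarrow> (\<exists>P Q. hom_pair d P Q \<and> f = rational_fun P Q)"
  unfolding rational_map_of_degree_def using hom_pair_of_coprime hom_pair_imp_coprime by metis

lemma rational_fun_proj_ratio:
  assumes "hom_pair d P Q" "(x, y) \<noteq> (0, 0)"
  shows "rational_fun P Q (proj_ratio x y) = proj_ratio (hom_poly d P x y) (hom_poly d Q x y)"
proof (cases "y = 0")
  case True
  then have "x \<noteq> 0" using assms(2) by auto
  then have "proj_ratio (hom_poly d P x y) (hom_poly d Q x y) = proj_ratio (coeff P d) (coeff Q d)"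
    using proj_ratio_scale[of "x ^ d" "coeff P d" "coeff Q d"] True by (simp add: hom_poly_0 mult.commute)
  then show ?thesis using True hom_pair_imp_coprime(2)[OF assms(1)]
    by (simp add: proj_ratio_def[of x 0] Let_def)
next
  case False
  then show ?thesis
    using hom_pairD(1,2)[OF assms(1)] proj_ratio_scale[of "y ^ d" "poly P (x / y)" "poly Q (x / y)"]
    by (simp add: hom_poly_nz proj_ratio_def[of x y])
qed

section \<open>Composition of rational maps and multiplicativity of the degree\<close>

lemma coeff_mult_top:
  fixes p q :: "complex poly"
  assumes "degree p \<le> a" "degree q \<le> b"
  shows "coeff (p * q) (a + b) = coeff p a * coeff q b"
proof (cases "degree p = a \<and> degree q = b")
  case True
  then show ?thesis using coeff_mult_degree_sum[of p q] by simp
next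
  case False
  then have "degree (p * q) < a + b" using assms degree_mult_le[of p q] by linarith
  moreover have "coeff p a = 0 \<or> coeff q b = 0" using False assms by (metis coeff_eq_0 le_neq_implies_less)
  ultimately show ?thesis by (auto simp: coeff_eq_0)
qed

lemma hom_poly_mult:
  assumes "degree p \<le> a" "degree q \<le> b"
  shows "hom_poly (a + b) (p * q) x y = hom_poly a p x y * hom_poly b q x y"
proof (cases "y = 0")
  case True
  then show ?thesis using assms by (simp add: hom_poly_0 coeff_mult_top power_add)
next
  case False
  have "degree (p * q) \<le> a + b" using assms degree_mult_le[of p q] by linarith
  then show ?thesis using False assms by (simp add: hom_poly_nz power_add)
qed

lemma degree_power_le': "degree p \<le> a \<Longrightarrow> degree (p ^ k) \<le> k * a" for p :: "complex poly"
  by (metis degree_power_le mult_le_mono1 mult.commute order_trans)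

lemma hom_poly_power:
  assumes "degree p \<le> a"
  shows "hom_poly (k * a) (p ^ k) x y = hom_poly a p x y ^ k"
proof (induction k)
  case 0
  show ?case by (simp add: hom_poly_def)
next
  case (Suc k)
  then show ?case
    using hom_poly_mult[OF assms degree_power_le'[OF assms, of k]] by simp
qed

definition hom_subst :: "nat \<Rightarrow> complex poly \<Rightarrow> complex poly \<Rightarrow> complex poly \<Rightarrow> complex poly" where
  "hom_subst d P R S = (\<Sum>k\<le>d. smult (coeff P k) (R ^ k * S ^ (d - k)))"

lemma hom_subst:
  assumes "degree R \<le> e" "degree S \<le> e"
  shows "degree (hom_subst d P R S) \<le> d * e"
    and "hom_poly (d * e) (hom_subst d P R S) x y = hom_poly d P (hom_poly e R x y) (hom_poly e S x y)"
proof -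
  have eq: "k * e + (d - k) * e = d * e" if "k \<le> d" for k
    using that by (metis add_mult_distrib le_add_diff_inverse)
  have deg: "degree (R ^ k * S ^ (d - k)) \<le> d * e" if "k \<le> d" for k
    using degree_mult_le[of "R ^ k" "S ^ (d - k)"] degree_power_le'[OF assms(1), of k]
      degree_power_le'[OF assms(2), of "d - k"] eq[OF that] by linarith
  show "degree (hom_subst d P R S) \<le> d * e"
    unfolding hom_subst_def
    using deg by (intro degree_sum_le order_trans[OF degree_smult_le]) auto
  have "hom_poly (d * e) (R ^ k * S ^ (d - k)) x y = hom_poly e R x y ^ k * hom_poly e S x y ^ (d - k)"
    if "k \<le> d" for k
    using hom_poly_mult[OF degree_power_le'[OF assms(1)] degree_power_le'[OF assms(2)], of k "d - k" x y] assms
    by (simp add: eq[OF that] hom_poly_power)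
  moreover have "hom_poly (d * e) (hom_subst d P R S) x y =
      (\<Sum>k\<le>d. coeff P k * hom_poly (d * e) (R ^ k * S ^ (d - k)) x y)"
    unfolding hom_subst_def hom_poly_def
    by (simp add: coeff_sum sum_distrib_left sum_distrib_right mult.assoc) (rule sum.swap)
  ultimately show "hom_poly (d * e) (hom_subst d P R S) x y = hom_poly d P (hom_poly e R x y) (hom_poly e S x y)"
    by (simp add: hom_poly_def[of d] mult.assoc)
qed

text \<open>Absence of common zeros outside the origin passes to compositions at once, so no
  cancellation has to be discussed and the degrees multiply.\<close>

lemma rational_map_comp:
  assumes "rational_map_of_degree d f" "rational_map_of_degree e g"
  shows "rational_map_of_degree (d * e) (f \<circ> g)"
proof -
  obtain P Q where PQ: "hom_pair d P Q" "f = rational_fun P Q"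
    using assms(1) by (auto simp: rational_map_of_degree_iff)
  obtain R S where RS: "hom_pair e R S" "g = rational_fun R S"
    using assms(2) by (auto simp: rational_map_of_degree_iff)
  note h = hom_subst[OF hom_pairD(1,2)[OF RS(1)]]
  have pair: "hom_pair (d * e) (hom_subst d P R S) (hom_subst d Q R S)"
    unfolding hom_pair_def using h hom_pairD(3)[OF PQ(1)] hom_pairD(3)[OF RS(1)] by simp
  moreover have "(f \<circ> g) x = rational_fun (hom_subst d P R S) (hom_subst d Q R S) x" for x
  proof -
    obtain a b where ab: "(a, b) \<noteq> (0, 0)" "x = proj_ratio a b" by (rule proj_ratio_surj)
    show ?thesis unfolding PQ(2) RS(2) ab(2) o_def
      by (simp only: rational_fun_proj_ratio[OF RS(1) ab(1)] rational_fun_proj_ratio[OF PQ(1) hom_pairD(3)[OF RS(1) ab(1)]]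
         rational_fun_proj_ratio[OF pair ab(1)] h)
  qed
  ultimately show ?thesis unfolding rational_map_of_degree_iff by blast
qed

lemma continuous_on_rational_map:
  assumes "rational_map_of_degree d f"
  shows "continuous_on A f"
proof -
  obtain P Q where PQ: "hom_pair d P Q" "f = rational_fun P Q"
    using assms(1) by (auto simp: rational_map_of_degree_iff)
  have "isCont f x" for x
  proof (cases "x = Infinity")
    case False
    have ev: "\<forall>\<^sub>F y in at x. y \<noteq> Infinity"
      using eventually_at_topological[of "\<lambda>y. y \<noteq> Infinity" x UNIV] open_Compl_Infinity(1) False
      by (metis ComplD ComplI insertI1 singletonD)
    have "((\<lambda>y. proj_ratio (hom_poly d P (fin_coord y) 1) (hom_poly d Q (fin_coord y) 1)) \<longlongrightarrow>
       proj_ratio (hom_poly d P (fin_coord x) 1) (hom_poly d Q (fin_coord x) 1)) (at x)"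
      using continuous_fin_coord[OF False] hom_pairD(3)[OF PQ(1), of "fin_coord x" 1]
      by (intro tendsto_proj_ratio tendsto_hom_poly tendsto_intros) (auto simp: isCont_def)
    then have "((\<lambda>y. f y) \<longlongrightarrow> f x) (at x)"
      unfolding PQ(2)
    proof (rule Lim_transform_eventually[OF tendsto_eq_rhs])
      show "proj_ratio (hom_poly d P (fin_coord x) 1) (hom_poly d Q (fin_coord x) 1) = rational_fun P Q x"
        using rational_fun_proj_ratio[OF PQ(1), of "fin_coord x" 1] proj_ratio_fin_coord[OF False] by simp
      show "\<forall>\<^sub>F y in at x. proj_ratio (hom_poly d P (fin_coord y) 1) (hom_poly d Q (fin_coord y) 1) = rational_fun P Q y"
        using ev by eventually_elim
          (metis rational_fun_proj_ratio[OF PQ(1)] proj_ratio_fin_coord prod.inject zero_neq_one)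
    qed
    then show ?thesis by (simp add: isCont_def)
  next
    case True
    then have n0: "x \<noteq> Finite 0" by simp
    have ev: "\<forall>\<^sub>F y in at x. y \<noteq> Finite 0"
      using eventually_at_topological[of "\<lambda>y. y \<noteq> Finite 0" x UNIV] open_Compl_Infinity(2) n0
      by (metis ComplD ComplI insertI1 singletonD)
    have "((\<lambda>y. proj_ratio (hom_poly d P 1 (inf_coord y)) (hom_poly d Q 1 (inf_coord y))) \<longlongrightarrow>
       proj_ratio (hom_poly d P 1 (inf_coord x)) (hom_poly d Q 1 (inf_coord x))) (at x)"
      using continuous_inf_coord[OF n0] hom_pairD(3)[OF PQ(1), of 1 "inf_coord x"]
      by (intro tendsto_proj_ratio tendsto_hom_poly tendsto_intros) (auto simp: isCont_def)
    then have "((\<lambda>y. f y) \<longlongrightarrow> f x) (at x)"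
      unfolding PQ(2)
    proof (rule Lim_transform_eventually[OF tendsto_eq_rhs])
      show "proj_ratio (hom_poly d P 1 (inf_coord x)) (hom_poly d Q 1 (inf_coord x)) = rational_fun P Q x"
        using rational_fun_proj_ratio[OF PQ(1), of 1 "inf_coord x"] proj_ratio_inf_coord[OF n0] by simp
      show "\<forall>\<^sub>F y in at x. proj_ratio (hom_poly d P 1 (inf_coord y)) (hom_poly d Q 1 (inf_coord y)) = rational_fun P Q y"
        using ev by eventually_elim
          (metis rational_fun_proj_ratio[OF PQ(1)] proj_ratio_inf_coord prod.inject zero_neq_one)
    qed
    then show ?thesis by (simp add: isCont_def)
  qed
  then show ?thesis by (simp add: continuous_at_imp_continuous_on)
qed

subsection \<open>Rotations of the sphere\<close>

text \<open>The Moebius map of the matrix with rows (a, b) and (- cnj b, cnj a), which for (a, b)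
  nonzero is a positive multiple of a unitary matrix.\<close>

definition rotation :: "complex \<Rightarrow> complex \<Rightarrow> riemann_sphere \<Rightarrow> riemann_sphere" where
  "rotation a b = rational_fun [:b, a:] [:cnj a, - cnj b:]"

lemma hom_poly_linear: "hom_poly (Suc 0) [:b, a:] x y = a * x + b * y"
  by (simp add: hom_poly_def)

lemma rotation_nondegenerate:
  assumes "(a, b) \<noteq> (0, 0)" "(x, y) \<noteq> (0, 0)"
  shows "(a * x + b * y, - cnj b * x + cnj a * y) \<noteq> (0, 0)"
proof
  assume "(a * x + b * y, - cnj b * x + cnj a * y) = (0, 0)"
  then have e: "a * x + b * y = 0" "cnj a * y = cnj b * x" by auto
  have "(a * cnj a + b * cnj b) * x = cnj a * (a * x + b * y) - b * (cnj a * y - cnj b * x)"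
    "(a * cnj a + b * cnj b) * y = cnj b * (a * x + b * y) + a * (cnj a * y - cnj b * x)"
    by algebra+
  then have "(a * cnj a + b * cnj b) * x = 0" "(a * cnj a + b * cnj b) * y = 0" using e by auto
  moreover have "a * cnj a + b * cnj b = of_real ((cmod a)\<^sup>2 + (cmod b)\<^sup>2)"
    by (simp add: complex_norm_square del: of_real_power)
  ultimately show False using homogeneous_norm_pos[OF assms(1)] assms(2)
    by (metis mult_eq_0_iff of_real_eq_0_iff less_irrefl)
qed

lemma hom_pair_rotation:
  assumes "(a, b) \<noteq> (0, 0)"
  shows "hom_pair 1 [:b, a:] [:cnj a, - cnj b:]"
  unfolding hom_pair_def using rotation_nondegenerate[OF assms] by (simp add: hom_poly_linear)

lemma rational_map_rotation:
  "(a, b) \<noteq> (0, 0) \<Longrightarrow> rational_map_of_degree 1 (rotation a b)"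
  unfolding rational_map_of_degree_iff rotation_def using hom_pair_rotation by blast

lemma rotation_proj_ratio:
  assumes "(a, b) \<noteq> (0, 0)" "(x, y) \<noteq> (0, 0)"
  shows "rotation a b (proj_ratio x y) = proj_ratio (a * x + b * y) (- cnj b * x + cnj a * y)"
  unfolding rotation_def rational_fun_proj_ratio[OF hom_pair_rotation[OF assms(1)] assms(2)]
  by (simp add: hom_poly_linear)

text \<open>The matrix multiplies Hermitian products and squared norms by the same \<open>s\<close>,
  which cancels in \<open>inner_stereo_proj_ratio\<close>.\<close>

lemma dist_rotation:
  assumes ab: "(a, b) \<noteq> (0, 0)"
  shows "dist (rotation a b p) (rotation a b q) = dist p q"
proof -
  obtain x y where xy: "(x, y) \<noteq> (0, 0)" "p = proj_ratio x y" by (rule proj_ratio_surj)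
  obtain z w where zw: "(z, w) \<noteq> (0, 0)" "q = proj_ratio z w" by (rule proj_ratio_surj)
  define s where "s = (cmod a)\<^sup>2 + (cmod b)\<^sup>2"
  have s: "s > 0" using homogeneous_norm_pos[OF ab] by (simp add: s_def)
  have n: "(cmod (a * x + b * y))\<^sup>2 + (cmod (- cnj b * x + cnj a * y))\<^sup>2 = s * ((cmod x)\<^sup>2 + (cmod y)\<^sup>2)" for x y
    unfolding s_def cmod_power2 by simp algebra
  have "(a * x + b * y) * cnj (a * z + b * w) + (- cnj b * x + cnj a * y) * cnj (- cnj b * z + cnj a * w)
     = (a * cnj a + b * cnj b) * (x * cnj z + y * cnj w)"
    by simp algebra
  also have "a * cnj a + b * cnj b = of_real s"
    by (simp add: complex_norm_square s_def del: of_real_power)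
  finally have i: "(cmod ((a * x + b * y) * cnj (a * z + b * w) + (- cnj b * x + cnj a * y) * cnj (- cnj b * z + cnj a * w)))\<^sup>2
     = s\<^sup>2 * (cmod (x * cnj z + y * cnj w))\<^sup>2"
    by (simp only: norm_mult power_mult_distrib norm_of_real power2_abs)
  have "stereo (rotation a b p) \<bullet> stereo (rotation a b q) = stereo p \<bullet> stereo q"
    unfolding xy(2) zw(2) rotation_proj_ratio[OF ab xy(1)] rotation_proj_ratio[OF ab zw(1)]
      inner_stereo_proj_ratio[OF xy(1) zw(1)]
      inner_stereo_proj_ratio[OF rotation_nondegenerate[OF ab xy(1)] rotation_nondegenerate[OF ab zw(1)]] i n
    using s by (simp add: power2_eq_square mult_ac)
  then show ?thesis by (simp add: dist_riemann_sphere_def)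
qed

lemma rotation_inverse:
  assumes ab: "(a, b) \<noteq> (0, 0)"
  shows "rotation (cnj a) (- b) (rotation a b p) = p"
proof -
  obtain x y where xy: "(x, y) \<noteq> (0, 0)" "p = proj_ratio x y" by (rule proj_ratio_surj)
  have ab': "(cnj a, - b) \<noteq> (0, 0)" using ab by auto
  have "a * cnj a + b * cnj b = of_real ((cmod a)\<^sup>2 + (cmod b)\<^sup>2)"
    by (simp add: complex_norm_square del: of_real_power)
  then have nz: "a * cnj a + b * cnj b \<noteq> 0"
    using homogeneous_norm_pos[OF ab] by (metis of_real_eq_0_iff less_irrefl)
  have "rotation (cnj a) (- b) (rotation a b p) =
     proj_ratio ((a * cnj a + b * cnj b) * x) ((a * cnj a + b * cnj b) * y)"
    unfolding xy(2) rotation_proj_ratio[OF ab xy(1)] rotation_proj_ratio[OF ab' rotation_nondegenerate[OF ab xy(1)]]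
    by (simp add: algebra_simps)
  then show ?thesis using proj_ratio_scale[OF nz] xy(2) by simp
qed

lemma ex_rotation:
  obtains \<rho> \<rho>' where "rational_map_of_degree 1 \<rho>" "rational_map_of_degree 1 \<rho>'"
    "\<And>p q. dist (\<rho> p) (\<rho> q) = dist p q" "\<And>p. \<rho>' (\<rho> p) = p" "\<And>p. \<rho> (\<rho>' p) = p" "\<rho> x = Infinity"
proof -
  obtain a b where ab: "(a, b) \<noteq> (0, 0)" "x = proj_ratio a b" by (rule proj_ratio_surj)
  have nz: "(cnj a, cnj b) \<noteq> (0, 0)" "(a, - cnj b) \<noteq> (0, 0)" using ab(1) by auto
  show thesis
  \<comment> \<open>For these parameters the second row of the matrix is (-b, a), which annihilates
    (a, b); so \<open>x\<close> goes to infinity.\<close>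
  proof (rule that[of "rotation (cnj a) (cnj b)" "rotation a (- cnj b)"])
    show "rotation a (- cnj b) (rotation (cnj a) (cnj b) p) = p" for p
      using rotation_inverse[OF nz(1)] by simp
    show "rotation (cnj a) (cnj b) (rotation a (- cnj b) p) = p" for p
      using rotation_inverse[OF nz(2)] by simp
    show "rotation (cnj a) (cnj b) x = Infinity"
      unfolding ab(2) rotation_proj_ratio[OF nz(1) ab(1)] by (simp add: proj_ratio_def mult.commute)
  qed (use rational_map_rotation dist_rotation nz in blast)+
qed

subsection \<open>Uniformly close rational maps have the same degree\<close>

text \<open>
  With \<open>f = P/Q\<close> and \<open>g = R/S\<close>, the function \<open>F = P * cnj R + Q * cnj S\<close> vanishes only where \<open>f\<close> and \<open>g\<close>
  are antipodal. So it has a continuous logarithm on the plane, and its winding number \<open>d - e\<close> along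
  large circles is zero.
\<close>

lemma degree_eq_of_close:
  assumes f: "rational_map_of_degree d f" and g: "rational_map_of_degree e g"
    and close: "\<And>z. dist (f z) (g z) < pi"
  shows "d = e"
proof -
  obtain P Q where PQ: "hom_pair d P Q" "f = rational_fun P Q"
    using f by (auto simp: rational_map_of_degree_iff)
  obtain R S where RS: "hom_pair e R S" "g = rational_fun R S"
    using g by (auto simp: rational_map_of_degree_iff)
  define H where "H = (\<lambda>x y. hom_poly d P x y * cnj (hom_poly e R x y) + hom_poly d Q x y * cnj (hom_poly e S x y))"
  have nz: "H x y \<noteq> 0" if xy: "(x, y) \<noteq> (0, 0)" for x y
  proof
    assume 0: "H x y = 0"
    have "cos (dist (f (proj_ratio x y)) (g (proj_ratio x y))) = -1"
      unfolding cos_dist_sphere PQ(2) RS(2) rational_fun_proj_ratio[OF PQ(1) xy] rational_fun_proj_ratio[OF RS(1) xy]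
       inner_stereo_proj_ratio[OF hom_pairD(3)[OF PQ(1) xy] hom_pairD(3)[OF RS(1) xy]]
      using 0 by (simp add: H_def)
    moreover have "cos pi < cos (dist (f (proj_ratio x y)) (g (proj_ratio x y)))"
      using close by (intro cos_monotone_0_pi) auto
    ultimately show False by simp
  qed
  define F where "F = (\<lambda>z. H z 1)"
  have contF: "continuous_on UNIV F"
    unfolding F_def H_def hom_poly_def by (intro continuous_intros)
  obtain G where G: "continuous_on UNIV G" "\<And>z. F z = exp (G z)"
  proof (rule continuous_logarithm_on_contractible[OF contF contractible_UNIV])
    show "F z \<noteq> 0" for z using nz[of z 1] by (simp add: F_def)
  qed auto
  define c where "c = H 1 0"
  have c: "c \<noteq> 0" using nz[of 1 0] by (simp add: c_def)
  \<comment> \<open>Near infinity \<open>F\<close> behaves like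
    \<open>c * (z ^ d * cnj z ^ e)\<close>, so \<open>q\<close> tends to 1 and on a large circle
    stays in the right half-plane, where the principal logarithm is continuous.\<close>
  define q where "q = (\<lambda>z. F z / (c * (z ^ d * cnj z ^ e)))"
  have "((\<lambda>z. H 1 (inverse z)) \<longlongrightarrow> H 1 0) at_infinity"
    unfolding H_def by (intro tendsto_intros tendsto_hom_poly tendsto_inverse_0)
  then have "((\<lambda>z. H 1 (inverse z) / c) \<longlongrightarrow> 1) at_infinity"
    using tendsto_divide[OF _ tendsto_const c] by (force simp: c_def c[unfolded c_def])
  then have "\<forall>\<^sub>F z in at_infinity. dist (H 1 (inverse z) / c) 1 < 1" by (rule tendstoD) simp
  then obtain b where b: "\<And>z. cmod z \<ge> b \<Longrightarrow> dist (H 1 (inverse z) / c) 1 < 1"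
    unfolding eventually_at_infinity by blast
  define r where "r = max b 1"
  have r: "r > 0" "r \<ge> b" by (auto simp: r_def)
  have qH: "q z = H 1 (inverse z) / c" if "z \<noteq> 0" for z
  proof -
    have "poly p z = z ^ k * hom_poly k p 1 (inverse z)" if "degree p \<le> k" for p k
      using \<open>z \<noteq> 0\<close> that by (simp add: hom_poly_nz field_simps)
    then have "F z = z ^ d * cnj z ^ e * H 1 (inverse z)"
      unfolding F_def H_def using hom_pairD(1,2)[OF PQ(1)] hom_pairD(1,2)[OF RS(1)]
      by (simp add: hom_poly_1 algebra_simps)
    then show ?thesis using that c by (simp add: q_def)
  qed
  define \<gamma> where "\<gamma> = (\<lambda>t::real. complex_of_real r * exp (\<i> * of_real t))"
  have \<gamma>: "cmod (\<gamma> t) = r" "\<gamma> t \<noteq> 0" for t using r by (auto simp: \<gamma>_def norm_mult)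
  have qpos: "Re (q (\<gamma> t)) > 0" for t
  proof -
    have "cmod (q (\<gamma> t) - 1) < 1" using b[of "\<gamma> t"] \<gamma> r qH by (simp add: dist_norm)
    then show ?thesis using abs_Re_le_cmod[of "q (\<gamma> t) - 1"] by simp
  qed
  \<comment> \<open>The difference of two logarithms of \<open>F\<close> along the circle: the
    global one, and the one assembled from the principal logarithm of \<open>q\<close> and the
    explicit argument (d - e) t. It takes values in 2 pi i Z, hence is constant; over one turn only
    the linear term changes, so d = e.\<close>
  define \<phi> where "\<phi> = (\<lambda>t. G (\<gamma> t) - Ln (q (\<gamma> t)) - \<i> * of_real ((real d - real e) * t) - Ln (c * of_real (r ^ (d + e))))"
  have cont\<gamma>: "continuous_on UNIV \<gamma>" unfolding \<gamma>_def by (intro continuous_intros)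
  have "continuous_on UNIV (\<lambda>t. q (\<gamma> t))"
    unfolding q_def using c \<gamma> by (intro continuous_intros continuous_on_compose2[OF contF cont\<gamma>] cont\<gamma>) auto
  moreover have "q (\<gamma> t) \<notin> \<real>\<^sub>\<le>\<^sub>0" for t using qpos[of t] by (auto simp: complex_nonpos_Reals_iff)
  ultimately have cont: "continuous_on UNIV \<phi>"
    unfolding \<phi>_def by (intro continuous_intros continuous_on_compose2[OF G(1) cont\<gamma>]) auto
  have ex1: "exp (\<phi> t) = 1" for t
  proof -
    have "q (\<gamma> t) \<noteq> 0" using qpos[of t] by auto
    then have "exp (\<phi> t) = F (\<gamma> t) / q (\<gamma> t) / exp (\<i> * of_real ((real d - real e) * t)) / (c * of_real (r ^ (d + e)))"
      using c r unfolding \<phi>_def by (simp add: exp_diff G(2)[symmetric])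
    also have "F (\<gamma> t) / q (\<gamma> t) = c * (\<gamma> t ^ d * cnj (\<gamma> t) ^ e)"
      using \<open>q (\<gamma> t) \<noteq> 0\<close> c \<gamma>(2)[of t] by (auto simp: q_def)
    also have "\<gamma> t ^ d * cnj (\<gamma> t) ^ e = of_real (r ^ (d + e)) * exp (\<i> * of_real ((real d - real e) * t))"
    proof -
      have "cnj (exp (\<i> * of_real t)) = exp (- (\<i> * of_real t))" by (simp add: exp_cnj)
      then have "\<gamma> t ^ d * cnj (\<gamma> t) ^ e = of_real r ^ (d + e) * (exp (of_nat d * (\<i> * of_real t)) * exp (of_nat e * (- (\<i> * of_real t))))"
        by (simp only: \<gamma>_def complex_cnj_mult complex_cnj_complex_of_real power_mult_distrib power_add exp_of_nat_mult) (simp add: mult_ac)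
      also have "exp (of_nat d * (\<i> * of_real t)) * exp (of_nat e * (- (\<i> * of_real t))) = exp (\<i> * of_real ((real d - real e) * t))"
        by (simp add: exp_add[symmetric] algebra_simps)
      finally show ?thesis by simp
    qed
    finally show ?thesis using c r by simp
  qed
  have "\<phi> constant_on UNIV"
  proof (rule continuous_discrete_range_constant[OF connected_UNIV cont])
    fix t :: real
    show "\<exists>\<epsilon>>0. \<forall>y. y \<in> UNIV \<and> \<phi> y \<noteq> \<phi> t \<longrightarrow> \<epsilon> \<le> norm (\<phi> y - \<phi> t)"
    proof (intro exI[of _ 1] conjI allI impI)
      fix y assume y: "y \<in> UNIV \<and> \<phi> y \<noteq> \<phi> t"
      have "exp (\<phi> y) = exp (\<phi> t)" by (simp add: ex1)
      then obtain n :: int where n: "\<phi> y = \<phi> t + of_int (2 * n) * pi * \<i>" unfolding exp_eq by blast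
      then have "n \<noteq> 0" using y by auto
      then have "\<bar>real_of_int n\<bar> \<ge> 1" by linarith
      then have "1 * 1 \<le> \<bar>real_of_int n\<bar> * (2 * pi)" using pi_gt3 by (intro mult_mono) auto
      then show "1 \<le> norm (\<phi> y - \<phi> t)" using n by (simp add: norm_mult abs_mult)
    qed simp
  qed
  then have "\<phi> 0 = \<phi> (2 * pi)" by (auto simp: constant_on_def)
  moreover have "\<gamma> 0 = \<gamma> (2 * pi)"
    unfolding \<gamma>_def using exp_two_pi_i by (simp add: mult_ac)
  ultimately have "(real d - real e) * (2 * pi) = 0"
    unfolding \<phi>_def by (simp add: complex_eq_iff)
  then show ?thesis by simp
qed


section \<open>The space of rational maps\<close>

lemma app_rational_map: obtains d where "d \<ge> 2" "rational_map_of_degree d (app f)"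
  using app[of f] by auto

lemma continuous_on_app: "continuous_on A (app f)"
  by (rule app_rational_map[of f]) (rule continuous_on_rational_map)

lemma dist_app_le: "dist (app f z) (app g z) \<le> dist f g"
  unfolding dist_rat_plus_def
  by (rule cSUP_upper) (auto intro!: bdd_aboveI2 dist_riemann_sphere_le_pi)

lemma dist_rat_plus_le: "(\<And>z. dist (app f z) (app g z) \<le> c) \<Longrightarrow> dist f g \<le> c"
  unfolding dist_rat_plus_def by (rule cSUP_least) auto

section \<open>Moduli of continuity, finite codes, separability\<close>

definition modulus :: "real \<Rightarrow> real \<Rightarrow> (riemann_sphere \<Rightarrow> riemann_sphere) \<Rightarrow> bool" where
  "modulus d e h \<longleftrightarrow> (\<forall>x y. dist x y < d \<longrightarrow> dist (h x) (h y) < e)"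

text \<open>Arzela--Ascoli at a single scale: the code of a function records its values on a d-net,
  rounded to an e-net. Equal codes leave four gaps of size e: from x to the net, rounding twice, and
  back to x. It yields two close iterates as well as a countable dense set of rational maps.\<close>

lemma ex_code:
  assumes "d > 0" "e > 0"
  obtains C :: "(riemann_sphere \<Rightarrow> riemann_sphere) \<Rightarrow> riemann_sphere \<Rightarrow> riemann_sphere" and K
  where "finite K" "\<And>f. C f \<in> K"
    "\<And>f g x. modulus d e f \<Longrightarrow> modulus d e g \<Longrightarrow> C f = C g \<Longrightarrow> dist (f x) (g x) < 4 * e"
proof -
  obtain X :: "riemann_sphere set" where X: "finite X" "\<And>x. \<exists>y\<in>X. dist x y < d"
    using sphere_finite_net[OF assms(1)] by blast
  obtain Y :: "riemann_sphere set" where Y: "finite Y" "\<And>x. \<exists>y\<in>Y. dist x y < e"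
    using sphere_finite_net[OF assms(2)] by blast
  define near where "near = (\<lambda>x. SOME y. y \<in> Y \<and> dist x y < e)"
  have near: "near x \<in> Y" "dist x (near x) < e" for x
    unfolding near_def using someI_ex[of "\<lambda>y. y \<in> Y \<and> dist x y < e"] Y(2)[of x] by auto
  define C where "C = (\<lambda>f. restrict (\<lambda>x. near (f x)) X)"
  show thesis
  proof (rule that[of "X \<rightarrow>\<^sub>E Y" C])
    show "finite (X \<rightarrow>\<^sub>E Y)" using X Y by (intro finite_PiE) auto
    show "C f \<in> X \<rightarrow>\<^sub>E Y" for f by (auto simp: C_def near)
    fix f g x assume fg: "modulus d e f" "modulus d e g" "C f = C g"
    obtain a where a: "a \<in> X" "dist x a < d" using X(2) by blast
    have "C f a = C g a" using fg(3) by simp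
    then have "near (f a) = near (g a)" using a(1) by (simp add: C_def)
    moreover have "dist (f x) (f a) < e" "dist (g x) (g a) < e"
      using fg(1,2) a(2) by (auto simp: modulus_def)
    ultimately show "dist (f x) (g x) < 4 * e"
      using near(2)[of "f a"] near(2)[of "g a"] dist_triangle[of "f x" "g x" "f a"]
        dist_triangle[of "f a" "g x" "near (f a)"] dist_triangle2[of "near (f a)" "g x" "g a"]
      by (simp add: dist_commute)
  qed
qed

lemma modulus_imp_close_pair:
  fixes h :: "nat \<Rightarrow> riemann_sphere \<Rightarrow> riemann_sphere"
  assumes "d > 0" "e > 0" "\<And>n. modulus d e (h n)"
  obtains m n where "m \<noteq> n" "\<And>x. dist (h m x) (h n x) < 4 * e"
proof -
  obtain C and K :: "(riemann_sphere \<Rightarrow> riemann_sphere) set" where C: "finite K" "\<And>f. C f \<in> K"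
    "\<And>f g x. modulus d e f \<Longrightarrow> modulus d e g \<Longrightarrow> C f = C g \<Longrightarrow> dist (f x) (g x) < 4 * e"
    using ex_code[OF assms(1,2)] by metis
  have "finite (range (\<lambda>n. C (h n)))" using C(1,2) by (auto intro: finite_subset)
  then have "\<not> inj (\<lambda>n. C (h n))" using finite_imageD infinite_UNIV_nat by blast
  then obtain m n where "m \<noteq> n" "C (h m) = C (h n)" by (auto simp: inj_def)
  with C(3)[OF assms(3) assms(3)] show thesis using that by blast
qed

lemma app_modulus:
  assumes "e > 0"
  obtains d where "d > 0" "modulus d e (app f)"
proof -
  have "uniformly_continuous_on UNIV (app f)"
    by (intro compact_uniformly_continuous continuous_on_app compact_UNIV_sphere)
  then show thesis using assms that unfolding uniformly_continuous_on_def modulus_def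
    by (metis UNIV_I dist_commute)
qed

text \<open>Second countability identifies the Borel sets of products with the product
  sigma-algebra, gives supports full measure, and makes cylinders generate the path space.\<close>

instance rat_plus :: second_countable_topology
proof
  define e where "e = (\<lambda>n::nat. 1 / real (Suc n))"
  have e: "e n > 0" for n by (simp add: e_def)
  have "\<exists>(C :: (riemann_sphere \<Rightarrow> riemann_sphere) \<Rightarrow> riemann_sphere \<Rightarrow> riemann_sphere) K. finite K \<and> (\<forall>f. C f \<in> K) \<and>
    (\<forall>f g x. modulus (e m) (e n) f \<longrightarrow> modulus (e m) (e n) g \<longrightarrow> C f = C g \<longrightarrow> dist (f x) (g x) < 4 * e n)"
    for m n
  proof (rule ex_code[OF e e, of m n])
    fix C and K :: "(riemann_sphere \<Rightarrow> riemann_sphere) set"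
    assume "finite K" "\<And>f. C f \<in> K"
      "\<And>f g x. modulus (e m) (e n) f \<Longrightarrow> modulus (e m) (e n) g \<Longrightarrow> C f = C g \<Longrightarrow> dist (f x) (g x) < 4 * e n"
    then show ?thesis by (intro exI[of _ C] exI[of _ K]) simp
  qed
  then obtain C and K :: "nat \<Rightarrow> nat \<Rightarrow> (riemann_sphere \<Rightarrow> riemann_sphere) set"
    where C: "\<And>m n. finite (K m n)" "\<And>m n f. C m n f \<in> K m n"
    "\<And>m n f g x. modulus (e m) (e n) f \<Longrightarrow> modulus (e m) (e n) g \<Longrightarrow> C m n f = C m n g \<Longrightarrow> dist (f x) (g x) < 4 * e n"
    by metis
  \<comment> \<open>One rational map is chosen for each code that occurs, so that the countable
    dense set consists of elements of the space itself.\<close>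
  define rep where "rep = (\<lambda>m n c. SOME f. modulus (e m) (e n) (app f) \<and> C m n (app f) = c)"
  show "\<exists>B::rat_plus set set. countable B \<and> open = generate_topology B"
  proof (rule countable_dense_imp_basis)
    show "countable (\<Union>m. \<Union>n. rep m n ` K m n)"
      using C(1) by (intro countable_UN countable_image) (auto intro: countable_finite)
    fix f :: rat_plus and \<epsilon> :: real assume \<epsilon>: "\<epsilon> > 0"
    obtain n where n: "e n < \<epsilon> / 4" using nat_approx_posE[of "\<epsilon> / 4"] \<epsilon> by (auto simp: e_def)
    obtain d where d: "d > 0" "modulus d (e n) (app f)" using app_modulus[OF e] by blast
    obtain m where m: "e m < d" using nat_approx_posE[OF d(1)] by (auto simp: e_def)
    have mf: "modulus (e m) (e n) (app f)" using d(2) m unfolding modulus_def by force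
    define g where "g = rep m n (C m n (app f))"
    have g: "modulus (e m) (e n) (app g) \<and> C m n (app g) = C m n (app f)"
      unfolding g_def rep_def by (rule someI[of _ f]) (use mf in auto)
    have "dist f g \<le> 4 * e n"
      using C(3)[OF mf] g by (intro dist_rat_plus_le less_imp_le) auto
    with n have "dist f g < \<epsilon>" by simp
    moreover have "g \<in> (\<Union>m. \<Union>n. rep m n ` K m n)" unfolding g_def using C(2) by blast
    ultimately show "\<exists>g\<in>(\<Union>m. \<Union>n. rep m n ` K m n). dist f g < \<epsilon>" by blast
  qed
qed

text \<open>The distance on maps is a supremum, so moving the map costs at most
  \<open>dist (fst p) f\<close>, uniformly in the point; the rest is continuity of the fixed map
  \<open>f\<close>.\<close>

lemma continuous_on_app_pair: "continuous_on A (\<lambda>p. app (fst p) (snd p))"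
proof -
  have "((\<lambda>p. app (fst p) (snd p)) \<longlongrightarrow> app f z) (at (f, z))" for f z
  proof -
    have "((\<lambda>p. app f (snd p)) \<longlongrightarrow> app f z) (at (f, z))"
      using continuous_on_app[of UNIV f] tendsto_snd[OF tendsto_ident_at, of "(f, z)" UNIV]
      by (intro continuous_on_tendsto_compose[of UNIV "app f" snd]) auto
    then have "((\<lambda>p. dist (fst p) f + dist (app f (snd p)) (app f z)) \<longlongrightarrow> dist f f + dist (app f z) (app f z)) (at (f, z))"
      using tendsto_fst[OF tendsto_ident_at, of "(f, z)" UNIV] by (intro tendsto_intros) auto
    then have "((\<lambda>p. dist (fst p) f + dist (app f (snd p)) (app f z)) \<longlongrightarrow> 0) (at (f, z))" by simp
    then have "((\<lambda>p. dist (app (fst p) (snd p)) (app f z)) \<longlongrightarrow> 0) (at (f, z))"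
    proof (rule tendsto_sandwich[rotated 3])
      have "dist (app (fst p) (snd p)) (app f z) \<le> dist (fst p) f + dist (app f (snd p)) (app f z)" for p
        using dist_triangle[of "app (fst p) (snd p)" "app f z" "app f (snd p)"]
          dist_app_le[of "fst p" "snd p" f] by linarith
      then show "\<forall>\<^sub>F p in at (f, z). dist (app (fst p) (snd p)) (app f z) \<le> dist (fst p) f + dist (app f (snd p)) (app f z)"
        by (intro always_eventually) auto
    qed (auto intro: tendsto_const)
    then show ?thesis by (simp add: tendsto_dist_iff[symmetric])
  qed
  then show ?thesis
    by (intro continuous_at_imp_continuous_on) (auto simp: isCont_def)
qed

lemma compact_imp_common_modulus:
  assumes "compact \<Gamma>" "e > 0"
  obtains d where "d > 0" "\<And>f. f \<in> \<Gamma> \<Longrightarrow> modulus d e (app f)"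
proof -
  have "uniformly_continuous_on (\<Gamma> \<times> UNIV) (\<lambda>p. app (fst p) (snd p))"
    by (intro compact_uniformly_continuous continuous_on_app_pair compact_Times assms compact_UNIV_sphere)
  then obtain d where d: "d > 0" "\<And>p q. p \<in> \<Gamma> \<times> UNIV \<Longrightarrow> q \<in> \<Gamma> \<times> UNIV \<Longrightarrow> dist q p < d \<Longrightarrow>
      dist (app (fst q) (snd q)) (app (fst p) (snd p)) < e"
    unfolding uniformly_continuous_on_def using assms(2) by metis
  show thesis
  proof (rule that[OF d(1)])
    fix f assume "f \<in> \<Gamma>"
    then show "modulus d e (app f)"
      unfolding modulus_def using d(2)[of "(f, y)" "(f, x)" for x y] by (auto simp: dist_Pair_Pair)
  qed
qed

section \<open>Compositions along admissible words\<close>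

text \<open>Compositions along admissible words, indexed by length, with the identity for the empty
  word. Induction on this relation replaces reasoning with pairs of lists;
  \<open>word_maps_eq\<close> and \<open>all_admissible_maps_iff\<close> lead back, with the length
  at least 1 because admissible words are nonempty.\<close>

inductive path_map :: "'v gdms \<Rightarrow> nat \<Rightarrow> 'v \<Rightarrow> 'v \<Rightarrow> (riemann_sphere \<Rightarrow> riemann_sphere) \<Rightarrow> bool"
  for S where
  path_map_0: "path_map S 0 i i id"
| path_map_Suc: "(i, j) \<in> edges S \<Longrightarrow> f \<in> gens S (i, j) \<Longrightarrow> path_map S n j k h \<Longrightarrow>
     path_map S (Suc n) i k (h \<circ> app f)"

lemma path_map_0_iff [simp]: "path_map S 0 i j h \<longleftrightarrow> j = i \<and> h = id"
  by (auto intro: path_map_0 elim: path_map.cases)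

lemma path_map_Suc_iff:
  "path_map S (Suc n) i k h \<longleftrightarrow>
     (\<exists>j f g. (i, j) \<in> edges S \<and> f \<in> gens S (i, j) \<and> path_map S n j k g \<and> h = g \<circ> app f)"
  by (rule iffI, erule path_map.cases) (auto intro: path_map_Suc)

lemma path_map_append:
  "path_map S m i j h \<Longrightarrow> path_map S n j k g \<Longrightarrow> path_map S (m + n) i k (g \<circ> h)"
proof (induction m arbitrary: i h)
  case (Suc m)
  from Suc.prems(1) obtain i' f h' where h': "(i, i') \<in> edges S" "f \<in> gens S (i, i')"
    "path_map S m i' j h'" "h = h' \<circ> app f"
    unfolding path_map_Suc_iff by blast
  from path_map_Suc[OF h'(1,2) Suc.IH[OF h'(3) Suc.prems(2)]] show ?case
    by (simp only: h'(4) comp_assoc add_Suc)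
qed simp

lemma path_map_split:
  assumes "path_map S (m + n) i k h"
  obtains j g g' where "path_map S m i j g" "path_map S n j k g'" "h = g' \<circ> g"
  using assms
proof (induction m arbitrary: i h thesis)
  case 0
  then show ?case by auto
next
  case (Suc m)
  from Suc.prems(2) obtain i' f h' where h': "(i, i') \<in> edges S" "f \<in> gens S (i, i')"
    "path_map S (m + n) i' k h'" "h = h' \<circ> app f"
    unfolding add_Suc path_map_Suc_iff by blast
  from Suc.IH[OF _ h'(3)] obtain j g g' where g: "path_map S m i' j g" "path_map S n j k g'" "h' = g' \<circ> g"
    by blast
  show ?case
    by (rule Suc.prems(1)[OF path_map_Suc[OF h'(1,2) g(1)] g(2)]) (simp only: h'(4) g(3) comp_assoc)
qed

lemma path_map_1: "(i, j) \<in> edges S \<Longrightarrow> f \<in> gens S (i, j) \<Longrightarrow> path_map S 1 i j (app f)"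
  using path_map_Suc[OF _ _ path_map_0, of i j S f] by simp

lemma path_map_snoc:
  "path_map S n i j h \<Longrightarrow> (j, k) \<in> edges S \<Longrightarrow> f \<in> gens S (j, k) \<Longrightarrow> path_map S (Suc n) i k (app f \<circ> h)"
  using path_map_append[OF _ path_map_1] by fastforce

lemma continuous_on_path_map: "path_map S n i j h \<Longrightarrow> continuous_on A h"
  by (induction arbitrary: A rule: path_map.induct)
     (auto simp del: comp_apply intro: continuous_on_id' intro!: continuous_on_compose continuous_on_app simp: id_def)

lemma comp_list_Cons: "comp_list (f # fs) = comp_list fs \<circ> app f"
proof -
  have "fold (\<lambda>f h. app f \<circ> h) fs k = comp_list fs \<circ> k" for k :: "riemann_sphere \<Rightarrow> riemann_sphere"
  proof (induction fs arbitrary: k)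
    case Nil
    show ?case by (simp add: comp_list_def)
  next
    case (Cons g fs)
    have "comp_list (g # fs) = comp_list fs \<circ> app g"
      using Cons.IH[of "app g"] by (simp only: comp_list_def fold_simps comp_id)
    then show ?case using Cons.IH[of "app g \<circ> k"] by (simp only: fold_simps comp_assoc)
  qed
  from this[of "app f"] show ?thesis by (simp add: comp_list_def)
qed

lemma admissible_Cons:
  "admissible S (e # es) \<longleftrightarrow> e \<in> edges S \<and> (es = [] \<or> snd e = fst (hd es) \<and> admissible S es)"
  unfolding admissible_def
  by (auto simp: hd_conv_nth less_Suc_eq_0_disj nth_Cons split: nat.splits)

lemma admissible_maps_Cons:
  "admissible_maps S (e # es) (f # fs) \<longleftrightarrow> e \<in> edges S \<and> f \<in> gens S e \<and>
     (es = [] \<and> fs = [] \<or> snd e = fst (hd es) \<and> admissible_maps S es fs)"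
  unfolding admissible_maps_def admissible_Cons by (auto simp: admissible_def)

lemma admissible_maps_imp_path_map:
  "admissible_maps S es fs \<Longrightarrow> path_map S (length es) (fst (hd es)) (snd (last es)) (comp_list fs)"
proof (induction es arbitrary: fs)
  case Nil
  then show ?case by (simp add: admissible_maps_def admissible_def)
next
  case (Cons e es)
  then obtain f fs' where fs: "fs = f # fs'"
    by (cases fs) (auto simp: admissible_maps_def)
  show ?case
  proof (cases "es = []")
    case True
    then show ?thesis
      using Cons.prems path_map_1[of "fst e" "snd e" S f]
      by (auto simp: fs admissible_maps_Cons comp_list_Cons comp_list_def[of "[]"] admissible_maps_def[of S "[]"] admissible_def)
  next
    case False
    then have a: "e \<in> edges S" "f \<in> gens S e" "snd e = fst (hd es)" "admissible_maps S es fs'"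
      using Cons.prems by (auto simp: fs admissible_maps_Cons)
    have e: "(fst e, fst (hd es)) = e" using a(3) by (metis prod.collapse)
    show ?thesis
      using path_map_Suc[OF _ _ Cons.IH[OF a(4)], of "fst e" f] a False
      by (simp only: fs comp_list_Cons e list.sel length_Cons last.simps if_False)
  qed
qed

lemma path_map_imp_admissible_maps:
  assumes "path_map S n i j h" "n \<ge> 1"
  shows "\<exists>es fs. admissible_maps S es fs \<and> length es = n \<and> fst (hd es) = i \<and> snd (last es) = j \<and> h = comp_list fs"
  using assms
proof (induction n arbitrary: i h)
  case (Suc n)
  from Suc.prems(1) obtain i' f h' where h': "(i, i') \<in> edges S" "f \<in> gens S (i, i')"
    "path_map S n i' j h'" "h = h' \<circ> app f"
    unfolding path_map_Suc_iff by blast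
  show ?case
  proof (cases "n = 0")
    case True
    then show ?thesis using h'
      by (intro exI[of _ "[(i, i')]"] exI[of _ "[f]"])
         (auto simp: admissible_maps_Cons comp_list_Cons comp_list_def)
  next
    case False
    with Suc.IH[OF h'(3)] obtain es fs where es: "admissible_maps S es fs" "length es = n"
      "fst (hd es) = i'" "snd (last es) = j" "h' = comp_list fs" by auto
    then show ?thesis using h' False
      by (intro exI[of _ "(i, i') # es"] exI[of _ "f # fs"])
         (auto simp: admissible_maps_Cons comp_list_Cons)
  qed
qed simp

lemma word_maps_eq: "word_maps S i j = {h. \<exists>n\<ge>1. path_map S n i j h}"
proof (intro set_eqI iffI)
  fix h assume "h \<in> word_maps S i j"
  then obtain es fs where "admissible_maps S es fs" "fst (hd es) = i" "snd (last es) = j" "h = comp_list fs"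
    by (auto simp: word_maps_def)
  then show "h \<in> {h. \<exists>n\<ge>1. path_map S n i j h}"
    using admissible_maps_imp_path_map[of S es fs]
    by (auto simp: admissible_maps_def admissible_def intro!: exI[of _ "length es"] simp: Suc_le_eq)
next
  fix h assume "h \<in> {h. \<exists>n\<ge>1. path_map S n i j h}"
  then show "h \<in> word_maps S i j"
    unfolding word_maps_def using path_map_imp_admissible_maps by fastforce
qed

lemma all_admissible_maps_iff:
  assumes "N \<ge> 1"
  shows "(\<forall>es fs. admissible_maps S es fs \<and> length es = N \<longrightarrow>
        closure (comp_list fs ` W (fst (hd es))) \<subseteq> U (snd (last es))) \<longleftrightarrow>
     (\<forall>i j h. path_map S N i j h \<longrightarrow> closure (h ` W i) \<subseteq> U j)"
  using path_map_imp_admissible_maps[OF _ assms] admissible_maps_imp_path_map by metis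


section \<open>Fatou sets of compactly generated systems\<close>

text \<open>Equicontinuity at one point, which can be propagated along maps point by point. The
  Fatou set is the interior of the set where it holds, by \<open>fatou_imp_equi_at\<close> and
  \<open>fatouI\<close>.\<close>

definition equi_at :: "'v gdms \<Rightarrow> 'v \<Rightarrow> riemann_sphere \<Rightarrow> bool" where
  "equi_at S i x \<longleftrightarrow> (\<forall>e>0. \<exists>d>0. \<forall>y. dist x y < d \<longrightarrow>
     (\<forall>n j h. path_map S n i j h \<longrightarrow> dist (h x) (h y) < e))"

lemma open_fatou_set: "open (fatou_set F)"
proof -
  have "fatou_set F = \<Union>{U. open U \<and> equicontinuous_on U F}"
    by (auto simp: fatou_set_def)
  then show ?thesis by (auto intro: open_Union)
qed

lemma open_fatou: "open (fatou S i)"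
  by (simp add: fatou_def open_fatou_set)

lemma fatou_imp_equi_at:
  assumes "x \<in> fatou S i"
  shows "equi_at S i x"
  unfolding equi_at_def
proof (intro allI impI)
  fix e :: real assume e: "e > 0"
  obtain U where U: "open U" "x \<in> U" "equicontinuous_on U (\<Union>j. word_maps S i j)"
    using assms by (auto simp: fatou_def fatou_set_def)
  obtain r where r: "r > 0" "ball x r \<subseteq> U" using U by (meson openE)
  obtain d where d: "d > 0" "\<forall>y\<in>U. dist x y < d \<longrightarrow> (\<forall>f\<in>(\<Union>j. word_maps S i j). dist (f x) (f y) < e)"
    using U(2,3) e unfolding equicontinuous_on_def by meson
  show "\<exists>d>0. \<forall>y. dist x y < d \<longrightarrow> (\<forall>n j h. path_map S n i j h \<longrightarrow> dist (h x) (h y) < e)"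
  \<comment> \<open>\<open>r\<close> keeps \<open>y\<close> inside the neighbourhood, and
    \<open>e\<close> takes care of the empty word.\<close>
  proof (intro exI[of _ "min d (min r e)"] conjI allI impI)
    fix y n j h assume y: "dist x y < min d (min r e)" and h: "path_map S n i j h"
    show "dist (h x) (h y) < e"
    proof (cases "n = 0")
      case True
      then show ?thesis using h y by simp
    next
      case False
      then have "h \<in> (\<Union>j. word_maps S i j)" using h by (auto simp: word_maps_eq Suc_le_eq)
      moreover have "y \<in> U" using y r by auto
      ultimately show ?thesis using d y by auto
    qed
  qed (use d r e in auto)
qed

lemma fatouI:
  assumes "open A" "x \<in> A" "\<And>y. y \<in> A \<Longrightarrow> equi_at S i y"
  shows "x \<in> fatou S i"
  unfolding fatou_def fatou_set_def
proof (intro CollectI exI[of _ A] conjI assms)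
  show "equicontinuous_on A (\<Union>j. word_maps S i j)"
    unfolding equicontinuous_on_def
  proof (intro ballI allI impI)
    fix x and e :: real assume "x \<in> A" "e > 0"
    then obtain d where "d > 0" "\<forall>y. dist x y < d \<longrightarrow>
     (\<forall>n j h. path_map S n i j h \<longrightarrow> dist (h x) (h y) < e)"
      using assms(3) unfolding equi_at_def by meson
    then show "\<exists>d>0. \<forall>y\<in>A. dist x y < d \<longrightarrow> (\<forall>f\<in>(\<Union>j. word_maps S i j). dist (f x) (f y) < e)"
      by (intro exI[of _ d]) (auto simp: word_maps_eq)
  qed
qed

text \<open>A Lebesgue number argument. Only \<open>x\<close> is confined to \<open>K\<close>;
  \<open>y\<close> is any nearby point, and both are compared with a centre of the cover, whence the
  halved tolerance.\<close>

lemma equi_at_uniform: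
  assumes "compact K" "\<And>x. x \<in> K \<Longrightarrow> equi_at S i x" "e > 0"
  obtains d where "d > 0"
    "\<And>x y n j h. x \<in> K \<Longrightarrow> dist x y < d \<Longrightarrow> path_map S n i j h \<Longrightarrow> dist (h x) (h y) < e"
proof -
  have "\<exists>d>0. \<forall>y. dist x y < d \<longrightarrow> (\<forall>n j h. path_map S n i j h \<longrightarrow> dist (h x) (h y) < e / 2)" if "x \<in> K" for x
    using assms(2)[OF that] assms(3) unfolding equi_at_def by (meson half_gt_zero)
  then obtain d where d: "\<And>x. x \<in> K \<Longrightarrow> d x > 0"
    "\<And>x y n j h. x \<in> K \<Longrightarrow> dist x y < d x \<Longrightarrow> path_map S n i j h \<Longrightarrow> dist (h x) (h y) < e / 2"
    by metis
  obtain r where r: "r > 0" "\<forall>x\<in>K. \<exists>G\<in>(\<lambda>x. ball x (d x)) ` K. ball x r \<subseteq> G"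
  proof (rule Heine_Borel_lemma[OF assms(1), of "(\<lambda>x. ball x (d x)) ` K"])
    show "K \<subseteq> (\<Union>x\<in>K. ball x (d x))" using d(1) by (auto intro!: bexI)
  qed auto
  show thesis
  proof (rule that[OF r(1)])
    fix x y n j h assume a: "x \<in> K" "dist x y < r" "path_map S n i j h"
    obtain p where p: "p \<in> K" "ball x r \<subseteq> ball p (d p)" using r(2) a(1) by blast
    have "x \<in> ball x r" "y \<in> ball x r" using a(2) r(1) by auto
    then have "x \<in> ball p (d p)" "y \<in> ball p (d p)" using p(2) by blast+
    then have "dist (h p) (h x) < e / 2" "dist (h p) (h y) < e / 2"
      using d(2)[OF p(1) _ a(3)] by auto
    then show "dist (h x) (h y) < e" using dist_triangle3[of "h x" "h y" "h p"] by linarith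
  qed
qed

text \<open>The exceptional points form the projection of a compact set of pairs. This is how
  compact supports make preimages under all maps of an edge open.\<close>

lemma open_forall_compact:
  assumes "compact \<Gamma>" "open A"
  shows "open {x. \<forall>f\<in>\<Gamma>. app f x \<in> A}"
proof -
  have "closed ((\<lambda>p. app (fst p) (snd p)) -` (- A))"
    using assms(2) by (intro continuous_closed_vimage) (auto simp: continuous_on_app_pair[of UNIV, unfolded continuous_on_eq_continuous_at[OF open_UNIV]])
  then have "compact ((\<Gamma> \<times> UNIV) \<inter> ((\<lambda>p. app (fst p) (snd p)) -` (- A)))"
    using assms(1) compact_UNIV_sphere by (intro compact_Int_closed compact_Times) auto
  then have "compact (snd ` ((\<Gamma> \<times> UNIV) \<inter> ((\<lambda>p. app (fst p) (snd p)) -` (- A))))"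
    by (intro compact_continuous_image continuous_intros)
  then have "closed (snd ` ((\<Gamma> \<times> UNIV) \<inter> ((\<lambda>p. app (fst p) (snd p)) -` (- A))))"
    by (rule compact_imp_closed)
  moreover have "{x. \<forall>f\<in>\<Gamma>. app f x \<in> A} = - (snd ` ((\<Gamma> \<times> UNIV) \<inter> ((\<lambda>p. app (fst p) (snd p)) -` (- A))))"
    by force
  ultimately show ?thesis by (simp add: open_Compl)
qed

section \<open>Preimages and images under all words of one length\<close>

definition path_pre :: "'v gdms \<Rightarrow> nat \<Rightarrow> ('v \<Rightarrow> riemann_sphere set) \<Rightarrow> 'v \<Rightarrow> riemann_sphere set" where
  "path_pre S n A i = {x. \<forall>j h. path_map S n i j h \<longrightarrow> h x \<in> A j}"

lemma path_pre_0 [simp]: "path_pre S 0 A i = A i"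
  by (simp add: path_pre_def)

lemma path_pre_Suc:
  "path_pre S (Suc n) A i = (\<Inter>j\<in>{j. (i, j) \<in> edges S}. {x. \<forall>f\<in>gens S (i, j). app f x \<in> path_pre S n A j})"
proof (intro set_eqI iffI)
  fix x assume x: "x \<in> path_pre S (Suc n) A i"
  have "g (app f x) \<in> A k" if "(i, j) \<in> edges S" "f \<in> gens S (i, j)" "path_map S n j k g" for j f k g
    using path_map_Suc[OF that] x unfolding path_pre_def by fastforce
  then show "x \<in> (\<Inter>j\<in>{j. (i, j) \<in> edges S}. {x. \<forall>f\<in>gens S (i, j). app f x \<in> path_pre S n A j})"
    by (auto simp: path_pre_def)
next
  fix x assume "x \<in> (\<Inter>j\<in>{j. (i, j) \<in> edges S}. {x. \<forall>f\<in>gens S (i, j). app f x \<in> path_pre S n A j})"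
  then show "x \<in> path_pre S (Suc n) A i"
    by (auto simp: path_pre_def path_map_Suc_iff)
qed

definition path_image :: "'v gdms \<Rightarrow> nat \<Rightarrow> ('v \<Rightarrow> riemann_sphere set) \<Rightarrow> 'v \<Rightarrow> riemann_sphere set" where
  "path_image S n A j = {h x | i h x. path_map S n i j h \<and> x \<in> A i}"

lemma path_image_0 [simp]: "path_image S 0 A j = A j"
  by (auto simp: path_image_def)

lemma path_image_Suc:
  "path_image S (Suc n) A k = (\<Union>j\<in>{j. (j, k) \<in> edges S}.
     (\<lambda>p. app (fst p) (snd p)) ` (gens S (j, k) \<times> path_image S n A j))"
proof (intro set_eqI iffI)
  fix y assume "y \<in> path_image S (Suc n) A k"
  then obtain i h x where h: "path_map S (Suc n) i k h" "x \<in> A i" "y = h x" by (auto simp: path_image_def)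
  from h(1) have "path_map S (n + 1) i k h" by simp
  then obtain j g g' where g: "path_map S n i j g" "path_map S 1 j k g'" "h = g' \<circ> g" by (rule path_map_split)
  then obtain f where "(j, k) \<in> edges S" "f \<in> gens S (j, k)" "g' = app f"
    by (auto simp: path_map_Suc_iff)
  then show "y \<in> (\<Union>j\<in>{j. (j, k) \<in> edges S}. (\<lambda>p. app (fst p) (snd p)) ` (gens S (j, k) \<times> path_image S n A j))"
    using g h by (intro UN_I[of j] image_eqI[of _ _ "(f, g x)"]) (auto simp: path_image_def)
next
  fix y assume "y \<in> (\<Union>j\<in>{j. (j, k) \<in> edges S}. (\<lambda>p. app (fst p) (snd p)) ` (gens S (j, k) \<times> path_image S n A j))"
  then obtain j f i h x where "(j, k) \<in> edges S" "f \<in> gens S (j, k)" "path_map S n i j h" "x \<in> A i" "y = app f (h x)"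
    by (auto simp: path_image_def)
  then show "y \<in> path_image S (Suc n) A k"
    unfolding path_image_def mem_Collect_eq using path_map_snoc[of S n i j h k f]
    by (intro exI[of _ i] exI[of _ "app f \<circ> h"] exI[of _ x]) simp
qed

section \<open>Degrees along words and loops\<close>

lemma rational_map_id: "rational_map_of_degree 1 id"
proof -
  obtain \<rho> \<rho>' where r: "rational_map_of_degree 1 \<rho>" "rational_map_of_degree 1 \<rho>'" "\<And>p. \<rho>' (\<rho> p) = p"
    using ex_rotation by metis
  have "\<rho>' \<circ> \<rho> = id" using r(3) by auto
  with rational_map_comp[OF r(2,1)] show ?thesis by simp
qed

lemma path_map_rational: "path_map S n i j h \<Longrightarrow> \<exists>d\<ge>2 ^ n. rational_map_of_degree d h"
proof (induction rule: path_map.induct)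
  case (path_map_0 i)
  then show ?case using rational_map_id by (intro exI[of _ 1] conjI) (simp, assumption)
next
  case (path_map_Suc i j f n k h)
  then obtain d where d: "d \<ge> 2 ^ n" "rational_map_of_degree d h" by blast
  obtain d' where d': "d' \<ge> 2" "rational_map_of_degree d' (app f)" by (rule app_rational_map)
  have "d * d' \<ge> 2 ^ n * 2" using d d' by (intro mult_le_mono)
  then have "2 ^ Suc n \<le> d * d'" by (simp add: mult.commute)
  with rational_map_comp[OF d(2) d'(2)] show ?case by blast
qed

lemma rational_map_funpow: "rational_map_of_degree d h \<Longrightarrow> rational_map_of_degree (d ^ m) (h ^^ m)"
proof (induction m)
  case 0
  then show ?case using rational_map_id by (simp only: power_0 funpow.simps)
next
  case (Suc m)
  then show ?case using rational_map_comp[of d h "d ^ m" "h ^^ m"] by (simp only: power_Suc funpow.simps)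
qed

lemma path_map_funpow: "path_map S n i i h \<Longrightarrow> path_map S (n * m) i i (h ^^ m)"
proof (induction m)
  case (Suc m)
  then show ?case using path_map_append[of S "n * m" i i "h ^^ m" n i h]
    by (simp only: funpow.simps mult_Suc_right add.commute)
qed (simp only: funpow.simps mult_0_right path_map_0_iff simp_thms)

text \<open>Reflexive closure makes \<open>strongly_connected\<close> hold for a single vertex
  without edges; \<open>ex_edge\<close> excludes that case.\<close>

locale compact_gdms =
  fixes S :: "'v::finite gdms"
  assumes compact_gens: "e \<in> edges S \<Longrightarrow> compact (gens S e)"
    and gens_nonempty: "e \<in> edges S \<Longrightarrow> gens S e \<noteq> {}"
    and strongly_connected: "(i, j) \<in> (edges S)\<^sup>*"
    and ex_edge: "\<exists>j. (i, j) \<in> edges S"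
begin

lemma ex_path_map: "\<exists>n\<ge>1. \<exists>h. path_map S n i j h"
proof -
  obtain k where k: "(i, k) \<in> edges S" using ex_edge by blast
  obtain f where f: "f \<in> gens S (i, k)" using gens_nonempty[OF k] by blast
  have "\<exists>n h. path_map S n k j h"
    using strongly_connected[of k j]
  proof (induction rule: converse_rtrancl_induct)
    case base
    show ?case by (rule exI, rule exI, rule path_map_0)
  next
    case (step a b)
    then obtain n h where h: "path_map S n b j h" by blast
    obtain g where "g \<in> gens S (a, b)" using gens_nonempty[OF step(1)] by blast
    from path_map_Suc[OF step(1) this h] show ?case by blast
  qed
  then obtain n h where "path_map S n k j h" by blast
  then have "path_map S (Suc n) i j (h \<circ> app f)" using k f by (intro path_map_Suc)
  then show ?thesis by (metis le_add1 plus_1_eq_Suc)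
qed

lemma ex_path_map_out: "\<exists>j h. path_map S n i j h"
proof (induction n arbitrary: i)
  case 0
  show ?case by (rule exI, rule exI, rule path_map_0)
next
  case (Suc n)
  obtain k where k: "(i, k) \<in> edges S" using ex_edge by blast
  obtain f where f: "f \<in> gens S (i, k)" using gens_nonempty[OF k] by blast
  then show ?case using Suc[of k] path_map_Suc[OF k f] by blast
qed

lemma ex_path_map_in: "\<exists>i h. path_map S n i j h"
proof (induction n arbitrary: j)
  case 0
  show ?case by (rule exI, rule exI, rule path_map_0)
next
  case (Suc n)
  \<comment> \<open>The last edge of a nonempty loop at \<open>j\<close> supplies an edge entering
    \<open>j\<close>.\<close>
  obtain m h where h: "m \<ge> 1" "path_map S m j j h" using ex_path_map by blast
  then have "path_map S ((m - 1) + 1) j j h" by simp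
  then obtain k g where "path_map S 1 k j g" by (meson path_map_split)
  moreover obtain i h where "path_map S n i k h" using Suc by blast
  ultimately have "path_map S (n + 1) i j (g \<circ> h)" by (intro path_map_append)
  then show ?case by (metis Suc_eq_plus1)
qed

lemma open_path_pre: "(\<And>j. open (A j)) \<Longrightarrow> open (path_pre S n A i)"
proof (induction n arbitrary: i)
  case (Suc n)
  show ?case unfolding path_pre_Suc
    by (intro open_INT open_forall_compact ballI compact_gens Suc) auto
qed simp

lemma compact_path_image: "(\<And>j. compact (A j)) \<Longrightarrow> compact (path_image S n A i)"
proof (induction n arbitrary: i)
  case (Suc n)
  show ?case unfolding path_image_Suc
    by (intro compact_UN compact_continuous_image continuous_on_app_pair ballI compact_Times compact_gens Suc) auto
qed simp

text \<open>For one step: the images of a point \<open>x\<close> under all first maps form a compact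
  subset of a Fatou set, so equicontinuity there is uniform, and the common modulus of the
  generators pulls it back to \<open>x\<close>. Such points form an open set \<open>A\<close>, which
  turns pointwise equicontinuity into membership in the Fatou set. Longer words reduce to one step
  by induction.\<close>

lemma path_pre_fatou: "path_pre S n (fatou S) i \<subseteq> fatou S i"
proof (induction n arbitrary: i)
  case (Suc n)
  define A where "A = path_pre S 1 (fatou S) i"
  have "path_pre S (Suc n) (fatou S) i \<subseteq> A"
    using Suc by (auto simp: A_def path_pre_Suc)
  also have "A \<subseteq> fatou S i"
  proof
    fix x assume "x \<in> A"
    then show "x \<in> fatou S i"
    proof (rule fatouI[rotated])
      show "open A" unfolding A_def by (intro open_path_pre open_fatou)
      fix x assume x: "x \<in> A"
      show "equi_at S i x" unfolding equi_at_def
      proof (intro allI impI)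
        fix e :: real assume e: "e > 0"
        have "\<exists>d>0. \<forall>f\<in>gens S (i, j). (i, j) \<in> edges S \<longrightarrow> (\<forall>y. dist x y < d \<longrightarrow>
            (\<forall>n k h. path_map S n j k h \<longrightarrow> dist (h (app f x)) (h (app f y)) < e))" for j
        proof (cases "(i, j) \<in> edges S")
          case True
          have K: "compact ((\<lambda>f. app f x) ` gens S (i, j))"
            using compact_continuous_image[OF _ compact_Times[OF compact_gens[OF True] compact_sing[of x]],
                OF continuous_on_app_pair] by (auto simp: image_image Times_insert_right)
          have F: "(\<lambda>f. app f x) ` gens S (i, j) \<subseteq> fatou S j"
            using x True by (auto simp: A_def path_pre_Suc)
          obtain d where d: "d > 0" "\<And>p y n k h. p \<in> (\<lambda>f. app f x) ` gens S (i, j) \<Longrightarrow> dist p y < d \<Longrightarrow>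
              path_map S n j k h \<Longrightarrow> dist (h p) (h y) < e"
          proof (rule equi_at_uniform[OF K _ e, of S j])
            show "equi_at S j p" if "p \<in> (\<lambda>f. app f x) ` gens S (i, j)" for p
              using that F by (intro fatou_imp_equi_at) blast
          qed metis
          obtain d' where d': "d' > 0" "\<And>f. f \<in> gens S (i, j) \<Longrightarrow> modulus d' d (app f)"
            using compact_imp_common_modulus[OF compact_gens[OF True] d(1)] by blast
          show ?thesis
            using d' d(2) by (intro exI[of _ d']) (auto simp: modulus_def)
        qed (auto intro: exI[of _ 1])
        then obtain d where d: "\<And>j. d j > 0" "\<And>j f y n k h. f \<in> gens S (i, j) \<Longrightarrow> (i, j) \<in> edges S \<Longrightarrow> dist x y < d j \<Longrightarrow>
           path_map S n j k h \<Longrightarrow> dist (h (app f x)) (h (app f y)) < e" by metis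
        show "\<exists>d>0. \<forall>y. dist x y < d \<longrightarrow> (\<forall>n j h. path_map S n i j h \<longrightarrow> dist (h x) (h y) < e)"
        proof (intro exI[of _ "min e (Min (range d))"] conjI allI impI)
          show "0 < min e (Min (range d))" using d(1) e by (auto simp: Min_gr_iff)
          fix y n k h assume y: "dist x y < min e (Min (range d))" and h: "path_map S n i k h"
          show "dist (h x) (h y) < e"
          proof (cases n)
            case 0
            then show ?thesis using h y by simp
          next
            case (Suc m)
            then obtain j f g where g: "(i, j) \<in> edges S" "f \<in> gens S (i, j)" "path_map S m j k g" "h = g \<circ> app f"
              using h by (auto simp: path_map_Suc_iff)
            have "dist x y < d j" using y Min_le[of "range d" "d j"] by simp
            with d(2)[OF g(2,1) _ g(3)] show ?thesis by (simp add: g(4))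
          qed
        qed
      qed
    qed
  qed
  finally show ?case .
qed simp

lemma fatou_neq_UNIV: "fatou S i \<noteq> UNIV"
proof
  assume F: "fatou S i = UNIV"
  obtain n h where h: "n \<ge> 1" "path_map S n i i h" using ex_path_map by blast
  obtain D where D: "D \<ge> 2 ^ n" "rational_map_of_degree D h" using path_map_rational[OF h(2)] by blast
  have "(2::nat) ^ 1 \<le> 2 ^ n" using h(1) by (intro power_increasing) auto
  with D have D2: "D \<ge> 2" by simp
  \<comment> \<open>\<open>modulus_imp_close_pair\<close> loses a factor 4, so pi / 4 produces two
    iterates at distance less than pi everywhere, exactly what \<open>degree_eq_of_close\<close>
    requires.\<close>
  obtain d where d: "d > 0"
    "\<And>x y n j h. x \<in> UNIV \<Longrightarrow> dist x y < d \<Longrightarrow> path_map S n i j h \<Longrightarrow> dist (h x) (h y) < pi / 4"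
  proof (rule equi_at_uniform[OF compact_UNIV_sphere, of S i "pi / 4"])
    show "equi_at S i p" for p using F by (intro fatou_imp_equi_at) simp
  qed auto
  have "modulus d (pi / 4) (h ^^ m)" for m
    unfolding modulus_def using d(2)[OF UNIV_I _ path_map_funpow[OF h(2)]] by blast
  then obtain k m where km: "k \<noteq> m" "\<And>x. dist ((h ^^ k) x) ((h ^^ m) x) < 4 * (pi / 4)"
    using modulus_imp_close_pair[of d "pi / 4" "\<lambda>m. h ^^ m"] d(1) by auto
  then have "D ^ k = D ^ m"
    using degree_eq_of_close[OF rational_map_funpow[OF D(2)] rational_map_funpow[OF D(2)]] by simp
  with km(1) D2 show False by simp
qed

end

section \<open>Trapping regions\<close>

text \<open>Compared with mean stability, \<open>U\<close> and \<open>W\<close> are in addition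
  invariant under single maps, so they can be followed along words of any length, and every orbit
  can reach \<open>U\<close> instead of merely \<open>W\<close>.\<close>

definition trapping ::
  "'v gdms \<Rightarrow> nat \<Rightarrow> ('v \<Rightarrow> riemann_sphere set) \<Rightarrow> ('v \<Rightarrow> riemann_sphere set) \<Rightarrow> bool" where
  "trapping S N U W \<longleftrightarrow> N \<ge> 1 \<and>
     (\<forall>i. open (U i) \<and> open (W i) \<and> closure (U i) \<subseteq> W i \<and> closure (W i) \<subseteq> fatou S i) \<and>
     (\<forall>i j f. (i, j) \<in> edges S \<longrightarrow> f \<in> gens S (i, j) \<longrightarrow> app f ` U i \<subseteq> U j \<and> app f ` W i \<subseteq> W j) \<and>
     (\<forall>i j h. path_map S N i j h \<longrightarrow> h ` closure (W i) \<subseteq> U j) \<and>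
     (\<forall>z i. \<exists>n j h. path_map S n i j h \<and> h z \<in> U j)"

lemma path_pre_mono: "(\<And>j. A j \<subseteq> B j) \<Longrightarrow> path_pre S n A i \<subseteq> path_pre S n B i"
  by (auto simp: path_pre_def)

lemma path_map_closure: "path_map S n i j h \<Longrightarrow> h ` closure A \<subseteq> closure (h ` A)"
  by (rule image_closure_subset[OF continuous_on_path_map]) (auto intro: closure_subset[THEN subsetD])

lemma closure_path_pre: "closure (path_pre S n A i) \<subseteq> path_pre S n (\<lambda>j. closure (A j)) i"
proof
  fix x assume x: "x \<in> closure (path_pre S n A i)"
  show "x \<in> path_pre S n (\<lambda>j. closure (A j)) i"
    unfolding path_pre_def
  proof (intro CollectI allI impI)
    fix j h assume h: "path_map S n i j h"
    have "h x \<in> closure (h ` path_pre S n A i)" using path_map_closure[OF h] x by blast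
    also have "\<dots> \<subseteq> closure (A j)" using h by (intro closure_mono) (auto simp: path_pre_def)
    finally show "h x \<in> closure (A j)" .
  qed
qed

lemma closure_UN_path_pre:
  "closure (\<Union>s<N. path_pre S s A i) \<subseteq> (\<Union>s<N. path_pre S s (\<lambda>j. closure (A j)) i)"
proof -
  have "closure (\<Union>s<N. path_pre S s A i) \<subseteq> (\<Union>s<N. closure (path_pre S s A i))"
    by (intro closure_minimal closed_UN) (auto intro: closure_subset[THEN subsetD])
  also have "\<dots> \<subseteq> (\<Union>s<N. path_pre S s (\<lambda>j. closure (A j)) i)"
    by (intro UN_mono order_refl closure_path_pre)
  finally show ?thesis .
qed

lemma (in compact_gdms) mean_stable_imp_trapping:
  assumes "mean_stable S"
  obtains N U W where "trapping S N U W"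
proof -
  from assms obtain N U W where N: "N \<ge> 1" and
    o: "\<forall>i. open (U i) \<and> U i \<noteq> {} \<and> open (W i) \<and> W i \<noteq> {}" and
    cl: "\<forall>i. closure (U i) \<subseteq> W i \<and> closure (W i) \<subseteq> fatou S i" and
    NN: "\<forall>es fs. admissible_maps S es fs \<and> length es = N \<longrightarrow>
        closure (comp_list fs ` W (fst (hd es))) \<subseteq> U (snd (last es))" and
    hit: "\<forall>z i. \<exists>j. \<exists>h\<in>word_maps S i j. h z \<in> W j"
    unfolding mean_stable_def by (elim exE conjE) (rule that; assumption)
  from o have o: "open (U i)" "open (W i)" for i by auto
  from cl have cl: "closure (U i) \<subseteq> W i" "closure (W i) \<subseteq> fatou S i" for i by auto
  from NN have NN': "\<forall>i j h. path_map S N i j h \<longrightarrow> closure (h ` W i) \<subseteq> U j"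
    unfolding all_admissible_maps_iff[OF N] .
  have NN: "closure (h ` W i) \<subseteq> U j" if "path_map S N i j h" for i j h
    by (rule NN'[rule_format, OF that])
  have NNc: "h ` closure (W i) \<subseteq> U j" if "path_map S N i j h" for i j h
    using NN[OF that] path_map_closure[OF that] by blast
  have UW: "U i \<subseteq> W i" for i using cl(1)[of i] closure_subset by blast
  define U' where "U' = (\<lambda>i. \<Union>s<N. path_pre S s U i)"
  define W' where "W' = (\<lambda>i. \<Union>s<N. path_pre S s W i)"
  \<comment> \<open>Stated for any \<open>A\<close> between \<open>U\<close> and \<open>W\<close>,
    to serve both families.\<close>
  have step: "app f ` (\<Union>s<N. path_pre S s A i) \<subseteq> (\<Union>s<N. path_pre S s A j)"
    if f: "(i, j) \<in> edges S" "f \<in> gens S (i, j)" and A: "\<And>i. A i \<subseteq> W i" "\<And>i. U i \<subseteq> A i" for i j f A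
  proof
    fix y assume "y \<in> app f ` (\<Union>s<N. path_pre S s A i)"
    then obtain s x where s: "s < N" "x \<in> path_pre S s A i" "y = app f x" by auto
    show "y \<in> (\<Union>s<N. path_pre S s A j)"
    proof (cases s)
      case 0
      \<comment> \<open>A point of \<open>W\<close> reaches \<open>U\<close> after N maps. After the
        first of them N - 1 remain, so the index \<open>s\<close> wraps around from 0 to N - 1,
        while in the other case it drops by one.\<close>
      have "y \<in> path_pre S (N - 1) A j" unfolding path_pre_def
      proof (intro CollectI allI impI)
        fix k g assume "path_map S (N - 1) j k g"
        then have "path_map S (Suc (N - 1)) i k (g \<circ> app f)" by (rule path_map_Suc[OF f])
        then have "path_map S N i k (g \<circ> app f)" using N by simp
        then have "(g \<circ> app f) ` W i \<subseteq> U k" using NN closure_subset by blast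
        moreover have "x \<in> W i" using s 0 A by auto
        ultimately show "g y \<in> A k" using s(3) A(2) by auto
      qed
      then show ?thesis using N by (auto intro!: bexI[of _ "N - 1"])
    next
      case (Suc t)
      then have "y \<in> path_pre S t A j" using s f by (auto simp: path_pre_Suc)
      then show ?thesis using Suc s by (auto intro!: bexI[of _ t])
    qed
  qed
  have "trapping S N U' W'"
    unfolding trapping_def
  proof (intro conjI allI impI)
    show "open (U' i)" "open (W' i)" for i
      unfolding U'_def W'_def using o by (auto intro!: open_UN open_path_pre)
    show "closure (U' i) \<subseteq> W' i" for i
      unfolding U'_def W'_def
      using closure_UN_path_pre[of S U i N] path_pre_mono[of "\<lambda>j. closure (U j)" W S _ i] cl(1) by blast
    show "closure (W' i) \<subseteq> fatou S i" for i
      unfolding W'_def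
      using closure_UN_path_pre[of S W i N] path_pre_mono[of "\<lambda>j. closure (W j)" "fatou S" S _ i] cl(2)
        path_pre_fatou[of _ i] by blast
    show "app f ` U' i \<subseteq> U' j" if "(i, j) \<in> edges S" "f \<in> gens S (i, j)" for i j f
      unfolding U'_def by (rule step[OF that]) (auto intro: subsetD[OF UW])
    show "app f ` W' i \<subseteq> W' j" if "(i, j) \<in> edges S" "f \<in> gens S (i, j)" for i j f
      unfolding W'_def by (rule step[OF that]) (auto intro: subsetD[OF UW])
    show "h ` closure (W' i) \<subseteq> U' j" if h: "path_map S N i j h" for i j h
    proof
      fix y assume "y \<in> h ` closure (W' i)"
      then obtain x where x: "x \<in> closure (W' i)" "y = h x" by auto
      from subsetD[OF closure_UN_path_pre x(1)[unfolded W'_def]]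
      obtain s where s: "s < N" "x \<in> path_pre S s (\<lambda>j. closure (W j)) i" by auto
      have "y \<in> path_pre S s U j" unfolding path_pre_def
      proof (intro CollectI allI impI)
        fix k g assume "path_map S s j k g"
        \<comment> \<open>The N + s maps are regrouped: the first \<open>s\<close> lead into the
          closure of \<open>W\<close>, and the block of N that follows leads into
          \<open>U\<close>.\<close>
        then have "path_map S (s + N) i k (g \<circ> h)" using path_map_append[OF h] by (subst add.commute)
        then obtain l a b where ab: "path_map S s i l a" "path_map S N l k b" "g \<circ> h = b \<circ> a"
          by (rule path_map_split)
        have "a x \<in> closure (W l)" using s(2) ab(1) by (auto simp: path_pre_def)
        then have "b (a x) \<in> U k" using NNc[OF ab(2)] by blast
        then show "g y \<in> U k" using ab(3) x(2) by (metis comp_apply)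
      qed
      then show "y \<in> U' j" using s(1) by (auto simp: U'_def)
    qed
    show "\<exists>n j h. path_map S n i j h \<and> h z \<in> U' j" for z i
    proof -
      obtain j h n where h: "path_map S n i j h" "h z \<in> W j"
        using spec[OF spec[OF hit, of z], of i] by (auto simp: word_maps_eq)
      \<comment> \<open>Mean stability promises a visit to \<open>W\<close> only; one more block
        leads into \<open>U\<close>.\<close>
      obtain k g where g: "path_map S N j k g" using ex_path_map_out by blast
      have "g (h z) \<in> U k" using NNc[OF g] h(2) closure_subset by blast
      then have "(g \<circ> h) z \<in> U' k" using N by (auto simp: U'_def intro!: bexI[of _ 0])
      then show ?thesis using path_map_append[OF h(1) g] by blast
    qed
  qed (use N in simp)
  then show thesis by (rule that)
qed


section \<open>Contraction on trapping regions\<close>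

lemma finite_pos_choice:
  fixes P :: "'v::finite \<Rightarrow> real \<Rightarrow> bool"
  assumes "\<And>i. \<exists>d>0. P i d" "\<And>i d d'. P i d \<Longrightarrow> 0 < d' \<Longrightarrow> d' \<le> d \<Longrightarrow> P i d'"
  shows "\<exists>d>0. \<forall>i. P i d"
proof -
  from assms(1) obtain d where d: "\<And>i. d i > 0" "\<And>i. P i (d i)" by metis
  show ?thesis
  proof (intro exI[of _ "Min (range d)"] conjI allI)
    show pos: "0 < Min (range d)" using d(1) by (auto simp: Min_gr_iff)
    show "P i (Min (range d))" for i using pos by (intro assms(2)[OF d(2)]) auto
  qed
qed

lemma compact_subset_open_margin:
  fixes K A :: "'a::metric_space set"
  assumes "compact K" "open A" "K \<subseteq> A"
  obtains d where "d > 0" "\<And>x y. x \<in> K \<Longrightarrow> dist x y < d \<Longrightarrow> y \<in> A"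
proof -
  obtain e where "e > 0" "\<forall>x\<in>K. \<exists>G\<in>{A}. ball x e \<subseteq> G"
    by (rule Heine_Borel_lemma[OF assms(1), of "{A}"]) (use assms in auto)
  then show thesis using that[of e] by (auto simp: subset_iff)
qed

text \<open>The map \<open>h\<close> in affine coordinates: \<rho> is the rotation belonging to the
  target vertex, \<sigma> the inverse of the one belonging to the source.\<close>

definition conj_chart ::
  "(riemann_sphere \<Rightarrow> riemann_sphere) \<Rightarrow> (riemann_sphere \<Rightarrow> riemann_sphere) \<Rightarrow>
    (riemann_sphere \<Rightarrow> riemann_sphere) \<Rightarrow> complex \<Rightarrow> complex" where
  "conj_chart \<rho> \<sigma> h z = fin_coord (\<rho> (h (\<sigma> (Finite z))))"

lemma Finite_fin_coord: "x \<noteq> Infinity \<Longrightarrow> Finite (fin_coord x) = x"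
  by (cases x) auto

lemma conj_chart_holomorphic:
  assumes "rational_map_of_degree d h" "rational_map_of_degree 1 \<rho>" "rational_map_of_degree 1 \<sigma>"
    and "\<And>z. z \<in> D \<Longrightarrow> \<rho> (h (\<sigma> (Finite z))) \<noteq> Infinity"
  shows "conj_chart \<rho> \<sigma> h holomorphic_on D"
proof -
  have "rational_map_of_degree (1 * (d * 1)) (\<rho> \<circ> (h \<circ> \<sigma>))"
    by (intro rational_map_comp assms)
  then obtain P Q where PQ: "\<rho> \<circ> (h \<circ> \<sigma>) = rational_fun P Q"
    unfolding rational_map_of_degree_def by blast
  have eq: "\<rho> (h (\<sigma> (Finite z))) = proj_ratio (poly P z) (poly Q z)" for z
    using fun_cong[OF PQ, of "Finite z"] by simp
  have nz: "poly Q z \<noteq> 0" if "z \<in> D" for z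
    using assms(4)[OF that] by (auto simp: eq proj_ratio_def)
  have "(\<lambda>z. poly P z / poly Q z) holomorphic_on D"
    using nz by (intro holomorphic_intros) auto
  moreover have "conj_chart \<rho> \<sigma> h z = poly P z / poly Q z" if "z \<in> D" for z
    using nz[OF that] by (simp add: conj_chart_def eq proj_ratio_def)
  ultimately show ?thesis
    using holomorphic_transform[of "\<lambda>z. poly P z / poly Q z" D "conj_chart \<rho> \<sigma> h"] by simp
qed

lemma trapping_block:
  assumes "trapping S N U W" "path_map S N i j h"
  shows "h ` closure (W i) \<subseteq> U j"
proof -
  have "\<forall>i j h. path_map S N i j h \<longrightarrow> h ` closure (W i) \<subseteq> U j"
    using assms(1) unfolding trapping_def by (elim conjE)
  then show ?thesis using assms(2) by (elim allE impE)
qed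

lemma trapping_path_map:
  assumes "trapping S N U W" "path_map S n i j h"
  shows "h ` W i \<subseteq> W j" "h ` U i \<subseteq> U j"
proof -
  from assms(2) have "h ` W i \<subseteq> W j \<and> h ` U i \<subseteq> U j"
  proof (induction rule: path_map.induct)
    case (path_map_Suc i j f n k h)
    then have "app f ` U i \<subseteq> U j" "app f ` W i \<subseteq> W j"
      using assms(1) by (auto simp: trapping_def)
    with path_map_Suc.IH show ?case unfolding image_comp[symmetric] by blast
  qed simp
  then show "h ` W i \<subseteq> W j" "h ` U i \<subseteq> U j" by auto
qed

context compact_gdms
begin

lemma trapping_charts:
  assumes "trapping S N U W"
  obtains \<rho> \<sigma> where
    "\<And>i. rational_map_of_degree 1 (\<rho> i)" "\<And>i. rational_map_of_degree 1 (\<sigma> i)"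
    "\<And>i p q. dist (\<rho> i p) (\<rho> i q) = dist p q" "\<And>i p. \<sigma> i (\<rho> i p) = p" "\<And>i p. \<rho> i (\<sigma> i p) = p"
    "\<And>i p. p \<in> closure (W i) \<Longrightarrow> \<rho> i p \<noteq> Infinity"
proof -
  have "\<exists>\<rho> \<sigma>. rational_map_of_degree 1 \<rho> \<and> rational_map_of_degree 1 \<sigma> \<and>
    (\<forall>p q. dist (\<rho> p) (\<rho> q) = dist p q) \<and> (\<forall>p. \<sigma> (\<rho> p) = p) \<and> (\<forall>p. \<rho> (\<sigma> p) = p) \<and>
    (\<forall>p\<in>closure (W i). \<rho> p \<noteq> Infinity)" for i
  proof -
    have "closure (W i) \<subseteq> fatou S i" using assms by (simp add: trapping_def)
    then have "closure (W i) \<noteq> UNIV" using fatou_neq_UNIV[of i] by auto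
    then obtain a where a: "a \<notin> closure (W i)" by blast
    obtain \<rho> \<sigma> where r: "rational_map_of_degree 1 \<rho>" "rational_map_of_degree 1 \<sigma>"
      "\<And>p q. dist (\<rho> p) (\<rho> q) = dist p q" "\<And>p. \<sigma> (\<rho> p) = p" "\<And>p. \<rho> (\<sigma> p) = p" "\<rho> a = Infinity"
      using ex_rotation[of a] by metis
    have "\<rho> p \<noteq> Infinity" if "p \<in> closure (W i)" for p
    proof
      assume "\<rho> p = Infinity"
      then have "p = a" using r(4)[of p] r(4)[of a] r(6) by simp
      with that a show False by simp
    qed
    with r show ?thesis by (intro exI[of _ \<rho>] exI[of _ \<sigma>]) auto
  qed
  then obtain \<rho> \<sigma> where "\<forall>i. rational_map_of_degree 1 (\<rho> i) \<and> rational_map_of_degree 1 (\<sigma> i) \<and>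
    (\<forall>p q. dist (\<rho> i p) (\<rho> i q) = dist p q) \<and> (\<forall>p. \<sigma> i (\<rho> i p) = p) \<and> (\<forall>p. \<rho> i (\<sigma> i p) = p) \<and>
    (\<forall>p\<in>closure (W i). \<rho> i p \<noteq> Infinity)" by metis
  then show thesis by (intro that[of \<rho> \<sigma>]) auto
qed

text \<open>In the charts the regions become bounded open sets \<open>D i\<close>, and the blocks
  send them into compact parts with a uniform margin \<eta>. The margin is what pays for the
  geometric gain; connectedness is not involved, as derivatives are estimated on discs.\<close>

lemma block_contraction:
  assumes T: "trapping S N U W"
  obtains C r q where "C > 0" "r > 0" "0 < q" "q < 1"
    "\<And>i x y k j h. x \<in> U i \<Longrightarrow> dist x y < r \<Longrightarrow> path_map S (N * k) i j h \<Longrightarrow> dist (h x) (h y) \<le> C * q ^ k"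
proof -
  obtain \<rho> \<sigma> where
    rat: "\<And>i. rational_map_of_degree 1 (\<rho> i)" "\<And>i. rational_map_of_degree 1 (\<sigma> i)" and
    iso: "\<And>i p q. dist (\<rho> i p) (\<rho> i q) = dist p q" and
    inv: "\<And>i p. \<sigma> i (\<rho> i p) = p" "\<And>i p. \<rho> i (\<sigma> i p) = p" and
    fin: "\<And>i p. p \<in> closure (W i) \<Longrightarrow> \<rho> i p \<noteq> Infinity"
    using trapping_charts[OF T] by metis
  have opn: "open (U i)" "open (W i)" and cl: "closure (U i) \<subseteq> W i" for i
    using T by (auto simp: trapping_def)
  have UW: "U i \<subseteq> W i" for i using cl[of i] closure_subset by blast
  have finW: "\<rho> i p \<noteq> Infinity" if "p \<in> W i" for i p using fin[of p i] that closure_subset by blast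
  define D where "D = (\<lambda>i. {z. \<sigma> i (Finite z) \<in> W i})"
  define c where "c = (\<lambda>i x. fin_coord (\<rho> i x))"
  have Fc: "Finite (c i x) = \<rho> i x" if "x \<in> W i" for i x
    unfolding c_def by (rule Finite_fin_coord[OF finW[OF that]])
  have \<sigma>c: "\<sigma> i (Finite (c i x)) = x" if "x \<in> W i" for i x
    using Fc[OF that] inv by simp
  have cD: "c i x \<in> D i" if "x \<in> W i" for i x using that \<sigma>c[OF that] by (simp add: D_def)
  have contc: "continuous_on (closure (W i)) (c i)" for i
  proof -
    have "continuous_on (\<rho> i ` closure (W i)) fin_coord"
      using fin by (auto intro!: continuous_at_imp_continuous_on continuous_fin_coord)
    from continuous_on_compose[OF continuous_on_rational_map[OF rat(1)] this] show ?thesis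
      by (simp add: c_def o_def)
  qed
  have cmpW: "compact (closure (W i))" and cmpU: "compact (closure (U i))" for i
    by (simp_all add: compact_sphere_iff)
  have openD: "open (D i)" for i
  proof -
    have "continuous_on UNIV (\<lambda>z. \<sigma> i (Finite z))"
      using continuous_on_compose[OF continuous_on_Finite continuous_on_rational_map[OF rat(2)]]
      by (simp add: o_def)
    then have "open ((\<lambda>z. \<sigma> i (Finite z)) -` W i)" by (intro open_vimage opn)
    then show ?thesis by (simp add: D_def vimage_def)
  qed
  obtain R where R: "R > 0" "\<And>i z. z \<in> D i \<Longrightarrow> cmod z \<le> R"
  proof -
    \<comment> \<open>The bound is written as 1 / b since \<open>finite_pos_choice\<close> passes to
      smaller constants.\<close>
    have "\<exists>b>0. \<forall>x\<in>closure (W i). cmod (c i x) \<le> 1 / b" for i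
    proof -
      have "bounded (c i ` closure (W i))"
        by (intro compact_imp_bounded compact_continuous_image contc cmpW)
      then obtain b where "b > 0" "\<forall>x\<in>closure (W i). cmod (c i x) \<le> b" by (auto simp: bounded_pos)
      then show ?thesis by (intro exI[of _ "1 / b"]) auto
    qed
    then have "\<exists>b>0. \<forall>i. \<forall>x\<in>closure (W i). cmod (c i x) \<le> 1 / b"
    proof (rule finite_pos_choice)
      fix i d d' assume d: "\<forall>x\<in>closure (W i). cmod (c i x) \<le> 1 / d" "0 < d'" "d' \<le> (d::real)"
      then have "1 / d \<le> 1 / d'" by (intro divide_left_mono) auto
      with d(1) show "\<forall>x\<in>closure (W i). cmod (c i x) \<le> 1 / d'" by force
    qed
    then obtain b where b: "b > 0" "\<And>i. \<forall>x\<in>closure (W i). cmod (c i x) \<le> 1 / b" by blast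
    show thesis
    proof (rule that[of "1 / b"])
      fix i z assume "z \<in> D i"
      then have "\<sigma> i (Finite z) \<in> closure (W i)" using closure_subset by (auto simp: D_def)
      with b(2) have "cmod (c i (\<sigma> i (Finite z))) \<le> 1 / b" by blast
      then show "cmod z \<le> 1 / b" by (simp add: c_def inv)
    qed (use b in simp)
  qed
  obtain \<eta> where \<eta>: "\<eta> > 0" "\<And>i x w. x \<in> closure (U i) \<Longrightarrow> dist (c i x) w < \<eta> \<Longrightarrow> w \<in> D i"
  proof -
    have "\<exists>d>0. \<forall>x\<in>closure (U i). \<forall>w. dist (c i x) w < d \<longrightarrow> w \<in> D i" for i
    proof -
      have "compact (c i ` closure (U i))"
        using cl[of i] closure_subset[of "W i"]
        by (intro compact_continuous_image cmpU continuous_on_subset[OF contc]) auto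
      moreover have "c i ` closure (U i) \<subseteq> D i" using cl cD by blast
      ultimately obtain d where "d > 0" "\<And>z w. z \<in> c i ` closure (U i) \<Longrightarrow> dist z w < d \<Longrightarrow> w \<in> D i"
        using compact_subset_open_margin[OF _ openD] by metis
      then show ?thesis by (intro exI[of _ d]) auto
    qed
    then have "\<exists>d>0. \<forall>i. \<forall>x\<in>closure (U i). \<forall>w. dist (c i x) w < d \<longrightarrow> w \<in> D i"
      by (rule finite_pos_choice) (auto intro: less_le_trans)
    then obtain d where "d > 0" "\<And>i. \<forall>x\<in>closure (U i). \<forall>w. dist (c i x) w < d \<longrightarrow> w \<in> D i" by blast
    then show thesis by (intro that[of d]) auto
  qed
  \<comment> \<open>Two points of a domain \<open>D\<close> differ by at most 2 R, so a push by the
    factor \<delta> moves a point by at most \<eta> / 2 and does not leave the margin.\<close>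
  define \<delta> where "\<delta> = \<eta> / (4 * R)"
  have \<delta>: "\<delta> > 0" using \<eta>(1) R(1) by (simp add: \<delta>_def)
  define q where "q = 1 / (1 + \<delta>)"
  have q: "0 < q" "q < 1" using \<delta> by (auto simp: q_def)
  text \<open>
    The Earle--Hamilton argument: pushing every block away from the orbit of \<open>z\<close> by the factor
    \<open>1 + \<delta>\<close> keeps it inside the bounded domains, so the Cauchy estimate for the modified
    composition \<open>G\<close> gains the factor \<open>(1 + \<delta>)\<^sup>k\<close> for the original one.
  \<close>
  have main: "\<exists>(G :: complex \<Rightarrow> complex) d. G holomorphic_on D i \<and> G ` D i \<subseteq> D j \<and> G z = conj_chart (\<rho> j) (\<sigma> i) h z \<and>
      (conj_chart (\<rho> j) (\<sigma> i) h has_field_derivative d) (at z) \<and>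
      (G has_field_derivative (of_real (1 + \<delta>) ^ k * d)) (at z)"
    if "path_map S (N * k) i j h" "z \<in> D i" for i j h k and z :: complex
    using that(1)
  proof (induction k arbitrary: j h)
    case 0
    then have h: "j = i" "h = id" by auto
    have eq: "conj_chart (\<rho> j) (\<sigma> i) h = (\<lambda>z. z)" by (auto simp: conj_chart_def h inv)
    show ?case unfolding eq using that(2) h(1)
      by (intro exI[of _ "\<lambda>z. z"] exI[of _ 1]) auto
  next
    case (Suc k)
    then have "path_map S (N * k + N) i j h" by (simp add: add.commute)
    then obtain l a b where ab: "path_map S (N * k) i l a" "path_map S N l j b" "h = b \<circ> a"
      by (rule path_map_split)
    from Suc.IH[OF ab(1)] obtain G d where G: "G holomorphic_on D i" "G ` D i \<subseteq> D l"
      "G z = conj_chart (\<rho> l) (\<sigma> i) a z" "(conj_chart (\<rho> l) (\<sigma> i) a has_field_derivative d) (at z)"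
      "(G has_field_derivative (of_real (1 + \<delta>) ^ k * d)) (at z)" by blast
    define B where "B = conj_chart (\<rho> j) (\<sigma> l) b"
    have bU: "b x \<in> U j" if "x \<in> W l" for x
      using trapping_block[OF T ab(2)] that closure_subset[of "W l"] by blast
    have BU: "B w = c j (b (\<sigma> l (Finite w)))" "b (\<sigma> l (Finite w)) \<in> U j" if "w \<in> D l" for w
      using that bU by (auto simp: B_def conj_chart_def c_def D_def)
    obtain e where "rational_map_of_degree e b" using path_map_rational[OF ab(2)] by blast
    then have Bhol: "B holomorphic_on D l"
      unfolding B_def using bU UW by (intro conj_chart_holomorphic rat) (auto simp: D_def intro!: finW)
    have Bbd: "cmod (B w) \<le> R" if "w \<in> D l" for w
      using R(2)[OF cD[OF subsetD[OF UW BU(2)[OF that]]]] BU(1)[OF that] by simp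
    \<comment> \<open>The modified block fixes the value at \<open>z\<close> and multiplies the
      derivative there by 1 + \<delta>. The new centre is \<open>B (G z)\<close>, which equals the
      true image since \<open>G\<close> was unchanged at \<open>z\<close>.\<close>
    define G' where "G' = (\<lambda>w. B (G w) + of_real \<delta> * (B (G w) - B (G z)))"
    have zl: "G z \<in> D l" using G(2) that(2) by blast
    have comp: "conj_chart (\<rho> j) (\<sigma> i) h w = B (conj_chart (\<rho> l) (\<sigma> i) a w)" if "w \<in> D i" for w
    proof -
      have "a (\<sigma> i (Finite w)) \<in> W l"
        using trapping_path_map(1)[OF T ab(1)] that by (auto simp: D_def)
      from \<sigma>c[OF this] show ?thesis by (simp add: conj_chart_def B_def ab(3) c_def)
    qed
    show ?case
    proof (intro exI[of _ G'] exI[of _ "deriv B (G z) * d"] conjI)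
      show "G' holomorphic_on D i"
        unfolding G'_def using holomorphic_on_compose_gen[OF G(1) Bhol G(2)]
        by (intro holomorphic_intros) (simp_all add: o_def)
      show "G' ` D i \<subseteq> D j"
      proof
        fix y assume "y \<in> G' ` D i"
        then obtain w where w: "w \<in> D i" "y = G' w" by auto
        have wl: "G w \<in> D l" using G(2) w by blast
        have "cmod (B (G w) - B (G z)) \<le> R + R"
          using norm_triangle_ineq4[of "B (G w)" "B (G z)"] Bbd[OF wl] Bbd[OF zl] by linarith
        then have "\<delta> * cmod (B (G w) - B (G z)) \<le> \<delta> * (2 * R)" using \<delta> by (intro mult_left_mono) auto
        also have "\<dots> < \<eta>" using \<eta>(1) R(1) by (simp add: \<delta>_def)
        finally have "dist (B (G w)) y < \<eta>"
          using \<delta> by (simp add: w(2) G'_def dist_norm norm_mult)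
        with BU[OF wl] \<eta>(2) closure_subset[of "U j"] show "y \<in> D j" by force
      qed
      show "G' z = conj_chart (\<rho> j) (\<sigma> i) h z"
        unfolding G'_def using comp[OF that(2)] G(3) by simp
      have dB: "(B has_field_derivative deriv B (G z)) (at (G z))"
        using Bhol openD zl by (rule holomorphic_derivI)
      show "(G' has_field_derivative of_real (1 + \<delta>) ^ Suc k * (deriv B (G z) * d)) (at z)"
        unfolding G'_def using DERIV_chain2[OF dB G(5)]
        by (auto intro!: derivative_eq_intros simp: algebra_simps)
      have "((\<lambda>w. B (conj_chart (\<rho> l) (\<sigma> i) a w)) has_field_derivative deriv B (G z) * d) (at z)"
        using dB G(3,4) by (intro DERIV_chain2) auto
      then show "(conj_chart (\<rho> j) (\<sigma> i) h has_field_derivative deriv B (G z) * d) (at z)"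
        by (rule has_field_derivative_transform_within_open[OF _ openD that(2)]) (simp add: comp)
    qed
  qed
  have lip: "cmod (conj_chart (\<rho> j) (\<sigma> i) h z - conj_chart (\<rho> j) (\<sigma> i) h w) \<le> (4 * R / \<eta> * q ^ k) * cmod (z - w)"
    if h: "path_map S (N * k) i j h" and x: "x \<in> U i" and zw: "z \<in> ball (c i x) (\<eta> / 2)" "w \<in> ball (c i x) (\<eta> / 2)"
    for i j h k x z w
  proof -
    have sub: "ball (c i x) \<eta> \<subseteq> D i" using \<eta>(2)[of x i] x closure_subset[of "U i"] by auto
    have "\<exists>d. (conj_chart (\<rho> j) (\<sigma> i) h has_field_derivative d) (at v) \<and> cmod d \<le> 4 * R / \<eta> * q ^ k"
      if v: "v \<in> ball (c i x) (\<eta> / 2)" for v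
    proof -
      have sub': "cball v (\<eta> / 4) \<subseteq> D i"
      proof
        fix u assume "u \<in> cball v (\<eta> / 4)"
        then have "dist (c i x) u < \<eta>" using v dist_triangle[of "c i x" u v] \<eta>(1) by simp
        then show "u \<in> D i" using sub by auto
      qed
      have vD: "v \<in> D i" using sub' \<eta>(1) by auto
      from main[OF h vD] obtain G d where G: "G holomorphic_on D i" "G ` D i \<subseteq> D j"
        "(conj_chart (\<rho> j) (\<sigma> i) h has_field_derivative d) (at v)"
        "(G has_field_derivative (of_real (1 + \<delta>) ^ k * d)) (at v)" by blast
      \<comment> \<open>Since \<open>v\<close> is within \<eta> / 2 of \<open>c i x\<close>, the
        disc of radius \<eta> / 4 about it still lies in \<open>D i\<close>. There \<open>G\<close>
        is bounded by \<open>R\<close>, and dividing its derivative by (1 + \<delta>)^k bounds that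
        of the original composition.\<close>
      have "norm ((deriv ^^ 1) G v) \<le> fact 1 * R / (\<eta> / 4) ^ 1"
      proof (rule Cauchy_inequality)
        show "G holomorphic_on ball v (\<eta> / 4)"
          using sub' ball_subset_cball by (intro holomorphic_on_subset[OF G(1)]) blast
        show "continuous_on (cball v (\<eta> / 4)) G"
          using sub' by (intro holomorphic_on_imp_continuous_on holomorphic_on_subset[OF G(1)])
        fix u assume "norm (v - u) = \<eta> / 4"
        then have "u \<in> cball v (\<eta> / 4)" by (simp add: dist_norm)
        then have "G u \<in> D j" using sub' G(2) by blast
        then show "norm (G u) \<le> R" by (rule R(2))
      qed (use \<eta>(1) in simp)
      then have "cmod (of_real (1 + \<delta>) ^ k * d) \<le> 4 * R / \<eta>"
        using DERIV_imp_deriv[OF G(4)] by (simp add: mult.commute)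
      then have "(1 + \<delta>) ^ k * cmod d \<le> 4 * R / \<eta>"
        using \<delta> by (simp add: norm_mult norm_power del: of_real_add)
      then have "cmod d \<le> (4 * R / \<eta>) / (1 + \<delta>) ^ k"
        using \<delta> by (subst pos_le_divide_eq) (simp_all add: mult.commute)
      then have "cmod d \<le> 4 * R / \<eta> * q ^ k"
        by (simp add: q_def power_divide)
      with G(3) show ?thesis by blast
    qed
    then obtain f' where f': "\<And>v. v \<in> ball (c i x) (\<eta> / 2) \<Longrightarrow>
        (conj_chart (\<rho> j) (\<sigma> i) h has_field_derivative f' v) (at v)"
      "\<And>v. v \<in> ball (c i x) (\<eta> / 2) \<Longrightarrow> cmod (f' v) \<le> 4 * R / \<eta> * q ^ k" by metis
    show ?thesis
      by (rule field_differentiable_bound[OF convex_ball has_field_derivative_at_within[OF f'(1)] f'(2) zw])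
  qed
  obtain r where r: "r > 0" "\<And>i x y. x \<in> U i \<Longrightarrow> dist x y < r \<Longrightarrow> y \<in> W i \<and> dist (c i x) (c i y) < \<eta> / 2"
  proof -
    have "\<exists>d>0. \<forall>x\<in>U i. \<forall>y. dist x y < d \<longrightarrow> y \<in> W i \<and> dist (c i x) (c i y) < \<eta> / 2" for i
    proof -
      obtain d1 where d1: "d1 > 0" "\<And>x y. x \<in> closure (U i) \<Longrightarrow> dist x y < d1 \<Longrightarrow> y \<in> W i"
        using compact_subset_open_margin[OF cmpU opn(2) cl] by metis
      have "uniformly_continuous_on (closure (W i)) (c i)"
        by (intro compact_uniformly_continuous contc cmpW)
      then obtain d2 where d2: "d2 > 0" "\<And>x y. x \<in> closure (W i) \<Longrightarrow> y \<in> closure (W i) \<Longrightarrow> dist y x < d2 \<Longrightarrow>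
          dist (c i y) (c i x) < \<eta> / 2"
        unfolding uniformly_continuous_on_def using \<eta>(1) half_gt_zero by metis
      show ?thesis
      proof (intro exI[of _ "min d1 d2"] conjI ballI allI impI)
        fix x y assume x: "x \<in> U i" and y: "dist x y < min d1 d2"
        show yW: "y \<in> W i" using d1(2)[of x y] x y closure_subset[of "U i"] by auto
        show "dist (c i x) (c i y) < \<eta> / 2"
          using d2(2)[of y x] x y yW UW[of i] closure_subset[of "W i"] by auto
      qed (use d1 d2 in auto)
    qed
    then have "\<exists>d>0. \<forall>i. \<forall>x\<in>U i. \<forall>y. dist x y < d \<longrightarrow> y \<in> W i \<and> dist (c i x) (c i y) < \<eta> / 2"
      by (rule finite_pos_choice) (meson less_le_trans)
    then obtain d where "d > 0" "\<And>i. \<forall>x\<in>U i. \<forall>y. dist x y < d \<longrightarrow> y \<in> W i \<and> dist (c i x) (c i y) < \<eta> / 2" by blast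
    then show thesis by (intro that[of d]) auto
  qed
  show thesis
  \<comment> \<open>8 R = 4 (4 R / \<eta>) (\<eta> / 2): the factor 4 from the chart, the Lipschitz
    constant, and the distance in the chart.\<close>
  proof (rule that[of "8 * R" r q])
    fix i x y k j h
    assume x: "x \<in> U i" and y: "dist x y < r" and h: "path_map S (N * k) i j h"
    have yW: "y \<in> W i" and cy: "dist (c i x) (c i y) < \<eta> / 2" using r(2)[OF x y] by auto
    have xW: "x \<in> W i" using x UW by blast
    have eq: "Finite (conj_chart (\<rho> j) (\<sigma> i) h (c i v)) = \<rho> j (h v)" if "v \<in> W i" for v
    proof -
      have "h v \<in> W j" using trapping_path_map(1)[OF T h] that by blast
      from Fc[OF this] show ?thesis unfolding conj_chart_def \<sigma>c[OF that] by (simp add: c_def)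
    qed
    have "dist (h x) (h y) = dist (\<rho> j (h x)) (\<rho> j (h y))" by (simp add: iso)
    also have "\<dots> \<le> 4 * cmod (conj_chart (\<rho> j) (\<sigma> i) h (c i x) - conj_chart (\<rho> j) (\<sigma> i) h (c i y))"
      unfolding eq[OF xW, symmetric] eq[OF yW, symmetric] by (rule dist_Finite_le)
    also have "\<dots> \<le> 4 * ((4 * R / \<eta> * q ^ k) * cmod (c i x - c i y))"
      using \<eta>(1) cy by (intro mult_left_mono lip[OF h x]) auto
    also have "\<dots> \<le> 4 * ((4 * R / \<eta> * q ^ k) * (\<eta> / 2))"
      using cy R(1) \<eta>(1) q by (intro mult_left_mono) (auto simp: dist_norm)
    also have "\<dots> = 8 * R * q ^ k" using \<eta>(1) by simp
    finally show "dist (h x) (h y) \<le> 8 * R * q ^ k" .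
  qed (use R(1) r(1) q in auto)
qed

text \<open>The incomplete block, shorter than N, is applied first: it keeps \<open>x\<close> in
  \<open>U\<close>, and by equicontinuity on the closure of \<open>U\<close> it keeps the two points
  within the radius that the complete blocks need.\<close>

lemma contraction:
  assumes T: "trapping S N U W"
  obtains C r c where "C > 0" "r > 0" "0 < c" "c < 1"
    "\<And>i x y n j h. x \<in> U i \<Longrightarrow> dist x y < r \<Longrightarrow> path_map S n i j h \<Longrightarrow> dist (h x) (h y) \<le> C * c ^ n"
proof -
  obtain C r q where C: "C > 0" "r > 0" "0 < q" "q < 1"
    "\<And>i x y k j h. x \<in> U i \<Longrightarrow> dist x y < r \<Longrightarrow> path_map S (N * k) i j h \<Longrightarrow> dist (h x) (h y) \<le> C * q ^ k"
    using block_contraction[OF T] by metis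
  have N: "N \<ge> 1" using T by (simp add: trapping_def)
  have "\<exists>d>0. \<forall>x\<in>U i. \<forall>y. dist x y < d \<longrightarrow> (\<forall>n j h. path_map S n i j h \<longrightarrow> dist (h x) (h y) < r)" for i
  proof (rule equi_at_uniform[of "closure (U i)" S i r])
    show "compact (closure (U i))" by (simp add: compact_sphere_iff)
    show "equi_at S i x" if "x \<in> closure (U i)" for x
      using that T closure_subset[of "W i"] by (intro fatou_imp_equi_at) (auto simp: trapping_def)
    fix d assume "d > 0" "\<And>x y n j h. x \<in> closure (U i) \<Longrightarrow> dist x y < d \<Longrightarrow> path_map S n i j h \<Longrightarrow> dist (h x) (h y) < r"
    then show ?thesis using closure_subset[of "U i"] by (intro exI[of _ d]) auto
  qed (use C in simp)
  then have "\<exists>d>0. \<forall>i. \<forall>x\<in>U i. \<forall>y. dist x y < d \<longrightarrow> (\<forall>n j h. path_map S n i j h \<longrightarrow> dist (h x) (h y) < r)"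
    by (rule finite_pos_choice) (meson less_le_trans)
  then obtain d where d: "d > 0"
    "\<And>i. \<forall>x\<in>U i. \<forall>y. dist x y < d \<longrightarrow> (\<forall>n j h. path_map S n i j h \<longrightarrow> dist (h x) (h y) < r)" by blast
  \<comment> \<open>Then q^k = c^(N k), and the missing factor c^s for the incomplete block is at
    least c^N = q; this explains the constant \<open>C / q\<close> below.\<close>
  define c where "c = root N q"
  have c: "0 < c" "c < 1" using C N by (auto simp: c_def)
  have cN: "c ^ N = q" using C N by (simp add: c_def)
  show thesis
  proof (rule that[of "C / q" d c])
    fix i x y n j h assume x: "x \<in> U i" and y: "dist x y < d" and h: "path_map S n i j h"
    define k s where "k = n div N" and "s = n mod N"
    have n: "n = s + N * k" by (simp add: k_def s_def)
    have s: "s \<le> N" using N by (simp add: s_def less_imp_le)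
    obtain l a b where ab: "path_map S s i l a" "path_map S (N * k) l j b" "h = b \<circ> a"
      using h unfolding n by (rule path_map_split)
    have "a x \<in> U l" using trapping_path_map(2)[OF T ab(1)] x by blast
    moreover have "dist (a x) (a y) < r" using d(2) x y ab(1) by blast
    ultimately have "dist (b (a x)) (b (a y)) \<le> C * q ^ k" using ab(2) by (rule C(5))
    also have "q ^ k = c ^ (N * k)" by (simp add: power_mult cN)
    also have "C * c ^ (N * k) \<le> C / q * c ^ n"
    proof -
      have "c ^ N \<le> c ^ s" using s c by (intro power_decreasing) auto
      then have "q * c ^ (N * k) \<le> c ^ n" using c by (simp add: cN n power_add mult_right_mono)
      then have "C * (q * c ^ (N * k)) \<le> C * c ^ n" using C by (intro mult_left_mono) auto
      then show ?thesis using C by (simp add: field_simps)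
    qed
    finally show "dist (h x) (h y) \<le> C / q * c ^ n" by (simp add: ab(3))
  qed (use C c d in auto)
qed

end


section \<open>Minimal sets\<close>

lemma compact_invariant_path_map:
  assumes "compact_invariant S L" "path_map S n i j h"
  shows "h ` L i \<subseteq> L j"
  using assms(2)
proof (induction rule: path_map.induct)
  case (path_map_Suc i j f n k h)
  then have "app f ` L i \<subseteq> L j"
    using assms(1) by (force simp: compact_invariant_def forward_invariant_def)
  with path_map_Suc.IH show ?case unfolding image_comp[symmetric] by blast
qed simp

lemma ex_minimal_set:
  assumes K: "compact_invariant S K"
  obtains L where "minimal_set S L" "\<And>i. L i \<subseteq> K i"
proof -
  define A where "A = {L. compact_invariant S L \<and> (\<forall>i. L i \<subseteq> K i)}"
  \<comment> \<open>Reverse inclusion, so that the maximal element from Zorn's lemma is a minimal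
    set. A nonempty chain is bounded by its intersection, nonempty at every vertex by
    compactness.\<close>
  define P where "P = (\<lambda>(a :: 'a \<Rightarrow> riemann_sphere set) b. \<forall>i. b i \<subseteq> a i)"
  have "\<exists>m\<in>A. \<forall>a\<in>A. P m a \<longrightarrow> a = m"
  proof (rule predicate_Zorn)
    show "partial_order_on A (relation_of P A)"
      by (rule partial_order_on_relation_ofI) (auto simp: P_def fun_eq_iff intro: subset_antisym)
  next
    fix C assume C: "C \<in> Chains (relation_of P A)"
    then have CA: "C \<subseteq> A" by (auto simp: Chains_def relation_of_def)
    have lin: "(\<forall>i. a i \<subseteq> b i) \<or> (\<forall>i. b i \<subseteq> a i)" if "a \<in> C" "b \<in> C" for a b
      using C that by (auto simp: Chains_def relation_of_def P_def)
    show "\<exists>u\<in>A. \<forall>a\<in>C. P a u"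
    proof (cases "C = {}")
      case True
      then show ?thesis using K by (auto simp: A_def)
    next
      case False
      define u where "u = (\<lambda>i. \<Inter>L\<in>C. L i)"
      have inv: "compact_invariant S L" if "L \<in> C" for L using that CA by (auto simp: A_def)
      have "compact_invariant S u"
        unfolding compact_invariant_def
      proof (intro conjI allI)
        show "forward_invariant S u"
          using inv by (fastforce simp: forward_invariant_def compact_invariant_def u_def)
        fix i
        have cp: "\<And>s. s \<in> (\<lambda>L. L i) ` C \<Longrightarrow> compact s" using inv by (auto simp: compact_invariant_def)
        show "u i \<noteq> {}" unfolding u_def
        proof (rule compact_chain)
          show "compact s" if "s \<in> (\<lambda>L. L i) ` C" for s using cp[OF that] .
          show "{} \<notin> (\<lambda>L. L i) ` C" using inv by (force simp: compact_invariant_def)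
          show "s \<subseteq> t \<or> t \<subseteq> s" if "s \<in> (\<lambda>L. L i) ` C \<and> t \<in> (\<lambda>L. L i) ` C" for s t
            using that lin by blast
        qed
        have "closed (u i)" unfolding u_def using cp by (intro closed_INT ballI compact_imp_closed) auto
        then show "compact (u i)" by (simp add: compact_sphere_iff)
      qed
      moreover have "u i \<subseteq> K i" for i using False CA by (auto simp: u_def A_def)
      ultimately have "u \<in> A" by (simp add: A_def)
      moreover have "\<forall>a\<in>C. P a u" by (auto simp: P_def u_def)
      ultimately show ?thesis by blast
    qed
  qed
  then obtain m where m: "m \<in> A" "\<And>a. a \<in> A \<Longrightarrow> P m a \<Longrightarrow> a = m" by blast
  show thesis
  proof (rule that[of m])
    show "minimal_set S m"
      unfolding minimal_set_def
    proof (intro conjI allI impI)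
      show "compact_invariant S m" using m(1) by (simp add: A_def)
      fix L assume L: "compact_invariant S L \<and> (\<forall>i. L i \<subseteq> m i)"
      moreover have "\<forall>i. m i \<subseteq> K i" using m(1) by (simp add: A_def)
      ultimately have "L \<in> A" by (auto simp: A_def)
      then show "L = m" using L m(2) by (simp add: P_def)
    qed
    show "m i \<subseteq> K i" for i using m(1) by (simp add: A_def)
  qed
qed

definition orbit_closure :: "'v gdms \<Rightarrow> riemann_sphere \<Rightarrow> 'v \<Rightarrow> 'v \<Rightarrow> riemann_sphere set" where
  "orbit_closure S z i j = closure {h z | n h. n \<ge> 1 \<and> path_map S n i j h}"

lemma orbit_closure_subset:
  assumes "compact_invariant S L" "z \<in> L i"
  shows "orbit_closure S z i j \<subseteq> L j"
  unfolding orbit_closure_def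
proof (rule closure_minimal)
  show "{h z |n h. n \<ge> 1 \<and> path_map S n i j h} \<subseteq> L j"
    using compact_invariant_path_map[OF assms(1)] assms(2) by blast
  show "closed (L j)" using assms(1) by (auto simp: compact_invariant_def intro: compact_imp_closed)
qed

lemma minimal_setD: "minimal_set S L \<Longrightarrow> compact_invariant S L"
  by (simp add: minimal_set_def)

lemma minimal_set_eqI: "minimal_set S L \<Longrightarrow> compact_invariant S K \<Longrightarrow> (\<And>i. K i \<subseteq> L i) \<Longrightarrow> K = L"
  by (simp add: minimal_set_def)

context compact_gdms
begin

lemma compact_invariant_orbit_closure: "compact_invariant S (orbit_closure S z i)"
  unfolding compact_invariant_def
proof (intro conjI allI)
  show "forward_invariant S (orbit_closure S z i)"
    unfolding forward_invariant_def
  proof (intro ballI)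
    fix e f assume e: "e \<in> edges S" "f \<in> gens S e"
    have "app f ` orbit_closure S z i (fst e) \<subseteq> closure (app f ` {h z |n h. n \<ge> 1 \<and> path_map S n i (fst e) h})"
      unfolding orbit_closure_def
      by (intro image_closure_subset continuous_on_app closed_closure) (rule closure_subset)
    also have "app f ` {h z |n h. n \<ge> 1 \<and> path_map S n i (fst e) h} \<subseteq> {h z |n h. n \<ge> 1 \<and> path_map S n i (snd e) h}"
    proof
      fix y assume "y \<in> app f ` {h z |n h. n \<ge> 1 \<and> path_map S n i (fst e) h}"
      then obtain n h where h: "path_map S n i (fst e) h" "y = app f (h z)" by auto
      have "path_map S (Suc n) i (snd e) (app f \<circ> h)"
        using e by (intro path_map_snoc[OF h(1)]) auto
      then show "y \<in> {h z |n h. n \<ge> 1 \<and> path_map S n i (snd e) h}"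
        unfolding mem_Collect_eq h(2)
        by (intro exI[of _ "Suc n"] exI[of _ "app f \<circ> h"]) simp
    qed
    then have "closure (app f ` {h z |n h. n \<ge> 1 \<and> path_map S n i (fst e) h}) \<subseteq> orbit_closure S z i (snd e)"
      unfolding orbit_closure_def by (rule closure_mono)
    finally show "app f ` orbit_closure S z i (fst e) \<subseteq> orbit_closure S z i (snd e)" .
  qed
  fix j
  obtain n h where "n \<ge> 1" "path_map S n i j h" using ex_path_map by blast
  then have "h z \<in> {h z |n h. n \<ge> 1 \<and> path_map S n i j h}" by blast
  then show "orbit_closure S z i j \<noteq> {}" unfolding orbit_closure_def by auto
  show "compact (orbit_closure S z i j)"
    by (simp add: orbit_closure_def compact_sphere_iff)
qed

lemma orbit_closure_minimal:
  assumes "minimal_set S L" "z \<in> L i"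
  shows "orbit_closure S z i = L"
  by (rule minimal_set_eqI[OF assms(1) compact_invariant_orbit_closure])
     (rule orbit_closure_subset[OF minimal_setD[OF assms(1)] assms(2)])

text \<open>Both sets are recovered from the common point as its orbit closure, over all vertices at
  once.\<close>

lemma minimal_set_disjoint:
  assumes "minimal_set S L" "minimal_set S L'" "z \<in> L i" "z \<in> L' i"
  shows "L = L'"
  using orbit_closure_minimal[OF assms(1,3)] orbit_closure_minimal[OF assms(2,4)] by simp

text \<open>For a minimal set this yields \<open>path_image S n L = L\<close>: each of its points is
  reached from the set by a word of any prescribed length.\<close>

lemma compact_invariant_path_image:
  assumes L: "compact_invariant S L"
  shows "compact_invariant S (path_image S n L)"
  unfolding compact_invariant_def
proof (intro conjI allI)
  show "forward_invariant S (path_image S n L)"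
    unfolding forward_invariant_def
  proof (intro ballI subsetI)
    fix e f y assume e: "e \<in> edges S" "f \<in> gens S e" "y \<in> app f ` path_image S n L (fst e)"
    then obtain i h x where h: "path_map S n i (fst e) h" "x \<in> L i" "y = app f (h x)"
      by (auto simp: path_image_def)
    have "path_map S (Suc n) i (snd e) (app f \<circ> h)"
      using e by (intro path_map_snoc[OF h(1)]) auto
    \<comment> \<open>The word is cut after its first map instead of before its last; invariance of
      \<open>L\<close> keeps the intermediate point in \<open>L\<close>.\<close>
    then have "path_map S (1 + n) i (snd e) (app f \<circ> h)" by simp
    then obtain j g g' where g: "path_map S 1 i j g" "path_map S n j (snd e) g'" "app f \<circ> h = g' \<circ> g"
      by (rule path_map_split)
    have "g x \<in> L j" using compact_invariant_path_map[OF L g(1)] h(2) by blast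
    moreover have "y = g' (g x)" using fun_cong[OF g(3), of x] h(3) by simp
    ultimately show "y \<in> path_image S n L (snd e)" using g(2) by (auto simp: path_image_def)
  qed
  fix j
  obtain i h where h: "path_map S n i j h" using ex_path_map_in by blast
  moreover obtain x where "x \<in> L i" using L by (auto simp: compact_invariant_def)
  ultimately have "h x \<in> path_image S n L j" by (auto simp: path_image_def)
  then show "path_image S n L j \<noteq> {}" by auto
  show "compact (path_image S n L j)"
    using L by (intro compact_path_image) (simp add: compact_invariant_def)
qed

text \<open>Some orbit starting in \<open>L\<close> enters \<open>U\<close> and stays there. As
  \<open>L\<close> is the closure of that orbit, it lies in the closure of \<open>U\<close>, hence
  of \<open>W\<close>; being its own image under N steps, it lies in \<open>U\<close>.\<close>

lemma minimal_set_subset_trapping: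
  assumes T: "trapping S N U W" and L: "minimal_set S L"
  shows "L i \<subseteq> U i"
proof -
  obtain z where z: "z \<in> L i" using minimal_setD[OF L] by (auto simp: compact_invariant_def)
  have "\<forall>z i. \<exists>n j h. path_map S n i j h \<and> h z \<in> U j" using T unfolding trapping_def by (elim conjE)
  then obtain n j h where h: "path_map S n i j h" "h z \<in> U j" by blast
  have "h z \<in> L j" using compact_invariant_path_map[OF minimal_setD[OF L] h(1)] z by blast
  then have Leq: "L = orbit_closure S (h z) j" using orbit_closure_minimal[OF L] by simp
  have "L k \<subseteq> closure (U k)" for k
    unfolding Leq orbit_closure_def
    by (rule closure_mono) (use trapping_path_map(2)[OF T] h(2) in blast)
  moreover have "closure (U k) \<subseteq> closure (W k)" for k
    using T closure_subset[of "W k"] by (auto simp: trapping_def)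
  ultimately have LW: "L k \<subseteq> closure (W k)" for k by blast
  have "path_image S N L = L"
  proof (rule minimal_set_eqI[OF L compact_invariant_path_image[OF minimal_setD[OF L]]])
    show "path_image S N L k \<subseteq> L k" for k
      using compact_invariant_path_map[OF minimal_setD[OF L]] unfolding path_image_def by fastforce
  qed
  then have "L i = path_image S N L i" by simp
  also have "\<dots> \<subseteq> U i"
  proof
    fix y assume "y \<in> path_image S N L i"
    then obtain k h x where h: "path_map S N k i h" "x \<in> L k" "y = h x" by (auto simp: path_image_def)
    then have "x \<in> closure (W k)" using LW by blast
    with trapping_block[OF T h(1)] h(3) show "y \<in> U i" by blast
  qed
  finally show ?thesis .
qed

lemma minimal_set_attracting:
  assumes T: "trapping S N U W" and L: "minimal_set S L"
  shows "attracting S L"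
proof -
  have N: "N \<ge> 1" using T by (simp add: trapping_def)
  have "closure (h ` W i) \<subseteq> U j" if "path_map S N i j h" for i j h
  proof -
    have "compact (h ` closure (W i))"
      by (intro compact_continuous_image continuous_on_path_map[OF that]) (simp add: compact_sphere_iff)
    then have "closure (h ` W i) \<subseteq> h ` closure (W i)"
      using closure_subset[of "W i"] by (intro closure_minimal compact_imp_closed) auto
    with trapping_block[OF T that] show ?thesis by blast
  qed
  then have 1: "\<forall>es fs. admissible_maps S es fs \<and> length es = N \<longrightarrow>
        closure (comp_list fs ` W (fst (hd es))) \<subseteq> U (snd (last es))"
    unfolding all_admissible_maps_iff[OF N] by simp
  have 2: "(\<forall>i. open (U i) \<and> open (W i))" "(\<forall>i. L i \<subseteq> U i \<and> closure (U i) \<subseteq> W i \<and> closure (W i) \<subseteq> fatou S i)"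
    using T minimal_set_subset_trapping[OF T L] by (simp_all add: trapping_def)
  show ?thesis unfolding attracting_def
    by (rule exI[of _ N], rule conjI[OF N], rule exI[of _ U], rule exI[of _ W]) (intro conjI 1 2)
qed

lemma minimal_set_separation:
  assumes L: "minimal_set S L" and L': "minimal_set S L'" and "L \<noteq> L'"
  obtains d where "d > 0" "\<And>i x y. x \<in> L i \<Longrightarrow> y \<in> L' i \<Longrightarrow> d \<le> dist x y"
proof -
  have "\<exists>d>0. \<forall>x\<in>L i. \<forall>y\<in>L' i. d \<le> dist x y" for i
  proof -
    have c: "compact (L i)" "compact (L' i)"
      using minimal_setD[OF L] minimal_setD[OF L'] by (auto simp: compact_invariant_def)
    have "L i \<inter> L' i = {}" using minimal_set_disjoint[OF L L'] assms(3) by blast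
    then have "L i \<subseteq> - L' i" by blast
    then obtain d where "d > 0" "\<And>x y. x \<in> L i \<Longrightarrow> dist x y < d \<Longrightarrow> y \<in> - L' i"
      using compact_subset_open_margin[OF c(1) open_Compl[OF compact_imp_closed[OF c(2)]]] by metis
    then show ?thesis by (intro exI[of _ d]) (force simp: not_less[symmetric])
  qed
  then have "\<exists>d>0. \<forall>i. \<forall>x\<in>L i. \<forall>y\<in>L' i. d \<le> dist x y"
    by (rule finite_pos_choice) force
  then show thesis using that by blast
qed

end

section \<open>Neighbourhoods of the minimal sets and the paths that enter them\<close>

definition near_minimal :: "'v gdms \<Rightarrow> real \<Rightarrow> 'v \<Rightarrow> riemann_sphere set" where
  "near_minimal S r i = {x. \<exists>L y. minimal_set S L \<and> y \<in> L i \<and> dist y x < r}"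

lemma open_near_minimal: "open (near_minimal S r i)"
proof -
  have "near_minimal S r i = (\<Union>L\<in>{L. minimal_set S L}. \<Union>y\<in>L i. ball y r)"
    unfolding near_minimal_def ball_def by blast
  then show ?thesis by auto
qed

text \<open>The path space asks only that each label be an edge. Consecutive edges and maps from the
  supports are an additional property, almost sure by \<open>AE_pmeas_regular\<close>.\<close>

definition regular_path :: "'v gdms \<Rightarrow> 'v path \<Rightarrow> bool" where
  "regular_path S \<xi> \<longleftrightarrow> (\<forall>n. snd (\<xi> n) \<in> edges S \<and> fst (\<xi> n) \<in> gens S (snd (\<xi> n)) \<and>
     snd (snd (\<xi> n)) = fst (snd (\<xi> (Suc n))))"

lemma traj_add: "traj \<xi> (m + n) = traj (\<lambda>k. \<xi> (m + k)) n \<circ> traj \<xi> m"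
  by (induction n) (simp_all only: add_0_right add_Suc_right traj.simps id_comp comp_assoc)

lemma regular_path_shift: "regular_path S \<xi> \<Longrightarrow> regular_path S (\<lambda>k. \<xi> (m + k))"
  unfolding regular_path_def by (metis add_Suc_right)

lemma regular_path_traj:
  assumes "regular_path S \<xi>"
  shows "path_map S n (fst (snd (\<xi> 0))) (fst (snd (\<xi> n))) (traj \<xi> n)"
proof (induction n)
  case 0
  show ?case unfolding traj.simps by (rule path_map_0)
next
  case (Suc n)
  have e: "(fst (snd (\<xi> n)), fst (snd (\<xi> (Suc n)))) = snd (\<xi> n)"
    using assms unfolding regular_path_def by (metis prod.collapse)
  show ?case unfolding traj.simps
    by (rule path_map_snoc[OF Suc]) (use assms in \<open>auto simp: e regular_path_def\<close>)
qed

text \<open>All that is kept of the trapping region: exponential contraction of a point near a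
  minimal set towards an orbit inside it.\<close>

locale contracting_gdms = compact_gdms S for S :: "'v::finite gdms" +
  fixes C r c :: real
  assumes pos: "C > 0" "r > 0" "0 < c" and c_less_1: "c < 1"
    and contraction: "minimal_set S L \<Longrightarrow> y \<in> L i \<Longrightarrow> dist y x < r \<Longrightarrow> path_map S n i j h \<Longrightarrow>
      dist (h y) (h x) \<le> C * c ^ n"
begin

text \<open>A long word would bring the two points together, while their images stay in the two
  sets, which have a positive distance if they differ.\<close>

lemma minimal_set_eq_of_close:
  assumes L: "minimal_set S L" and L': "minimal_set S L'" and xy: "x \<in> L i" "y \<in> L' i" "dist x y < r"
  shows "L = L'"
proof (rule ccontr)
  assume "L \<noteq> L'"
  then obtain d where d: "d > 0" "\<And>i x y. x \<in> L i \<Longrightarrow> y \<in> L' i \<Longrightarrow> d \<le> dist x y"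
    using minimal_set_separation[OF L L'] by metis
  obtain n where n: "c ^ n < d / C" using real_arch_pow_inv[of "d / C" c] d(1) pos c_less_1 by auto
  obtain j h where h: "path_map S n i j h" using ex_path_map_out by blast
  have "d \<le> dist (h x) (h y)"
    using compact_invariant_path_map[OF minimal_setD[OF L] h] compact_invariant_path_map[OF minimal_setD[OF L'] h] xy
    by (intro d(2)[of _ j]) auto
  also have "\<dots> \<le> C * c ^ n" by (rule contraction[OF L xy(1,3) h])
  also have "\<dots> < d" using n pos by (simp add: field_simps)
  finally show False by simp
qed

text \<open>Distinct minimal sets are at least \<open>r\<close> apart at each vertex, so already at
  one arbitrary vertex, here \<open>undefined\<close>, an r/2-net tells them apart.\<close>

lemma finite_minimal_sets: "finite {L. minimal_set S L}"
proof -
  obtain X :: "riemann_sphere set" where X: "finite X" "\<And>x. \<exists>y\<in>X. dist x y < r / 2"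
    using sphere_finite_net[of "r / 2"] pos by auto
  have "\<exists>y x. y \<in> X \<and> x \<in> L undefined \<and> dist x y < r / 2" if "minimal_set S L" for L :: "'v \<Rightarrow> riemann_sphere set"
    using minimal_setD[OF that] X(2) unfolding compact_invariant_def by blast
  then obtain p q where p: "\<And>L. minimal_set S L \<Longrightarrow> p L \<in> X \<and> q L \<in> L undefined \<and> dist (q L) (p L) < r / 2"
    by metis
  show ?thesis
  proof (rule inj_on_finite[OF _ _ X(1)])
    show "p ` {L. minimal_set S L} \<subseteq> X" using p by auto
    show "inj_on p {L. minimal_set S L}"
    proof (rule inj_onI, unfold mem_Collect_eq)
      fix L L' assume L: "minimal_set S L" "minimal_set S L'" "p L = p L'"
      have "dist (q L) (q L') < r"
        using p[OF L(1)] p[OF L(2)] L(3) dist_triangle2[of "q L" "q L'" "p L"] by auto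
      then show "L = L'" using p[OF L(1)] p[OF L(2)] minimal_set_eq_of_close[OF L(1,2)] by blast
    qed
  qed
qed

lemma ex_path_to_near_minimal: "\<exists>n j h. path_map S n i j h \<and> h z \<in> near_minimal S r j"
proof -
  obtain L where L: "minimal_set S L" "\<And>j. L j \<subseteq> orbit_closure S z i j"
    using ex_minimal_set[OF compact_invariant_orbit_closure] by metis
  obtain y where y: "y \<in> L i" using minimal_setD[OF L(1)] by (auto simp: compact_invariant_def)
  then have "y \<in> closure {h z | n h. n \<ge> 1 \<and> path_map S n i i h}"
    using L(2) by (auto simp: orbit_closure_def)
  then obtain n h where h: "path_map S n i i h" "dist (h z) y < r"
    using pos(2) unfolding closure_approachable by blast
  then have "h z \<in> near_minimal S r i" using L(1) y by (auto simp: near_minimal_def dist_commute)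
  with h(1) show ?thesis by blast
qed

text \<open>\<open>fst (snd (\<xi> n))\<close> is the vertex at which the path stands after
  \<open>n\<close> maps; time 0 counts.\<close>

definition hits :: "'v path \<Rightarrow> riemann_sphere \<Rightarrow> bool" where
  "hits \<xi> z \<longleftrightarrow> (\<exists>n. traj \<xi> n z \<in> near_minimal S r (fst (snd (\<xi> n))))"

text \<open>From the hitting time \<open>m\<close> on, the path is shadowed by the orbit of the
  nearby point \<open>y\<close>, which never leaves the minimal set.\<close>

lemma hits_imp_tends_to:
  assumes "regular_path S \<xi>" "hits \<xi> z"
  obtains L where "minimal_set S L" "tends_to \<xi> z L"
proof -
  obtain m where "traj \<xi> m z \<in> near_minimal S r (fst (snd (\<xi> m)))" using assms(2) by (auto simp: hits_def)
  then obtain L y where L: "minimal_set S L" "y \<in> L (fst (snd (\<xi> m)))" "dist y (traj \<xi> m z) < r"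
    by (auto simp: near_minimal_def)
  define \<zeta> where "\<zeta> = (\<lambda>k. \<xi> (m + k))"
  have \<zeta>: "regular_path S \<zeta>" unfolding \<zeta>_def by (rule regular_path_shift[OF assms(1)])
  have pm: "path_map S n (fst (snd (\<xi> m))) (fst (snd (\<zeta> n))) (traj \<zeta> n)" for n
    using regular_path_traj[OF \<zeta>, of n] by (simp add: \<zeta>_def)
  have bound: "infdist (traj \<xi> (Suc (n + m)) z) (L (snd (snd (\<xi> (n + m))))) \<le> C * c ^ Suc n" for n
  proof -
    \<comment> \<open>\<open>tends_to\<close> uses the terminal vertex of the last edge taken; on a
      regular path this is the initial vertex of the next one.\<close>
    have "snd (snd (\<xi> (n + m))) = fst (snd (\<zeta> (Suc n)))"
      using assms(1) by (simp add: regular_path_def \<zeta>_def add.commute)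
    moreover have "traj \<xi> (Suc (n + m)) z = traj \<zeta> (Suc n) (traj \<xi> m z)"
      using fun_cong[OF traj_add[of \<xi> m "Suc n"], of z] by (simp add: \<zeta>_def add.commute)
    moreover have "traj \<zeta> (Suc n) y \<in> L (fst (snd (\<zeta> (Suc n))))"
      using compact_invariant_path_map[OF minimal_setD[OF L(1)] pm] L(2) by blast
    moreover have "dist (traj \<zeta> (Suc n) y) (traj \<zeta> (Suc n) (traj \<xi> m z)) \<le> C * c ^ Suc n"
      by (rule contraction[OF L pm])
    ultimately show ?thesis
      using infdist_le[of "traj \<zeta> (Suc n) y" _ "traj \<zeta> (Suc n) (traj \<xi> m z)"] by (simp only: dist_commute) (meson order_trans)
  qed
  have "(\<lambda>n. C * c ^ Suc n) \<longlonglongrightarrow> C * 0"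
    using pos c_less_1 by (intro tendsto_mult tendsto_const LIMSEQ_Suc LIMSEQ_realpow_zero) auto
  then have lim: "(\<lambda>n. C * c ^ Suc n) \<longlonglongrightarrow> 0" by simp
  have "(\<lambda>n. infdist (traj \<xi> (Suc (n + m)) z) (L (snd (snd (\<xi> (n + m)))))) \<longlonglongrightarrow> 0"
    by (rule tendsto_sandwich[OF always_eventually[OF allI[OF infdist_nonneg]] always_eventually[OF allI[OF bound]]
          tendsto_const lim])
  then have "tends_to \<xi> z L" unfolding tends_to_def by (rule LIMSEQ_offset)
  with L(1) show thesis by (rule that)
qed

lemma hits_imp_contraction:
  assumes "regular_path S \<xi>" "hits \<xi> z"
  obtains \<rho> K where "\<rho> > 0" "K > 0"
    "\<And>n x y. x \<in> ball z \<rho> \<Longrightarrow> y \<in> ball z \<rho> \<Longrightarrow> dist (traj \<xi> n x) (traj \<xi> n y) \<le> K * c ^ n"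
proof -
  obtain m where "traj \<xi> m z \<in> near_minimal S r (fst (snd (\<xi> m)))" using assms(2) by (auto simp: hits_def)
  then obtain L y where L: "minimal_set S L" "y \<in> L (fst (snd (\<xi> m)))" "dist y (traj \<xi> m z) < r"
    by (auto simp: near_minimal_def)
  define \<zeta> where "\<zeta> = (\<lambda>k. \<xi> (m + k))"
  have \<zeta>: "regular_path S \<zeta>" unfolding \<zeta>_def by (rule regular_path_shift[OF assms(1)])
  have pm: "path_map S n (fst (snd (\<xi> m))) (fst (snd (\<zeta> n))) (traj \<zeta> n)" for n
    using regular_path_traj[OF \<zeta>, of n] by (simp add: \<zeta>_def)
  have "open (traj \<xi> m -` ball y r)"
    by (intro open_vimage open_ball continuous_on_path_map[OF regular_path_traj[OF assms(1)]])
  then obtain \<rho> where \<rho>: "\<rho> > 0" "ball z \<rho> \<subseteq> traj \<xi> m -` ball y r"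
    using L(3) by (auto elim!: openE)
  \<comment> \<open>2 C comes from comparing both points with \<open>y\<close>. The summand pi
    covers the times before \<open>m\<close>, where only the diameter bound is available, and
    division by c^m accounts for the late start.\<close>
  define K where "K = (2 * C + pi) / c ^ m"
  show thesis
  proof (rule that[OF \<rho>(1), of K])
    show "K > 0" using pos by (simp add: K_def add_pos_pos)
    fix n x x' assume x: "x \<in> ball z \<rho>" "x' \<in> ball z \<rho>"
    show "dist (traj \<xi> n x) (traj \<xi> n x') \<le> K * c ^ n"
    proof (cases "n < m")
      case True
      then have "c ^ m \<le> c ^ n" using pos c_less_1 by (intro power_decreasing) auto
      then have "pi * c ^ m \<le> (2 * C + pi) * c ^ n" using pos by (intro mult_mono) auto
      then have "pi \<le> K * c ^ n" using pos by (simp add: K_def field_simps)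
      with dist_riemann_sphere_le_pi[of "traj \<xi> n x" "traj \<xi> n x'"] show ?thesis by linarith
    next
      case False
      define k where "k = n - m"
      have n: "n = m + k" using False by (simp add: k_def)
      have tr: "traj \<xi> n v = traj \<zeta> k (traj \<xi> m v)" for v
        using fun_cong[OF traj_add[of \<xi> m k], of v] by (simp add: n \<zeta>_def)
      have "dist (traj \<zeta> k y) (traj \<zeta> k (traj \<xi> m v)) \<le> C * c ^ k" if "v \<in> ball z \<rho>" for v
        using \<rho>(2) that by (intro contraction[OF L(1,2) _ pm]) auto
      from this[OF x(1)] this[OF x(2)]
      have "dist (traj \<xi> n x) (traj \<xi> n x') \<le> 2 * C * c ^ k"
        unfolding tr using dist_triangle3[of "traj \<zeta> k (traj \<xi> m x)" "traj \<zeta> k (traj \<xi> m x')" "traj \<zeta> k y"] by linarith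
      also have "\<dots> \<le> (2 * C + pi) * c ^ k" using pos by (intro mult_right_mono) auto
      also have "\<dots> = K * c ^ n" using pos by (simp add: K_def n power_add)
      finally show ?thesis .
    qed
  qed
qed

text \<open>At a late time the point would be close to both sets at the same vertex, against their
  positive distance.\<close>

lemma tends_to_unique:
  assumes L: "minimal_set S L" "minimal_set S L'" and t: "tends_to \<xi> z L" "tends_to \<xi> z L'"
  shows "L = L'"
proof (rule ccontr)
  assume "L \<noteq> L'"
  then obtain d where d: "d > 0" "\<And>i x y. x \<in> L i \<Longrightarrow> y \<in> L' i \<Longrightarrow> d \<le> dist x y"
    using minimal_set_separation[OF L] by metis
  have d2: "0 < d / 2" using d(1) by simp
  from order_tendstoD(2)[OF t(1)[unfolded tends_to_def] d2] order_tendstoD(2)[OF t(2)[unfolded tends_to_def] d2]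
  have "\<forall>\<^sub>F n in sequentially. infdist (traj \<xi> (Suc n) z) (L (snd (snd (\<xi> n)))) < d / 2 \<and>
      infdist (traj \<xi> (Suc n) z) (L' (snd (snd (\<xi> n)))) < d / 2"
    by (rule eventually_conj)
  then obtain n where n: "infdist (traj \<xi> (Suc n) z) (L (snd (snd (\<xi> n)))) < d / 2"
      "infdist (traj \<xi> (Suc n) z) (L' (snd (snd (\<xi> n)))) < d / 2"
    unfolding eventually_sequentially by blast
  have near: "\<exists>a\<in>A. dist p a < d / 2" if "infdist p A < d / 2" "A \<noteq> {}" for p :: riemann_sphere and A
  proof (rule ccontr)
    assume "\<not> (\<exists>a\<in>A. dist p a < d / 2)"
    then have "d / 2 \<le> infdist p A"
      unfolding infdist_notempty[OF that(2)] by (intro cINF_greatest that(2)) force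
    with that(1) show False by simp
  qed
  have ne: "L i \<noteq> {}" "L' i \<noteq> {}" for i
    using minimal_setD[OF L(1)] minimal_setD[OF L(2)] by (auto simp: compact_invariant_def)
  obtain a b where "a \<in> L (snd (snd (\<xi> n)))" "dist (traj \<xi> (Suc n) z) a < d / 2"
    "b \<in> L' (snd (snd (\<xi> n)))" "dist (traj \<xi> (Suc n) z) b < d / 2"
    using near[OF n(1) ne(1)] near[OF n(2) ne(2)] by blast
  with d(2)[of a _ b] dist_triangle3[of a b "traj \<xi> (Suc n) z"] show False by fastforce
qed

lemma tends_to_cong:
  assumes z: "\<And>n. dist (traj \<xi> n x) (traj \<xi> n y) \<le> K * c ^ n" and t: "tends_to \<xi> x L"
  shows "tends_to \<xi> y L"
proof -
  have "(\<lambda>n. K * c ^ Suc n) \<longlonglongrightarrow> K * 0"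
    using pos c_less_1 by (intro tendsto_mult tendsto_const LIMSEQ_Suc LIMSEQ_realpow_zero) auto
  from tendsto_add[OF this t[unfolded tends_to_def]]
  have lim: "(\<lambda>n. K * c ^ Suc n + infdist (traj \<xi> (Suc n) x) (L (snd (snd (\<xi> n))))) \<longlonglongrightarrow> 0" by simp
  show ?thesis unfolding tends_to_def
  proof (rule tendsto_sandwich[OF _ _ tendsto_const lim])
    show "\<forall>\<^sub>F n in sequentially. 0 \<le> infdist (traj \<xi> (Suc n) y) (L (snd (snd (\<xi> n))))"
      by (simp add: infdist_nonneg)
    have "infdist (traj \<xi> (Suc n) y) (L (snd (snd (\<xi> n)))) \<le> K * c ^ Suc n + infdist (traj \<xi> (Suc n) x) (L (snd (snd (\<xi> n))))" for n
      using infdist_triangle[of "traj \<xi> (Suc n) y" "L (snd (snd (\<xi> n)))" "traj \<xi> (Suc n) x"] z[of "Suc n"]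
      by (simp only: dist_commute[of "traj \<xi> (Suc n) y"])
    then show "\<forall>\<^sub>F n in sequentially. infdist (traj \<xi> (Suc n) y) (L (snd (snd (\<xi> n)))) \<le> K * c ^ Suc n + infdist (traj \<xi> (Suc n) x) (L (snd (snd (\<xi> n))))"
      by (intro always_eventually allI)
  qed
qed

lemma hits_imp_not_julia:
  assumes "regular_path S \<xi>" "hits \<xi> z"
  shows "z \<notin> path_julia \<xi>"
proof -
  obtain \<rho> K where \<rho>: "\<rho> > 0" "K > 0"
    "\<And>n x y. x \<in> ball z \<rho> \<Longrightarrow> y \<in> ball z \<rho> \<Longrightarrow> dist (traj \<xi> n x) (traj \<xi> n y) \<le> K * c ^ n"
    using hits_imp_contraction[OF assms] by metis
  have "equicontinuous_on (ball z \<rho>) {traj \<xi> n |n. n \<ge> 1}"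
    unfolding equicontinuous_on_def
  proof (intro ballI allI impI)
    fix x and e :: real assume x: "x \<in> ball z \<rho>" and e: "e > 0"
    \<comment> \<open>From time \<open>M\<close> on the exponential bound is below \<open>e\<close>;
      the finitely many earlier maps are individually continuous.\<close>
    obtain M where M: "c ^ M < e / K" using real_arch_pow_inv[of "e / K" c] e \<rho>(2) c_less_1 by auto
    have "\<forall>\<^sub>F y in nhds x. dist (traj \<xi> n y) (traj \<xi> n x) < e" for n
    proof -
      have "isCont (traj \<xi> n) x"
        using continuous_on_path_map[OF regular_path_traj[OF assms(1)], of UNIV n]
        by (simp add: continuous_on_eq_continuous_at)
      then have "(traj \<xi> n \<longlongrightarrow> traj \<xi> n x) (nhds x)" by (simp add: isCont_def tendsto_nhds_iff)
      then show ?thesis using e by (rule tendstoD)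
    qed
    then have "\<forall>\<^sub>F y in nhds x. \<forall>n\<in>{..<M}. dist (traj \<xi> n y) (traj \<xi> n x) < e"
      by (intro eventually_ball_finite) auto
    then obtain d where d: "d > 0" "\<And>y n. dist y x < d \<Longrightarrow> n < M \<Longrightarrow> dist (traj \<xi> n y) (traj \<xi> n x) < e"
      unfolding eventually_nhds_metric by (auto simp: lessThan_iff)
    show "\<exists>\<delta>>0. \<forall>y\<in>ball z \<rho>. dist x y < \<delta> \<longrightarrow> (\<forall>f\<in>{traj \<xi> n |n. n \<ge> 1}. dist (f x) (f y) < e)"
    proof (intro exI[of _ d] conjI ballI impI d(1))
      fix y f assume y: "y \<in> ball z \<rho>" "dist x y < d" and "f \<in> {traj \<xi> n |n. n \<ge> 1}"
      then obtain n where f: "f = traj \<xi> n" by auto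
      show "dist (f x) (f y) < e"
      proof (cases "n < M")
        case True
        then show ?thesis using d(2)[of y n] y by (simp add: f dist_commute)
      next
        case False
        then have "c ^ n \<le> c ^ M" using pos c_less_1 by (intro power_decreasing) auto
        then have "K * c ^ n < e" using M \<rho>(2) by (simp add: field_simps) (meson le_less_trans mult_left_mono less_imp_le)
        with \<rho>(3)[OF x y(1), of n] show ?thesis by (simp add: f)
      qed
    qed
  qed
  then have "z \<in> fatou_set {traj \<xi> n |n. n \<ge> 1}"
    unfolding fatou_set_def using \<rho>(1) by (intro CollectI exI[of _ "ball z \<rho>"]) auto
  then show ?thesis by (simp add: path_julia_def)
qed

end


section \<open>The path space\<close>

lemma space_path_borel: "space (path_borel \<tau>) = {\<xi>. \<forall>n. snd (\<xi> n) \<in> mrds_edges \<tau>}"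
  by (auto simp: path_borel_def space_measure_of_conv path_topology_def PiE_iff mem_Times_iff)

lemma sets_path_borel:
  "sets (path_borel \<tau>) = sigma_sets (space (path_borel \<tau>)) {U. openin (path_topology \<tau>) U}"
  unfolding path_borel_def space_measure_of_conv
  by (rule sets_measure_of) (auto dest: openin_subset)

lemma open_imp_sets_path_borel: "openin (path_topology \<tau>) U \<Longrightarrow> U \<in> sets (path_borel \<tau>)"
  unfolding sets_path_borel by (rule sigma_sets.Basic) simp

lemma topspace_path_topology: "topspace (path_topology \<tau>) = space (path_borel \<tau>)"
  by (simp add: path_borel_def space_measure_of_conv)

lemma continuous_map_path_component:
  "continuous_map (path_topology \<tau>) (prod_topology euclidean (discrete_topology (mrds_edges \<tau>))) (\<lambda>\<xi>. \<xi> n)"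
  unfolding path_topology_def by (rule continuous_map_product_projection) simp

lemma measurable_path_fst: "(\<lambda>\<xi>. fst (\<xi> n)) \<in> borel_measurable (path_borel \<tau>)"
proof (rule borel_measurableI)
  fix A :: "rat_plus set" assume "open A"
  moreover have "continuous_map (path_topology \<tau>) euclidean (\<lambda>\<xi>. fst (\<xi> n))"
    using continuous_map_compose[OF continuous_map_path_component continuous_map_fst] by (simp add: o_def)
  ultimately have "openin (path_topology \<tau>) {\<xi> \<in> topspace (path_topology \<tau>). fst (\<xi> n) \<in> A}"
    by (intro openin_continuous_map_preimage) auto
  also have "{\<xi> \<in> topspace (path_topology \<tau>). fst (\<xi> n) \<in> A} = (\<lambda>\<xi>. fst (\<xi> n)) -` A \<inter> space (path_borel \<tau>)"
    by (auto simp: topspace_path_topology)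
  finally show "(\<lambda>\<xi>. fst (\<xi> n)) -` A \<inter> space (path_borel \<tau>) \<in> sets (path_borel \<tau>)"
    by (rule open_imp_sets_path_borel)
qed

lemma measurable_path_snd:
  fixes \<tau> :: "'v::finite \<Rightarrow> 'v \<Rightarrow> rat_plus measure"
  shows "(\<lambda>\<xi>. snd (\<xi> n)) \<in> path_borel \<tau> \<rightarrow>\<^sub>M count_space (mrds_edges \<tau>)"
proof (subst measurable_count_space_eq2)
  have "(\<lambda>\<xi>. snd (\<xi> n)) -` {e} \<inter> space (path_borel \<tau>) \<in> sets (path_borel \<tau>)" if "e \<in> mrds_edges \<tau>" for e
  proof -
    have "continuous_map (path_topology \<tau>) (discrete_topology (mrds_edges \<tau>)) (\<lambda>\<xi>. snd (\<xi> n))"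
      using continuous_map_compose[OF continuous_map_path_component continuous_map_snd] by (simp add: o_def)
    then have "openin (path_topology \<tau>) {\<xi> \<in> topspace (path_topology \<tau>). snd (\<xi> n) \<in> {e}}"
      using that by (intro openin_continuous_map_preimage) auto
    also have "{\<xi> \<in> topspace (path_topology \<tau>). snd (\<xi> n) \<in> {e}} = (\<lambda>\<xi>. snd (\<xi> n)) -` {e} \<inter> space (path_borel \<tau>)"
      by (auto simp: topspace_path_topology)
    finally show ?thesis by (rule open_imp_sets_path_borel)
  qed
  then show "(\<lambda>\<xi>. snd (\<xi> n)) \<in> space (path_borel \<tau>) \<rightarrow> mrds_edges \<tau> \<and>
    (\<forall>e\<in>mrds_edges \<tau>. (\<lambda>\<xi>. snd (\<xi> n)) -` {e} \<inter> space (path_borel \<tau>) \<in> sets (path_borel \<tau>))"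
    by (auto simp: space_path_borel)
qed (rule finite)

section \<open>Cylinders as an intersection-stable generator of the Borel sets\<close>

definition cylinders :: "('v \<Rightarrow> 'v \<Rightarrow> rat_plus measure) \<Rightarrow> 'v path set set" where
  "cylinders \<tau> = {cylinder \<tau> As es | As es. es \<noteq> [] \<and> length As = length es \<and>
     set As \<subseteq> sets borel \<and> set es \<subseteq> mrds_edges \<tau>}"

lemma vimage_cylinder_measurable:
  assumes "\<And>n. (\<lambda>\<omega>. fst (f \<omega> n)) \<in> borel_measurable M"
    and "\<And>n. (\<lambda>\<omega>. snd (f \<omega> n)) \<in> M \<rightarrow>\<^sub>M count_space (mrds_edges \<tau>)"
    and X: "X \<in> cylinders \<tau>"
  shows "f -` X \<inter> space M \<in> sets M"
proof -
  obtain As es where X: "X = cylinder \<tau> As es" and es: "es \<noteq> []" "length As = length es"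
    "set As \<subseteq> sets borel" "set es \<subseteq> mrds_edges \<tau>" using X by (auto simp: cylinders_def)
  have "snd (f \<omega> n) \<in> mrds_edges \<tau>" if "\<omega> \<in> space M" for \<omega> n
    using measurable_space[OF assms(2) that] by simp
  then have "f -` X \<inter> space M = (\<Inter>n\<in>{..<length es}.
     ((\<lambda>\<omega>. fst (f \<omega> n)) -` (As ! n) \<inter> space M) \<inter> ((\<lambda>\<omega>. snd (f \<omega> n)) -` {es ! n} \<inter> space M))"
    using es(1) by (auto simp: X cylinder_def space_path_borel)
  also have "\<dots> \<in> sets M"
  proof (rule sets.finite_INT)
    fix n assume "n \<in> {..<length es}"
    then have "As ! n \<in> set As" "es ! n \<in> set es" using es(2) by auto
    then have "As ! n \<in> sets borel" "es ! n \<in> mrds_edges \<tau>" using es(3,4) by blast+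
    then show "((\<lambda>\<omega>. fst (f \<omega> n)) -` (As ! n) \<inter> space M) \<inter> ((\<lambda>\<omega>. snd (f \<omega> n)) -` {es ! n} \<inter> space M) \<in> sets M"
      by (intro sets.Int measurable_sets[OF assms(1)] measurable_sets[OF assms(2)]) simp_all
  qed (use es in auto)
  finally show ?thesis .
qed

text \<open>With a countable base for the maps and finitely many edges there are only countably many
  cylinders \<open>CC\<close>, and they form a base of the product topology; so an open set is a
  countable union of them.\<close>

lemma open_in_sigma_cylinders:
  fixes \<tau> :: "'v::finite \<Rightarrow> 'v \<Rightarrow> rat_plus measure"
  assumes U: "openin (path_topology \<tau>) U"
  shows "U \<in> sigma_sets (space (path_borel \<tau>)) (cylinders \<tau>)"
proof -
  obtain B :: "rat_plus set set" where B: "countable B" "topological_basis B"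
    using ex_countable_basis by blast
  define B' where "B' = insert UNIV B"
  define CC where "CC = (\<lambda>(As, es). cylinder \<tau> As es) `
    {(As, es). As \<in> lists B' \<and> es \<in> lists (mrds_edges \<tau>) \<and> es \<noteq> [] \<and> length As = length es}"
  have "countable (lists B' \<times> lists (mrds_edges \<tau>))"
    using B(1) by (intro countable_SIGMA countable_lists) (auto simp: B'_def)
  then have "countable {(As, es). As \<in> lists B' \<and> es \<in> lists (mrds_edges \<tau>) \<and> es \<noteq> [] \<and> length As = length es}"
    by (rule countable_subset[rotated]) auto
  then have CCc: "countable CC" unfolding CC_def by (rule countable_image)
  have CCs: "CC \<subseteq> cylinders \<tau>"
  proof
    fix X assume "X \<in> CC"
    then obtain As es where X: "X = cylinder \<tau> As es" "As \<in> lists B'" "es \<in> lists (mrds_edges \<tau>)"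
      "es \<noteq> []" "length As = length es" by (auto simp: CC_def)
    moreover have "set As \<subseteq> sets borel"
      using X(2) topological_basis_open[OF B(2)] by (auto simp: B'_def)
    ultimately show "X \<in> cylinders \<tau>" unfolding cylinders_def by blast
  qed
  have "U = \<Union>{X\<in>CC. X \<subseteq> U}"
  proof (intro subset_antisym subsetI)
    fix \<xi> assume \<xi>: "\<xi> \<in> U"
    have \<xi>E: "snd (\<xi> n) \<in> mrds_edges \<tau>" for n
      using openin_subset[OF U] \<xi> by (auto simp: topspace_path_topology space_path_borel)
    let ?X = "prod_topology (euclidean :: rat_plus topology) (discrete_topology (mrds_edges \<tau>))"
    obtain V where V: "finite {n. V n \<noteq> topspace ?X}" "\<And>n. openin ?X (V n)" "\<And>n. \<xi> n \<in> V n" "Pi\<^sub>E UNIV V \<subseteq> U"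
      using U \<xi> unfolding path_topology_def openin_product_topology_alt by (auto simp: PiE_iff)
    have "\<exists>b\<in>B'. fst (\<xi> n) \<in> b \<and> b \<times> {snd (\<xi> n)} \<subseteq> V n" for n
    proof -
      obtain G H where G: "open G" "fst (\<xi> n) \<in> G" "snd (\<xi> n) \<in> H" "G \<times> H \<subseteq> V n"
        using V(2)[of n] V(3)[of n] unfolding openin_prod_topology_alt open_openin[symmetric]
        by (metis prod.collapse)
      obtain b where "b \<in> B" "fst (\<xi> n) \<in> b" "b \<subseteq> G" using topological_basisE[OF B(2) G(1,2)] by metis
      with G show ?thesis by (intro bexI[of _ b]) (auto simp: B'_def)
    qed
    then obtain b where b: "\<And>n. b n \<in> B'" "\<And>n. fst (\<xi> n) \<in> b n" "\<And>n. b n \<times> {snd (\<xi> n)} \<subseteq> V n" by metis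
    obtain m where m: "\<forall>n\<in>{n. V n \<noteq> topspace ?X}. n < m"
      using V(1) finite_nat_set_iff_bounded by blast
    \<comment> \<open>\<open>Suc m\<close> keeps the word nonempty even if no coordinate is
      restricted.\<close>
    define As where "As = map b [0..<Suc m]"
    define es where "es = map (\<lambda>n. snd (\<xi> n)) [0..<Suc m]"
    have nth: "As ! n = b n" "es ! n = snd (\<xi> n)" if "n < Suc m" for n
      using that by (auto simp: As_def es_def simp del: upt_Suc)
    have len: "length As = Suc m" "length es = Suc m" by (auto simp: As_def es_def)
    have "cylinder \<tau> As es \<in> CC"
    proof -
      have "As \<in> lists B'" "es \<in> lists (mrds_edges \<tau>)" using b(1) \<xi>E by (auto simp: As_def es_def)
      then show ?thesis unfolding CC_def using len
        by (intro image_eqI[of _ _ "(As, es)"]) (auto simp: length_greater_0_conv[symmetric] simp del: length_greater_0_conv)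
    qed
    moreover have "cylinder \<tau> As es \<subseteq> U"
    proof
      fix \<zeta> assume \<zeta>: "\<zeta> \<in> cylinder \<tau> As es"
      have "\<zeta> n \<in> V n" for n
      proof (cases "n < Suc m")
        case True
        with \<zeta> len have "fst (\<zeta> n) \<in> b n" "snd (\<zeta> n) = snd (\<xi> n)" by (auto simp: cylinder_def nth)
        then have "\<zeta> n \<in> b n \<times> {snd (\<xi> n)}" by (simp add: mem_Times_iff)
        then show ?thesis by (rule subsetD[OF b(3)])
      next
        case False
        then have "V n = topspace ?X" using m by (metis (mono_tags, lifting) mem_Collect_eq less_SucI)
        moreover have "snd (\<zeta> n) \<in> mrds_edges \<tau>" using \<zeta> by (auto simp: cylinder_def space_path_borel)
        ultimately show ?thesis by (simp add: mem_Times_iff)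
      qed
      then have "\<zeta> \<in> Pi\<^sub>E UNIV V" by (auto simp: PiE_iff)
      with V(4) show "\<zeta> \<in> U" by blast
    qed
    moreover have "\<xi> \<in> cylinder \<tau> As es"
      using len b(2) \<xi>E by (auto simp: cylinder_def nth space_path_borel)
    ultimately show "\<xi> \<in> \<Union>{X\<in>CC. X \<subseteq> U}" by blast
  qed auto
  moreover have "\<Union>{X\<in>CC. X \<subseteq> U} \<in> sigma_sets (space (path_borel \<tau>)) (cylinders \<tau>)"
    using CCs by (intro sigma_sets_UNION countable_subset[OF _ CCc] sigma_sets.Basic) auto
  ultimately show ?thesis by simp
qed

lemma cylinders_subset: "cylinders \<tau> \<subseteq> Pow (space (path_borel \<tau>))"
  by (auto simp: cylinders_def cylinder_def)

lemma cylinders_sets: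
  fixes \<tau> :: "'v::finite \<Rightarrow> 'v \<Rightarrow> rat_plus measure"
  shows "cylinders \<tau> \<subseteq> sets (path_borel \<tau>)"
proof
  fix X assume X: "X \<in> cylinders \<tau>"
  have "(\<lambda>\<xi>. \<xi>) -` X \<inter> space (path_borel \<tau>) \<in> sets (path_borel \<tau>)"
    by (rule vimage_cylinder_measurable[OF measurable_path_fst measurable_path_snd X])
  also have "(\<lambda>\<xi>. \<xi>) -` X \<inter> space (path_borel \<tau>) = X"
    using X cylinders_subset by blast
  finally show "X \<in> sets (path_borel \<tau>)" .
qed

lemma sets_path_borel_cylinders:
  fixes \<tau> :: "'v::finite \<Rightarrow> 'v \<Rightarrow> rat_plus measure"
  shows "sets (path_borel \<tau>) = sigma_sets (space (path_borel \<tau>)) (cylinders \<tau>)"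
proof
  show "sets (path_borel \<tau>) \<subseteq> sigma_sets (space (path_borel \<tau>)) (cylinders \<tau>)"
    unfolding sets_path_borel
    by (rule sigma_sets_mono) (use open_in_sigma_cylinders in \<open>auto simp: sets_path_borel[symmetric]\<close>)
  show "sigma_sets (space (path_borel \<tau>)) (cylinders \<tau>) \<subseteq> sets (path_borel \<tau>)"
    using cylinders_sets by (rule sets.sigma_sets_subset)
qed

lemma measurable_pathI:
  fixes \<tau> :: "'v::finite \<Rightarrow> 'v \<Rightarrow> rat_plus measure"
  assumes "\<And>n. (\<lambda>\<omega>. fst (f \<omega> n)) \<in> borel_measurable M"
    and "\<And>n. (\<lambda>\<omega>. snd (f \<omega> n)) \<in> M \<rightarrow>\<^sub>M count_space (mrds_edges \<tau>)"
  shows "f \<in> M \<rightarrow>\<^sub>M path_borel \<tau>"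
proof (rule measurable_sigma_sets[OF sets_path_borel_cylinders cylinders_subset])
  show "f \<in> space M \<rightarrow> space (path_borel \<tau>)"
    using measurable_space[OF assms(2)] by (auto simp: space_path_borel)
  show "f -` X \<inter> space M \<in> sets M" if "X \<in> cylinders \<tau>" for X
    by (rule vimage_cylinder_measurable[OF assms that])
qed

lemma Int_stable_cylinders: "Int_stable (cylinders \<tau>)"
proof (rule Int_stableI)
  fix X Y assume "X \<in> cylinders \<tau>" "Y \<in> cylinders \<tau>"
  then obtain As es Bs fs where X: "X = cylinder \<tau> As es" "es \<noteq> []" "length As = length es"
    "set As \<subseteq> sets borel" "set es \<subseteq> mrds_edges \<tau>" and Y: "Y = cylinder \<tau> Bs fs" "fs \<noteq> []"
    "length Bs = length fs" "set Bs \<subseteq> sets borel" "set fs \<subseteq> mrds_edges \<tau>"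
    unfolding cylinders_def by blast
  define m where "m = max (length es) (length fs)"
  define gs where "gs = map (\<lambda>n. if n < length es then es ! n else fs ! n) [0..<m]"
  \<comment> \<open>The shorter word is padded with \<open>UNIV\<close>. Where the two words
    disagree on an edge, the empty set of maps makes the whole cylinder empty while
    \<open>gs\<close> remains a list of edges.\<close>
  define Cs where "Cs = map (\<lambda>n. (if n < length es then As ! n else UNIV) \<inter> (if n < length fs then Bs ! n else UNIV) \<inter>
     (if n < length es \<and> n < length fs \<and> es ! n \<noteq> fs ! n then {} else UNIV)) [0..<m]"
  have m: "m > 0" using X(2) by (simp add: m_def less_max_iff_disj)
  have "X \<inter> Y = cylinder \<tau> Cs gs"
  proof (intro set_eqI iffI)
    fix \<xi> assume "\<xi> \<in> X \<inter> Y"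
    then show "\<xi> \<in> cylinder \<tau> Cs gs"
      unfolding X(1) Y(1) cylinder_def gs_def Cs_def
      by (auto simp: m_def less_max_iff_disj)
  next
    fix \<xi> assume "\<xi> \<in> cylinder \<tau> Cs gs"
    then have \<xi>: "\<xi> \<in> space (path_borel \<tau>)" "\<And>n. n < m \<Longrightarrow> fst (\<xi> n) \<in> Cs ! n" "\<And>n. n < m \<Longrightarrow> snd (\<xi> n) = gs ! n"
      by (auto simp: cylinder_def gs_def)
    have "fst (\<xi> n) \<in> As ! n \<and> snd (\<xi> n) = es ! n" if "n < length es" for n
      using \<xi>(2,3)[of n] that by (auto simp: gs_def Cs_def m_def less_max_iff_disj split: if_splits)
    moreover have "fst (\<xi> n) \<in> Bs ! n \<and> snd (\<xi> n) = fs ! n" if "n < length fs" for n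
      using \<xi>(2,3)[of n] that by (auto simp: gs_def Cs_def m_def less_max_iff_disj split: if_splits)
    ultimately show "\<xi> \<in> X \<inter> Y" using \<xi>(1) by (simp add: X(1) Y(1) cylinder_def)
  qed
  moreover have "gs \<noteq> []" "length Cs = length gs" using m by (auto simp: gs_def Cs_def)
  moreover have "set Cs \<subseteq> sets borel"
    using X(3,4) Y(3,4) by (auto simp: Cs_def subset_iff intro!: sets.Int)
  moreover have "set gs \<subseteq> mrds_edges \<tau>"
  proof
    fix e assume "e \<in> set gs"
    then obtain n where n: "n < m" "e = (if n < length es then es ! n else fs ! n)" by (auto simp: gs_def)
    show "e \<in> mrds_edges \<tau>"
    proof (cases "n < length es")
      case True
      then show ?thesis using n X(5) nth_mem[of n es] by auto
    next
      case False
      then have "n < length fs" using n by (simp add: m_def)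
      then show ?thesis using False n Y(5) nth_mem[of n fs] by auto
    qed
  qed
  ultimately show "X \<inter> Y \<in> cylinders \<tau>" unfolding cylinders_def by blast
qed

section \<open>Construction of the path measures\<close>

locale markov_system =
  fixes \<tau> :: "'v::finite \<Rightarrow> 'v \<Rightarrow> rat_plus measure"
  assumes in_MRDS: "\<tau> \<in> MRDS UNIV"
begin

lemma sets_tau [measurable_cong]: "sets (\<tau> i j) = sets borel"
  using in_MRDS by (auto simp: MRDS_def markov_rds_def regular_borel_measure_def)

lemma space_tau: "space (\<tau> i j) = UNIV"
  using sets_eq_imp_space_eq[OF sets_tau] by simp

lemma sum_tau: "(\<Sum>j\<in>UNIV. emeasure (\<tau> i j) UNIV) = 1"
  using in_MRDS by (auto simp: MRDS_def markov_rds_def)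

lemma emeasure_tau_le_1: "emeasure (\<tau> i j) A \<le> 1"
proof -
  have "emeasure (\<tau> i j) A \<le> emeasure (\<tau> i j) UNIV"
    using emeasure_space[of "\<tau> i j" A] by (simp add: space_tau)
  also have "\<dots> \<le> (\<Sum>j\<in>UNIV. emeasure (\<tau> i j) UNIV)" by (rule member_le_sum) auto
  finally show ?thesis by (simp add: sum_tau)
qed

lemma finite_measure_tau: "finite_measure (\<tau> i j)"
  using emeasure_tau_le_1[of i j "space (\<tau> i j)"] by (intro finite_measureI) (auto simp: top_unique)

lemma tau_not_edge: "(i, j) \<notin> mrds_edges \<tau> \<Longrightarrow> emeasure (\<tau> i j) A = 0"
  using emeasure_space[of "\<tau> i j" A] by (simp add: mrds_edges_def space_tau)

text \<open>The complement of the support is covered by the null members of a countable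
  base.\<close>

lemma tau_support: "AE f in \<tau> i j. f \<in> topological_support (\<tau> i j)"
proof -
  obtain B :: "rat_plus set set" where B: "countable B" "topological_basis B"
    using ex_countable_basis by blast
  have "- topological_support (\<tau> i j) \<subseteq> \<Union>{b\<in>B. emeasure (\<tau> i j) b = 0}"
  proof
    fix f assume "f \<in> - topological_support (\<tau> i j)"
    then obtain U where U: "open U" "f \<in> U" "emeasure (\<tau> i j) U = 0"
      by (auto simp: topological_support_def)
    obtain b where b: "b \<in> B" "f \<in> b" "b \<subseteq> U" using topological_basisE[OF B(2) U(1,2)] by metis
    have "emeasure (\<tau> i j) b \<le> emeasure (\<tau> i j) U"
      using b(3) U(1) by (intro emeasure_mono) (auto simp: sets_tau)
    with U(3) b show "f \<in> \<Union>{b\<in>B. emeasure (\<tau> i j) b = 0}" by auto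
  qed
  moreover have "\<Union>{b\<in>B. emeasure (\<tau> i j) b = 0} \<in> null_sets (\<tau> i j)"
  proof -
    have "countable {b\<in>B. emeasure (\<tau> i j) b = 0}" using B(1) by (rule countable_subset[rotated]) auto
    moreover have "b \<in> null_sets (\<tau> i j)" if "b \<in> {b\<in>B. emeasure (\<tau> i j) b = 0}" for b
      using that topological_basis_open[OF B(2)] by (auto simp: null_sets_def sets_tau)
    ultimately have "(\<Union>b\<in>{b\<in>B. emeasure (\<tau> i j) b = 0}. b) \<in> null_sets (\<tau> i j)"
      by (rule null_sets_UN')
    then show ?thesis by simp
  qed
  ultimately show ?thesis by (intro AE_I'[of "\<Union>{b\<in>B. emeasure (\<tau> i j) b = 0}"]) auto
qed

section \<open>The law of one step and the driving sequence of choices\<close>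

definition succs :: "'v \<Rightarrow> 'v set" where
  "succs i = {j. (i, j) \<in> mrds_edges \<tau>}"

definition step_space :: "'v \<Rightarrow> (rat_plus \<times> 'v) measure" where
  "step_space i = borel \<Otimes>\<^sub>M count_space (succs i)"

definition step_measure :: "'v \<Rightarrow> (rat_plus \<times> 'v) measure" where
  "step_measure i = measure_of (space (step_space i)) (sets (step_space i))
     (\<lambda>A. \<Sum>j\<in>succs i. emeasure (\<tau> i j) ((\<lambda>f. (f, j)) -` A))"

lemma sets_step [measurable_cong]: "sets (step_measure i) = sets (step_space i)"
  by (simp add: step_measure_def)

lemma space_step: "space (step_measure i) = UNIV \<times> succs i"
  using sets_eq_imp_space_eq[OF sets_step, of i] by (simp add: step_space_def space_pair_measure)

lemma measurable_step_section: "j \<in> succs i \<Longrightarrow> (\<lambda>f. (f, j)) \<in> \<tau> i j \<rightarrow>\<^sub>M step_space i"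
  unfolding step_space_def by (intro measurable_Pair) (auto simp: measurable_cong_sets[OF sets_tau refl])

lemma emeasure_step:
  assumes A: "A \<in> sets (step_space i)"
  shows "emeasure (step_measure i) A = (\<Sum>j\<in>succs i. emeasure (\<tau> i j) ((\<lambda>f. (f, j)) -` A))"
  unfolding step_measure_def
proof (rule emeasure_measure_of_sigma)
  show "sigma_algebra (space (step_space i)) (sets (step_space i))" ..
  show "positive (sets (step_space i)) (\<lambda>A. \<Sum>j\<in>succs i. emeasure (\<tau> i j) ((\<lambda>f. (f, j)) -` A))"
    by (simp add: positive_def)
  show "countably_additive (sets (step_space i)) (\<lambda>A. \<Sum>j\<in>succs i. emeasure (\<tau> i j) ((\<lambda>f. (f, j)) -` A))"
  proof (rule countably_additiveI)
    fix F :: "nat \<Rightarrow> (rat_plus \<times> 'v) set"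
    assume F: "range F \<subseteq> sets (step_space i)" "disjoint_family F" "(\<Union>n. F n) \<in> sets (step_space i)"
    have "(\<Sum>n. \<Sum>j\<in>succs i. emeasure (\<tau> i j) ((\<lambda>f. (f, j)) -` F n)) =
      (\<Sum>j\<in>succs i. \<Sum>n. emeasure (\<tau> i j) ((\<lambda>f. (f, j)) -` F n))"
      by (intro suminf_sum summableI)
    also have "\<dots> = (\<Sum>j\<in>succs i. emeasure (\<tau> i j) ((\<lambda>f. (f, j)) -` (\<Union>n. F n)))"
    proof (intro sum.cong refl)
      fix j assume j: "j \<in> succs i"
      have "(\<Sum>n. emeasure (\<tau> i j) ((\<lambda>f. (f, j)) -` F n)) = emeasure (\<tau> i j) (\<Union>n. (\<lambda>f. (f, j)) -` F n)"
      proof (rule suminf_emeasure)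
        show "range (\<lambda>n. (\<lambda>f. (f, j)) -` F n) \<subseteq> sets (\<tau> i j)"
          using measurable_sets[OF measurable_step_section[OF j]] F(1) by (auto simp: space_tau)
        show "disjoint_family (\<lambda>n. (\<lambda>f. (f, j)) -` F n)"
          using F(2) by (auto simp: disjoint_family_on_def)
      qed
      then show "(\<Sum>n. emeasure (\<tau> i j) ((\<lambda>f. (f, j)) -` F n)) = emeasure (\<tau> i j) ((\<lambda>f. (f, j)) -` (\<Union>n. F n))"
        by (simp add: vimage_UN)
    qed
    finally show "(\<Sum>n. \<Sum>j\<in>succs i. emeasure (\<tau> i j) ((\<lambda>f. (f, j)) -` F n)) =
      (\<Sum>j\<in>succs i. emeasure (\<tau> i j) ((\<lambda>f. (f, j)) -` (\<Union>n. F n)))" .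
  qed
qed (rule A)

lemma emeasure_step_rect:
  assumes "A \<in> sets borel" "j \<in> succs i"
  shows "A \<times> {j} \<in> sets (step_measure i)" "emeasure (step_measure i) (A \<times> {j}) = emeasure (\<tau> i j) A"
proof -
  show A: "A \<times> {j} \<in> sets (step_measure i)"
    unfolding sets_step step_space_def using assms by (intro pair_measureI) auto
  have "emeasure (step_measure i) (A \<times> {j}) = (\<Sum>k\<in>succs i. if k = j then emeasure (\<tau> i k) A else 0)"
    unfolding emeasure_step[OF A[unfolded sets_step]]
  proof (intro sum.cong refl)
    fix k
    have "(\<lambda>f. (f, k)) -` (A \<times> {j}) = (if k = j then A else {})" by auto
    then show "emeasure (\<tau> i k) ((\<lambda>f. (f, k)) -` (A \<times> {j})) = (if k = j then emeasure (\<tau> i k) A else 0)" by simp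
  qed
  also have "\<dots> = emeasure (\<tau> i j) A" using assms(2) by simp
  finally show "emeasure (step_measure i) (A \<times> {j}) = emeasure (\<tau> i j) A" .
qed

lemma prob_space_step: "prob_space (step_measure i)"
proof
  have "emeasure (step_measure i) (space (step_measure i)) =
      (\<Sum>j\<in>succs i. emeasure (\<tau> i j) ((\<lambda>f. (f, j)) -` space (step_measure i)))"
    by (rule emeasure_step) (metis sets.top sets_step)
  also have "\<dots> = (\<Sum>j\<in>succs i. emeasure (\<tau> i j) UNIV)"
    by (intro sum.cong refl arg_cong2[where f=emeasure]) (auto simp: space_step)
  also have "\<dots> = (\<Sum>j\<in>UNIV. emeasure (\<tau> i j) UNIV)"
    by (intro sum.mono_neutral_left) (auto simp: succs_def tau_not_edge)
  finally show "emeasure (step_measure i) (space (step_measure i)) = 1" by (simp add: sum_tau)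
qed

lemma AE_step:
  assumes "\<And>j. j \<in> succs i \<Longrightarrow> AE f in \<tau> i j. P (f, j)" and P: "Measurable.pred (step_measure i) P"
  shows "AE y in step_measure i. P y"
proof -
  have m: "{y \<in> space (step_measure i). \<not> P y} \<in> sets (step_measure i)" using P by measurable
  have "emeasure (step_measure i) {y \<in> space (step_measure i). \<not> P y} =
     (\<Sum>j\<in>succs i. emeasure (\<tau> i j) ((\<lambda>f. (f, j)) -` {y \<in> space (step_measure i). \<not> P y}))"
    using m unfolding sets_step by (rule emeasure_step)
  also have "\<dots> = 0"
  proof (intro sum.neutral ballI)
    fix j assume j: "j \<in> succs i"
    have "(\<lambda>f. (f, j)) -` {y \<in> space (step_measure i). \<not> P y} \<in> sets (\<tau> i j)"
      using measurable_sets[OF measurable_step_section[OF j] m[unfolded sets_step]] by (simp add: space_tau)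
    moreover have "(\<lambda>f. (f, j)) -` {y \<in> space (step_measure i). \<not> P y} = {f \<in> space (\<tau> i j). \<not> P (f, j)}"
      using j by (auto simp: space_tau space_step)
    ultimately show "emeasure (\<tau> i j) ((\<lambda>f. (f, j)) -` {y \<in> space (step_measure i). \<not> P y}) = 0"
      using assms(1)[OF j] by (simp add: AE_iff_measurable)
  qed
  finally show ?thesis using m by (simp add: AE_iff_measurable)
qed

text \<open>
  The chain is driven by independent random choice functions: \<open>\<omega> n v\<close> is the map and the next vertex
  that a path takes at time \<open>n\<close> if it is then at \<open>v\<close>.
\<close>

definition choice_measure :: "('v \<Rightarrow> rat_plus \<times> 'v) measure" where
  "choice_measure = PiM UNIV step_measure"

definition seq_measure :: "(nat \<Rightarrow> 'v \<Rightarrow> rat_plus \<times> 'v) measure" where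
  "seq_measure = PiM UNIV (\<lambda>_. choice_measure)"

lemma prob_space_choice: "prob_space choice_measure"
  unfolding choice_measure_def by (intro prob_space_PiM prob_space_step)

lemma prob_space_seq: "prob_space seq_measure"
  unfolding seq_measure_def by (intro prob_space_PiM prob_space_choice)

lemma measurable_choice_component: "(\<lambda>x. x i) \<in> choice_measure \<rightarrow>\<^sub>M step_measure i"
  unfolding choice_measure_def by (rule measurable_component_singleton) simp

lemma measurable_seq_component: "(\<lambda>\<omega>. \<omega> n) \<in> seq_measure \<rightarrow>\<^sub>M choice_measure"
  unfolding seq_measure_def by (rule measurable_component_singleton) simp

lemma measurable_seq_component2: "(\<lambda>\<omega>. \<omega> n i) \<in> seq_measure \<rightarrow>\<^sub>M step_measure i"
  using measurable_compose[OF measurable_seq_component measurable_choice_component] .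

primrec vertex_at :: "'v \<Rightarrow> (nat \<Rightarrow> 'v \<Rightarrow> rat_plus \<times> 'v) \<Rightarrow> nat \<Rightarrow> 'v" where
  "vertex_at i \<omega> 0 = i"
| "vertex_at i \<omega> (Suc n) = snd (\<omega> n (vertex_at i \<omega> n))"

definition path_of :: "'v \<Rightarrow> (nat \<Rightarrow> 'v \<Rightarrow> rat_plus \<times> 'v) \<Rightarrow> 'v path" where
  "path_of i \<omega> n = (fst (\<omega> n (vertex_at i \<omega> n)), vertex_at i \<omega> n, vertex_at i \<omega> (Suc n))"

lemma vertex_at_case_nat: "vertex_at i (case_nat x \<omega>) (Suc n) = vertex_at (snd (x i)) \<omega> n"
  by (induction n) auto

text \<open>The Markov property on the level of samples: after the first step the path is driven by
  the remaining choices, from the new vertex.\<close>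

lemma path_of_case_nat:
  "path_of i (case_nat x \<omega>) = case_nat (fst (x i), i, snd (x i)) (path_of (snd (x i)) \<omega>)"
proof
  fix n show "path_of i (case_nat x \<omega>) n = case_nat (fst (x i), i, snd (x i)) (path_of (snd (x i)) \<omega>) n"
  proof (cases n)
    case (Suc m)
    show ?thesis unfolding Suc path_of_def vertex_at_case_nat by simp
  qed (simp add: path_of_def)
qed

lemma measurable_step_fst: "fst \<in> borel_measurable (step_measure i)"
  unfolding measurable_cong_sets[OF sets_step refl] step_space_def by simp

lemma measurable_step_snd: "snd \<in> step_measure i \<rightarrow>\<^sub>M count_space (succs i)"
  unfolding measurable_cong_sets[OF sets_step refl] step_space_def by simp

lemma measurable_step_snd': "snd \<in> step_measure i \<rightarrow>\<^sub>M count_space UNIV"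
  by (rule measurable_compose[OF measurable_step_snd]) simp

lemma measurable_step_edge: "(\<lambda>y. (i, snd y)) \<in> step_measure i \<rightarrow>\<^sub>M count_space (mrds_edges \<tau>)"
  by (rule measurable_compose[OF measurable_step_snd]) (simp add: succs_def)

lemma measurable_vertex_at: "(\<lambda>\<omega>. vertex_at i \<omega> n) \<in> seq_measure \<rightarrow>\<^sub>M count_space UNIV"
proof (induction n)
  case (Suc n)
  have "(\<lambda>\<omega>. (\<lambda>v \<omega>. snd (\<omega> n v)) (vertex_at i \<omega> n) \<omega>) \<in> seq_measure \<rightarrow>\<^sub>M count_space UNIV"
    by (rule measurable_compose_countable[OF _ Suc])
       (rule measurable_compose[OF measurable_seq_component2 measurable_step_snd'])
  then show ?case by simp
qed simp

lemma measurable_path_of: "path_of i \<in> seq_measure \<rightarrow>\<^sub>M path_borel \<tau>"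
proof (rule measurable_pathI)
  fix n
  have "(\<lambda>\<omega>. (\<lambda>v \<omega>. fst (\<omega> n v)) (vertex_at i \<omega> n) \<omega>) \<in> borel_measurable seq_measure"
    by (rule measurable_compose_countable[OF _ measurable_vertex_at])
       (rule measurable_compose[OF measurable_seq_component2 measurable_step_fst])
  then show "(\<lambda>\<omega>. fst (path_of i \<omega> n)) \<in> borel_measurable seq_measure"
    by (simp add: path_of_def)
  have "(\<lambda>\<omega>. (\<lambda>v \<omega>. (v, snd (\<omega> n v))) (vertex_at i \<omega> n) \<omega>) \<in> seq_measure \<rightarrow>\<^sub>M count_space (mrds_edges \<tau>)"
    by (rule measurable_compose_countable[OF _ measurable_vertex_at])
       (rule measurable_compose[OF measurable_seq_component2 measurable_step_edge])
  then show "(\<lambda>\<omega>. snd (path_of i \<omega> n)) \<in> seq_measure \<rightarrow>\<^sub>M count_space (mrds_edges \<tau>)"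
    by (simp add: path_of_def)
qed

section \<open>The path measures as image measures\<close>

definition pmeas :: "'v \<Rightarrow> 'v path measure" where
  "pmeas i = distr seq_measure (path_borel \<tau>) (path_of i)"

lemma sets_pmeas [measurable_cong]: "sets (pmeas i) = sets (path_borel \<tau>)"
  by (simp add: pmeas_def)

lemma space_pmeas: "space (pmeas i) = space (path_borel \<tau>)"
  by (simp add: pmeas_def)

lemma prob_space_pmeas: "prob_space (pmeas i)"
  unfolding pmeas_def by (rule prob_space.prob_space_distr[OF prob_space_seq measurable_path_of])

lemma measurable_cons_path:
  "(\<lambda>(y, \<omega>). case_nat (fst y, i, snd y) (path_of (snd y) \<omega>)) \<in> step_measure i \<Otimes>\<^sub>M seq_measure \<rightarrow>\<^sub>M path_borel \<tau>"
proof (rule measurable_pathI)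
  fix n
  have snd': "(\<lambda>p. snd (fst p)) \<in> step_measure i \<Otimes>\<^sub>M seq_measure \<rightarrow>\<^sub>M count_space UNIV"
    by (rule measurable_compose[OF measurable_fst measurable_step_snd'])
  show "(\<lambda>p. fst ((case p of (y, \<omega>) \<Rightarrow> case_nat (fst y, i, snd y) (path_of (snd y) \<omega>)) n)) \<in> borel_measurable (step_measure i \<Otimes>\<^sub>M seq_measure)"
  proof (cases n)
    case 0
    show ?thesis unfolding 0 split_beta using measurable_compose[OF measurable_fst measurable_step_fst] by simp
  next
    case (Suc m)
    have "(\<lambda>p. (\<lambda>v p. fst (path_of v (snd p) m)) (snd (fst p)) p) \<in> borel_measurable (step_measure i \<Otimes>\<^sub>M seq_measure)"
      by (rule measurable_compose_countable[OF _ snd'])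
         (rule measurable_compose[OF measurable_compose[OF measurable_snd measurable_path_of] measurable_path_fst])
    then show ?thesis by (simp add: Suc split_beta)
  qed
  show "(\<lambda>p. snd ((case p of (y, \<omega>) \<Rightarrow> case_nat (fst y, i, snd y) (path_of (snd y) \<omega>)) n)) \<in> step_measure i \<Otimes>\<^sub>M seq_measure \<rightarrow>\<^sub>M count_space (mrds_edges \<tau>)"
  proof (cases n)
    case 0
    show ?thesis unfolding 0 split_beta using measurable_compose[OF measurable_fst measurable_step_edge] by simp
  next
    case (Suc m)
    have "(\<lambda>p. (\<lambda>v p. snd (path_of v (snd p) m)) (snd (fst p)) p) \<in> step_measure i \<Otimes>\<^sub>M seq_measure \<rightarrow>\<^sub>M count_space (mrds_edges \<tau>)"
      by (rule measurable_compose_countable[OF _ snd'])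
         (rule measurable_compose[OF measurable_compose[OF measurable_snd measurable_path_of] measurable_path_snd])
    then show ?thesis by (simp add: Suc split_beta)
  qed
qed

definition cons_section :: "'v path set \<Rightarrow> 'v \<Rightarrow> rat_plus \<times> 'v \<Rightarrow> 'v path set" where
  "cons_section X i y = {\<xi> \<in> space (path_borel \<tau>). case_nat (fst y, i, snd y) \<xi> \<in> X}"

lemma cons_section_sets:
  assumes X: "X \<in> sets (path_borel \<tau>)" and y: "y \<in> space (step_measure i)"
  shows "cons_section X i y \<in> sets (path_borel \<tau>)"
proof -
  have "case_nat (fst y, i, snd y) \<in> path_borel \<tau> \<rightarrow>\<^sub>M path_borel \<tau>"
  proof (rule measurable_pathI)
    fix n
    show "(\<lambda>\<xi>. fst (case_nat (fst y, i, snd y) \<xi> n)) \<in> borel_measurable (path_borel \<tau>)"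
      by (cases n) (auto intro: measurable_path_fst)
    show "(\<lambda>\<xi>. snd (case_nat (fst y, i, snd y) \<xi> n)) \<in> path_borel \<tau> \<rightarrow>\<^sub>M count_space (mrds_edges \<tau>)"
      using y by (cases n) (auto intro: measurable_path_snd simp: space_step succs_def)
  qed
  from measurable_sets[OF this X] show ?thesis
    by (simp add: cons_section_def vimage_def Int_def conj_commute)
qed

text \<open>First-step analysis. The independent sequence of choices splits into head and tail by
  \<open>PiM_iter\<close>; the tail has the law of the whole sequence and drives the path from the
  vertex that the head selects.\<close>

lemma emeasure_pmeas_cons:
  assumes X: "X \<in> sets (path_borel \<tau>)"
  shows "emeasure (pmeas i) X = (\<integral>\<^sup>+y. emeasure (pmeas (snd y)) (cons_section X i y) \<partial>step_measure i)"
proof -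
  interpret C: prob_space choice_measure by (rule prob_space_choice)
  interpret S: prob_space seq_measure by (rule prob_space_seq)
  interpret SS: sequence_space choice_measure ..
  interpret P: pair_sigma_finite choice_measure seq_measure ..
  define g where "g = (\<lambda>y. \<integral>\<^sup>+\<omega>. indicator X (case_nat (fst y, i, snd y) (path_of (snd y) \<omega>)) \<partial>seq_measure)"
  have mg: "g \<in> borel_measurable (step_measure i)"
    unfolding g_def
    using measurable_compose[OF measurable_cons_path borel_measurable_indicator[OF X], of i]
    by (intro S.borel_measurable_nn_integral) (simp add: split_beta')
  have mi: "(\<lambda>\<omega>. indicator X (path_of i \<omega>) :: ennreal) \<in> borel_measurable seq_measure"
    by (rule measurable_compose[OF measurable_path_of borel_measurable_indicator[OF X]])
  have mc: "(\<lambda>(s, \<omega>). case_nat s \<omega>) \<in> choice_measure \<Otimes>\<^sub>M seq_measure \<rightarrow>\<^sub>M seq_measure"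
    unfolding seq_measure_def by measurable
  have "emeasure (pmeas i) X = (\<integral>\<^sup>+\<xi>. indicator X \<xi> \<partial>pmeas i)"
    using X by (simp add: sets_pmeas)
  also have "\<dots> = (\<integral>\<^sup>+\<omega>. indicator X (path_of i \<omega>) \<partial>seq_measure)"
    unfolding pmeas_def using X by (intro nn_integral_distr measurable_path_of) auto
  also have "\<dots> = (\<integral>\<^sup>+\<omega>. indicator X (path_of i \<omega>) \<partial>distr (choice_measure \<Otimes>\<^sub>M seq_measure) seq_measure (\<lambda>(s, \<omega>). case_nat s \<omega>))"
    unfolding seq_measure_def SS.PiM_iter ..
  also have "\<dots> = (\<integral>\<^sup>+p. indicator X (path_of i (case_nat (fst p) (snd p))) \<partial>(choice_measure \<Otimes>\<^sub>M seq_measure))"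
    using nn_integral_distr[OF mc, of "\<lambda>\<omega>. indicator X (path_of i \<omega>)"] mi by (simp add: split_beta)
  also have "\<dots> = (\<integral>\<^sup>+x. \<integral>\<^sup>+\<omega>. indicator X (path_of i (case_nat x \<omega>)) \<partial>seq_measure \<partial>choice_measure)"
    using measurable_compose[OF mc mi] by (subst S.nn_integral_fst[symmetric]) (auto simp: split_beta)
  also have "\<dots> = (\<integral>\<^sup>+x. g (x i) \<partial>choice_measure)"
    by (simp add: g_def path_of_case_nat)
  \<comment> \<open>The integrand reads only component \<open>i\<close> of the first choice
    function, and the law of this component is \<open>step_measure i\<close>.\<close>
  also have "\<dots> = (\<integral>\<^sup>+y. g y \<partial>distr choice_measure (step_measure i) (\<lambda>x. x i))"
    using nn_integral_distr[OF measurable_choice_component, of g] mg by simp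
  also have "distr choice_measure (step_measure i) (\<lambda>x. x i) = step_measure i"
    unfolding choice_measure_def by (intro distr_PiM_component prob_space_step) simp
  also have "(\<integral>\<^sup>+y. g y \<partial>step_measure i) = (\<integral>\<^sup>+y. emeasure (pmeas (snd y)) (cons_section X i y) \<partial>step_measure i)"
  proof (intro nn_integral_cong)
    fix y assume y: "y \<in> space (step_measure i)"
    have "emeasure (pmeas (snd y)) (cons_section X i y) = (\<integral>\<^sup>+\<xi>. indicator (cons_section X i y) \<xi> \<partial>pmeas (snd y))"
      using cons_section_sets[OF X y] by (simp add: sets_pmeas)
    also have "\<dots> = (\<integral>\<^sup>+\<omega>. indicator (cons_section X i y) (path_of (snd y) \<omega>) \<partial>seq_measure)"
      unfolding pmeas_def using cons_section_sets[OF X y] by (intro nn_integral_distr measurable_path_of) auto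
    also have "\<dots> = g y"
      unfolding g_def using measurable_space[OF measurable_path_of]
      by (intro nn_integral_cong) (auto simp: cons_section_def indicator_def)
    finally show "g y = emeasure (pmeas (snd y)) (cons_section X i y)" by simp
  qed
  finally show ?thesis .
qed

lemma admissible_induced_Cons:
  "admissible (induced_gdms \<tau>) (e # es) \<longleftrightarrow> e \<in> mrds_edges \<tau> \<and> (es = [] \<or> snd e = fst (hd es) \<and> admissible (induced_gdms \<tau>) es)"
  by (simp add: admissible_Cons induced_gdms_def)

text \<open>The empty word, with value 1, is included to start the induction; each further edge is
  one first-step analysis.\<close>

lemma emeasure_pmeas_cylinder:
  assumes "length As = length es" "set As \<subseteq> sets borel" "set es \<subseteq> mrds_edges \<tau>"
  shows "emeasure (pmeas i) (cylinder \<tau> As es) =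
     (if es = [] \<or> admissible (induced_gdms \<tau>) es \<and> fst (hd es) = i
      then \<Prod>n<length es. emeasure (\<tau> (fst (es ! n)) (snd (es ! n))) (As ! n) else 0)"
  using assms
proof (induction es arbitrary: As i)
  case Nil
  have "cylinder \<tau> As [] = space (pmeas i)" by (simp add: cylinder_def space_pmeas)
  then show ?case using prob_space.emeasure_space_1[OF prob_space_pmeas] by simp
next
  case (Cons e es)
  then obtain A As' where As: "As = A # As'" by (cases As) auto
  have As': "length As' = length es" "set As' \<subseteq> sets borel" "set es \<subseteq> mrds_edges \<tau>" "A \<in> sets borel" "e \<in> mrds_edges \<tau>"
    using Cons.prems by (auto simp: As)
  have cyl: "cylinder \<tau> As (e # es) \<in> sets (path_borel \<tau>)"
  proof (rule subsetD[OF cylinders_sets])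
    show "cylinder \<tau> As (e # es) \<in> cylinders \<tau>"
      unfolding cylinders_def using Cons.prems by (intro CollectI exI[of _ As] exI[of _ "e # es"]) simp
  qed
  have sec: "cons_section (cylinder \<tau> As (e # es)) i y =
     (if fst y \<in> A \<and> (i, snd y) = e then cylinder \<tau> As' es else {})" if "y \<in> space (step_measure i)" for y
  proof -
    have "(i, snd y) \<in> mrds_edges \<tau>" using that by (auto simp: space_step succs_def)
    then show ?thesis
      by (auto simp: cons_section_def cylinder_def As All_less_Suc2 space_path_borel split: nat.splits)
  qed
  define c where "c = emeasure (pmeas (snd e)) (cylinder \<tau> As' es)"
  have IH: "c = (if es = [] \<or> admissible (induced_gdms \<tau>) es \<and> fst (hd es) = snd e
      then \<Prod>n<length es. emeasure (\<tau> (fst (es ! n)) (snd (es ! n))) (As' ! n) else 0)"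
    unfolding c_def by (rule Cons.IH[OF As'(1-3)])
  have "emeasure (pmeas i) (cylinder \<tau> As (e # es)) =
     (\<integral>\<^sup>+y. emeasure (pmeas (snd y)) (if fst y \<in> A \<and> (i, snd y) = e then cylinder \<tau> As' es else {}) \<partial>step_measure i)"
    unfolding emeasure_pmeas_cons[OF cyl] by (intro nn_integral_cong) (simp only: sec)
  also have "\<dots> = (if fst e = i then emeasure (\<tau> (fst e) (snd e)) A * c else 0)"
  proof (cases "fst e = i")
    case True
    have j: "snd e \<in> succs i" using As'(5) True by (auto simp: succs_def)
    have "(\<integral>\<^sup>+y. emeasure (pmeas (snd y)) (if fst y \<in> A \<and> (i, snd y) = e then cylinder \<tau> As' es else {}) \<partial>step_measure i)
      = (\<integral>\<^sup>+y. c * indicator (A \<times> {snd e}) y \<partial>step_measure i)"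
      using True by (intro nn_integral_cong, cases e) (auto simp: c_def indicator_def)
    also have "\<dots> = c * emeasure (\<tau> i (snd e)) A"
      using emeasure_step_rect[OF As'(4) j] by (simp add: nn_integral_cmult_indicator)
    finally show ?thesis using True by (simp add: mult.commute)
  next
    case False
    then have "(\<integral>\<^sup>+y. emeasure (pmeas (snd y)) (if fst y \<in> A \<and> (i, snd y) = e then cylinder \<tau> As' es else {}) \<partial>step_measure i)
      = (\<integral>\<^sup>+y. 0 \<partial>step_measure i)" by (intro nn_integral_cong) auto
    with False show ?thesis by simp
  qed
  finally show ?case
    unfolding IH using As'(5)
    by (auto simp: admissible_induced_Cons As prod.lessThan_Suc_shift simp del: prod.lessThan_Suc)
qed

text \<open>The construction provides existence. Uniqueness holds because cylinders are stable under
  intersection, generate the Borel sets, and finitely many of length 1 cover the space.\<close>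

lemma path_measure_from_eq: "path_measure_from \<tau> i = pmeas i"
  unfolding path_measure_from_def
proof (rule the_equality)
  show "prob_space (pmeas i) \<and> sets (pmeas i) = sets (path_borel \<tau>) \<and>
     (\<forall>As es. es \<noteq> [] \<and> length As = length es \<and> set As \<subseteq> sets borel \<and> set es \<subseteq> mrds_edges \<tau> \<longrightarrow>
        emeasure (pmeas i) (cylinder \<tau> As es) =
          (if admissible (induced_gdms \<tau>) es \<and> fst (hd es) = i
           then \<Prod>n<length es. emeasure (\<tau> (fst (es ! n)) (snd (es ! n))) (As ! n)
           else 0))"
    by (simp add: prob_space_pmeas sets_pmeas emeasure_pmeas_cylinder)
next
  fix M assume M: "prob_space M \<and> sets M = sets (path_borel \<tau>) \<and>
     (\<forall>As es. es \<noteq> [] \<and> length As = length es \<and> set As \<subseteq> sets borel \<and> set es \<subseteq> mrds_edges \<tau> \<longrightarrow>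
        emeasure M (cylinder \<tau> As es) =
          (if admissible (induced_gdms \<tau>) es \<and> fst (hd es) = i
           then \<Prod>n<length es. emeasure (\<tau> (fst (es ! n)) (snd (es ! n))) (As ! n)
           else 0))"
  then interpret M: prob_space M by simp
  show "M = pmeas i"
  proof (rule measure_eqI_generator_eq_countable)
    show "Int_stable (cylinders \<tau>)" by (rule Int_stable_cylinders)
    show "cylinders \<tau> \<subseteq> Pow (space (path_borel \<tau>))" by (rule cylinders_subset)
    show "emeasure M X = emeasure (pmeas i) X" if "X \<in> cylinders \<tau>" for X
      using that M by (auto simp: cylinders_def emeasure_pmeas_cylinder)
    show "sets M = sigma_sets (space (path_borel \<tau>)) (cylinders \<tau>)"
      "sets (pmeas i) = sigma_sets (space (path_borel \<tau>)) (cylinders \<tau>)"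
      using M sets_path_borel_cylinders by (auto simp: sets_pmeas)
    show "(\<lambda>e. cylinder \<tau> [UNIV] [e]) ` mrds_edges \<tau> \<subseteq> cylinders \<tau>"
    proof
      fix X assume "X \<in> (\<lambda>e. cylinder \<tau> [UNIV] [e]) ` mrds_edges \<tau>"
      then obtain e where "X = cylinder \<tau> [UNIV] [e]" "e \<in> mrds_edges \<tau>" by auto
      then show "X \<in> cylinders \<tau>" unfolding cylinders_def
        by (intro CollectI exI[of _ "[UNIV]"] exI[of _ "[e]"]) simp
    qed
    show "\<Union>((\<lambda>e. cylinder \<tau> [UNIV] [e]) ` mrds_edges \<tau>) = space (path_borel \<tau>)"
      by (auto simp: cylinder_def space_path_borel)
    show "countable ((\<lambda>e. cylinder \<tau> [UNIV] [e]) ` mrds_edges \<tau>)" by (intro countable_finite) simp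
  qed auto
qed

lemma AE_pmeas_regular: "AE \<xi> in pmeas i. regular_path (induced_gdms \<tau>) \<xi> \<and> fst (snd (\<xi> 0)) = i"
proof -
  have closed: "closed (topological_support (\<tau> v j))" for v j
  proof -
    have "- topological_support (\<tau> v j) = \<Union>{U. open U \<and> emeasure (\<tau> v j) U = 0}"
      unfolding topological_support_def by (auto simp: zero_less_iff_neq_zero)
    then have "open (- topological_support (\<tau> v j))" by auto
    then show ?thesis by (simp add: closed_def)
  qed
  have supp: "AE y in step_measure v. fst y \<in> topological_support (\<tau> v (snd y))" for v
  proof (rule AE_step)
    show "AE f in \<tau> v j. fst (f, j) \<in> topological_support (\<tau> v (snd (f, j)))" for j
      using tau_support by simp
    have "(\<lambda>y. (\<lambda>j y. fst y \<in> topological_support (\<tau> v j)) (snd y) y) \<in> step_measure v \<rightarrow>\<^sub>M count_space UNIV"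
    proof (rule measurable_compose_countable[OF _ measurable_step_snd'])
      fix j
      show "Measurable.pred (step_measure v) (\<lambda>y. fst y \<in> topological_support (\<tau> v j))"
        using measurable_sets[OF measurable_step_fst borel_closed[OF closed]]
          by (simp add: pred_def vimage_def Int_def conj_commute)
    qed
    then show "Measurable.pred (step_measure v) (\<lambda>y. fst y \<in> topological_support (\<tau> v (snd y)))" by simp
  qed
  \<comment> \<open>All choices are controlled, also those at vertices the path does not visit;
    there are countably many of them.\<close>
  have "AE \<omega> in seq_measure. \<forall>n. \<forall>v. fst (\<omega> n v) \<in> topological_support (\<tau> v (snd (\<omega> n v)))"
  proof (subst AE_all_countable, intro allI, subst AE_all_countable, intro allI)
    fix n v
    have "AE x in choice_measure. fst (x v) \<in> topological_support (\<tau> v (snd (x v)))"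
      unfolding choice_measure_def by (rule AE_PiM_component[OF prob_space_step _ supp]) simp
    then show "AE \<omega> in seq_measure. fst (\<omega> n v) \<in> topological_support (\<tau> v (snd (\<omega> n v)))"
      unfolding seq_measure_def by (rule AE_PiM_component[OF prob_space_choice UNIV_I])
  qed
  moreover have "AE \<omega> in seq_measure. \<forall>n. snd (path_of i \<omega> n) \<in> mrds_edges \<tau>"
    by (rule AE_I2) (use measurable_space[OF measurable_path_of] in \<open>auto simp: space_path_borel\<close>)
  ultimately have ae: "AE \<omega> in seq_measure. regular_path (induced_gdms \<tau>) (path_of i \<omega>) \<and> fst (snd (path_of i \<omega> 0)) = i"
    by eventually_elim (auto simp: regular_path_def path_of_def induced_gdms_def)
  have "{\<xi> \<in> space (path_borel \<tau>). regular_path (induced_gdms \<tau>) \<xi> \<and> fst (snd (\<xi> 0)) = i} \<in> sets (path_borel \<tau>)"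
  proof -
    have m1: "(\<lambda>\<xi>. snd (\<xi> n)) \<in> path_borel \<tau> \<rightarrow>\<^sub>M count_space UNIV" for n
      by (rule measurable_compose[OF measurable_path_snd]) simp
    have m2: "Measurable.pred (path_borel \<tau>) (\<lambda>\<xi>. fst (\<xi> n) \<in> gens (induced_gdms \<tau>) (snd (\<xi> n)))" for n
    proof -
      have "(\<lambda>\<xi>. (\<lambda>e \<xi>. fst (\<xi> n) \<in> topological_support (\<tau> (fst e) (snd e))) (snd (\<xi> n)) \<xi>) \<in> path_borel \<tau> \<rightarrow>\<^sub>M count_space UNIV"
      proof (rule measurable_compose_countable[OF _ m1])
        fix e :: "'v \<times> 'v"
        show "Measurable.pred (path_borel \<tau>) (\<lambda>\<xi>. fst (\<xi> n) \<in> topological_support (\<tau> (fst e) (snd e)))"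
          using measurable_sets[OF measurable_path_fst borel_closed[OF closed]]
          by (simp add: pred_def vimage_def Int_def conj_commute)
      qed
      then show ?thesis by (simp add: induced_gdms_def split_beta)
    qed
    have "Measurable.pred (path_borel \<tau>) (\<lambda>\<xi>. regular_path (induced_gdms \<tau>) \<xi> \<and> fst (snd (\<xi> 0)) = i)"
      unfolding regular_path_def
    proof (intro pred_intros_countable pred_intros_logic)
      fix n
      have m1': "Measurable.pred (path_borel \<tau>) (\<lambda>\<xi>. P (snd (\<xi> n)))" for n P
        by (rule measurable_compose[OF m1]) simp
      show "Measurable.pred (path_borel \<tau>) (\<lambda>\<xi>. snd (\<xi> n) \<in> edges (induced_gdms \<tau>))"
        "Measurable.pred (path_borel \<tau>) (\<lambda>\<xi>. fst (snd (\<xi> 0)) = i)"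
        by (rule m1')+
      show "Measurable.pred (path_borel \<tau>) (\<lambda>\<xi>. fst (\<xi> n) \<in> gens (induced_gdms \<tau>) (snd (\<xi> n)))" by (rule m2)
      have "(\<lambda>\<xi>. (\<lambda>e \<xi>. snd e = fst (snd (\<xi> (Suc n)))) (snd (\<xi> n)) \<xi>) \<in> path_borel \<tau> \<rightarrow>\<^sub>M count_space UNIV"
        by (rule measurable_compose_countable[OF m1' m1])
      then show "Measurable.pred (path_borel \<tau>) (\<lambda>\<xi>. snd (snd (\<xi> n)) = fst (snd (\<xi> (Suc n))))" by simp
    qed
    then show ?thesis by simp
  qed
  then show ?thesis unfolding pmeas_def using ae
    by (subst AE_distr_iff[OF measurable_path_of]) auto
qed

end


section \<open>The stationary vector and the averaged path measure\<close>

context markov_system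
begin

definition trans_prob :: "'v \<Rightarrow> 'v \<Rightarrow> real" where
  "trans_prob i j = measure (\<tau> i j) UNIV"

lemma trans_prob_nonneg: "0 \<le> trans_prob i j"
  by (simp add: trans_prob_def)

lemma emeasure_tau_UNIV: "emeasure (\<tau> i j) UNIV = ennreal (trans_prob i j)"
  using finite_measure.emeasure_eq_measure[OF finite_measure_tau] by (simp add: trans_prob_def)

lemma sum_trans_prob: "(\<Sum>j\<in>UNIV. trans_prob i j) = 1"
proof -
  have "ennreal (\<Sum>j\<in>UNIV. trans_prob i j) = ennreal 1"
    using sum_tau[of i] by (simp add: emeasure_tau_UNIV trans_prob_nonneg sum_ennreal)
  then show ?thesis by (subst (asm) ennreal_inj) (auto intro: sum_nonneg trans_prob_nonneg)
qed

lemma trans_prob_pos: "(i, j) \<in> mrds_edges \<tau> \<Longrightarrow> 0 < trans_prob i j"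
  by (simp add: mrds_edges_def emeasure_tau_UNIV)

lemma irreducible: "(i, j) \<in> (mrds_edges \<tau>)\<^sup>*"
  using in_MRDS by (simp add: MRDS_def irreducible_mrds_def)

text \<open>Mass is carried along every edge, and irreducibility connects \<open>k\<close> to
  \<open>j\<close>. Nonnegative vectors suffice, which the uniqueness proof exploits.\<close>

lemma stationary_pos:
  assumes nn: "\<And>i. 0 \<le> q i" and st: "\<And>j. (\<Sum>i\<in>UNIV. q i * trans_prob i j) = q j" and "0 < q k"
  shows "0 < q j"
  using irreducible[of k j]
proof (induction rule: rtrancl_induct)
  case base
  show ?case by (rule assms(3))
next
  case (step a b)
  have "0 < q a * trans_prob a b" using step(3) trans_prob_pos[OF step(2)] by simp
  also have "\<dots> \<le> (\<Sum>i\<in>UNIV. q i * trans_prob i b)"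
    by (rule member_le_sum) (auto intro: mult_nonneg_nonneg nn trans_prob_nonneg)
  finally show ?case by (simp add: st)
qed

definition is_stationary :: "('v \<Rightarrow> real) \<Rightarrow> bool" where
  "is_stationary p \<longleftrightarrow> (\<forall>j. (\<Sum>i\<in>UNIV. p i * measure (\<tau> i j) UNIV) = p j) \<and>
     (\<Sum>i\<in>UNIV. p i) = 1 \<and> (\<forall>i. p i > 0)"

text \<open>The transition matrix maps the simplex of probability vectors into itself, and Brouwer's
  theorem gives a fixed point there.\<close>

lemma ex_stationary: "\<exists>p. is_stationary p"
proof -
  define S where "S = {x :: real ^ 'v. (\<forall>i. 0 \<le> x $ i) \<and> (\<Sum>i\<in>UNIV. x $ i) = 1}"
  define f where "f = (\<lambda>x :: real ^ 'v. \<chi> j. \<Sum>i\<in>UNIV. x $ i * trans_prob i j)"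
  have "closed S"
  proof -
    have "S = (\<Inter>i. {x. 0 \<le> x $ i}) \<inter> {x. (\<Sum>i\<in>UNIV. x $ i) = 1}" by (auto simp: S_def)
    also have "closed \<dots>"
      by (intro closed_Int closed_INT ballI closed_Collect_le closed_Collect_eq continuous_intros)
    finally show ?thesis .
  qed
  moreover have "bounded S"
  proof (rule bounded_subset[OF bounded_cbox])
    show "S \<subseteq> cbox 0 (\<chi> i. 1)"
    proof
      fix x assume x: "x \<in> S"
      then have "x $ i \<le> (\<Sum>i\<in>UNIV. x $ i)" for i by (intro member_le_sum) (auto simp: S_def)
      with x show "x \<in> cbox 0 (\<chi> i. 1)" by (auto simp: S_def mem_box_cart)
    qed
  qed
  ultimately have cpt: "compact S" by (simp add: compact_eq_bounded_closed)
  have conv: "convex S"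
    unfolding convex_def S_def by (auto simp: sum.distrib simp flip: sum_distrib_left)
  have "(\<chi> i. if i = undefined then 1 else 0) \<in> S" by (auto simp: S_def)
  then have ne: "S \<noteq> {}" by auto
  have cont: "continuous_on S f" unfolding f_def by (intro continuous_intros)
  have map: "f \<in> S \<rightarrow> S"
  proof
    fix x assume x: "x \<in> S"
    have "(\<Sum>j\<in>UNIV. \<Sum>i\<in>UNIV. x $ i * trans_prob i j) = (\<Sum>i\<in>UNIV. x $ i * (\<Sum>j\<in>UNIV. trans_prob i j))"
      unfolding sum_distrib_left by (rule sum.swap)
    with x show "f x \<in> S"
      by (auto simp: S_def f_def sum_trans_prob intro!: sum_nonneg mult_nonneg_nonneg trans_prob_nonneg)
  qed
  obtain x where x: "x \<in> S" "f x = x" using brouwer[OF cpt conv ne cont map] by metis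
  define p where "p = (\<lambda>i. x $ i)"
  have st: "(\<Sum>i\<in>UNIV. p i * trans_prob i j) = p j" for j
    using arg_cong[OF x(2), of "\<lambda>x. x $ j"] by (simp add: f_def p_def)
  have nn: "0 \<le> p i" and s1: "(\<Sum>i\<in>UNIV. p i) = 1" for i using x(1) by (auto simp: S_def p_def)
  have "\<exists>k. 0 < p k"
  proof (rule ccontr)
    assume "\<not> (\<exists>k. 0 < p k)"
    then have "p k = 0" for k using nn[of k] by (metis less_eq_real_def)
    with s1 show False by simp
  qed
  then have "0 < p j" for j using stationary_pos[of p, OF nn st] by blast
  with st s1 show ?thesis by (auto simp: is_stationary_def trans_prob_def)
qed

lemma stationary_unique:
  assumes p: "is_stationary p" and p': "is_stationary p'"
  shows "p = p'"
proof -
  have pos: "0 < p i" "0 < p' i" for i using p p' by (auto simp: is_stationary_def)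
  have st: "(\<Sum>i\<in>UNIV. p i * trans_prob i j) = p j" "(\<Sum>i\<in>UNIV. p' i * trans_prob i j) = p' j" for j
    using p p' by (auto simp: is_stationary_def trans_prob_def)
  \<comment> \<open>With the smallest ratio, \<open>q\<close> is nonnegative, invariant and zero at
    some vertex, so it vanishes by \<open>stationary_pos\<close>; the two vectors are proportional,
    and their sums agree.\<close>
  define t where "t = Min (range (\<lambda>i. p i / p' i))"
  define q where "q = (\<lambda>i. p i - t * p' i)"
  have "t \<in> range (\<lambda>i. p i / p' i)" unfolding t_def by (rule Min_in) auto
  then obtain k where k: "t = p k / p' k" by auto
  have q0: "q k = 0" using pos(2)[of k] by (simp add: q_def k)
  have nn: "0 \<le> q i" for i
  proof -
    have "t \<le> p i / p' i" unfolding t_def by (rule Min_le) auto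
    then show ?thesis using pos(2)[of i] by (simp add: q_def field_simps)
  qed
  have stq: "(\<Sum>i\<in>UNIV. q i * trans_prob i j) = q j" for j
    by (simp add: q_def left_diff_distrib sum_subtractf st sum_distrib_left[symmetric] mult.assoc)
  have qz: "q i = 0" for i
    using stationary_pos[of q, OF nn stq, of i k] q0 nn[of i] by (cases "q i = 0") auto
  then have eq: "p i = t * p' i" for i using q_def by (metis eq_iff_diff_eq_0)
  have "(\<Sum>i\<in>UNIV. p i) = t * (\<Sum>i\<in>UNIV. p' i)" by (simp add: eq sum_distrib_left)
  then have "t = 1" using p p' by (simp add: is_stationary_def)
  then show ?thesis using eq by auto
qed

lemma is_stationary_vector: "is_stationary (stationary_vector \<tau>)"
proof -
  have "stationary_vector \<tau> = (THE p. is_stationary p)"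
    by (simp add: stationary_vector_def is_stationary_def)
  moreover have "\<exists>!p. is_stationary p" using ex_stationary stationary_unique by blast
  ultimately show ?thesis using theI'[of is_stationary] by simp
qed

lemma stationary_vector_props:
  "0 < stationary_vector \<tau> i" "(\<Sum>i\<in>UNIV. stationary_vector \<tau> i) = 1"
  using is_stationary_vector by (auto simp: is_stationary_def)

lemma emeasure_path_measure:
  assumes A: "A \<in> sets (path_borel \<tau>)"
  shows "emeasure (path_measure \<tau>) A = (\<Sum>i\<in>UNIV. ennreal (stationary_vector \<tau> i) * emeasure (pmeas i) A)"
  unfolding path_measure_def path_measure_from_eq
proof (rule emeasure_measure_of_sigma)
  show "sigma_algebra (space (path_borel \<tau>)) (sets (path_borel \<tau>))" ..
  show "positive (sets (path_borel \<tau>)) (\<lambda>A. \<Sum>i\<in>UNIV. ennreal (stationary_vector \<tau> i) * emeasure (pmeas i) A)"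
    by (simp add: positive_def)
  show "countably_additive (sets (path_borel \<tau>)) (\<lambda>A. \<Sum>i\<in>UNIV. ennreal (stationary_vector \<tau> i) * emeasure (pmeas i) A)"
  proof (rule countably_additiveI)
    fix F :: "nat \<Rightarrow> 'v path set"
    assume F: "range F \<subseteq> sets (path_borel \<tau>)" "disjoint_family F"
    have "(\<Sum>n. \<Sum>i\<in>UNIV. ennreal (stationary_vector \<tau> i) * emeasure (pmeas i) (F n)) =
      (\<Sum>i\<in>UNIV. \<Sum>n. ennreal (stationary_vector \<tau> i) * emeasure (pmeas i) (F n))"
      by (intro suminf_sum summableI)
    also have "\<dots> = (\<Sum>i\<in>UNIV. ennreal (stationary_vector \<tau> i) * emeasure (pmeas i) (\<Union>n. F n))"
      using F by (intro sum.cong refl) (simp add: suminf_emeasure sets_pmeas)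
    finally show "(\<Sum>n. \<Sum>i\<in>UNIV. ennreal (stationary_vector \<tau> i) * emeasure (pmeas i) (F n)) =
      (\<Sum>i\<in>UNIV. ennreal (stationary_vector \<tau> i) * emeasure (pmeas i) (\<Union>n. F n))" .
  qed
qed (rule A)

text \<open>Converts almost sure statements from every starting vertex into a Borel set of full
  averaged measure on which the property holds without exception.\<close>

lemma path_measure_full:
  assumes "\<And>i. AE \<xi> in pmeas i. Q \<xi>"
  obtains F where "F \<in> sets (path_borel \<tau>)" "emeasure (path_measure \<tau>) F = 1" "\<And>\<xi>. \<xi> \<in> F \<Longrightarrow> Q \<xi>"
proof -
  have "\<exists>N. {\<xi> \<in> space (pmeas i). \<not> Q \<xi>} \<subseteq> N \<and> emeasure (pmeas i) N = 0 \<and> N \<in> sets (pmeas i)" for i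
    by (rule AE_E[OF assms[of i]]) blast
  then have "\<forall>i. \<exists>N. {\<xi> \<in> space (pmeas i). \<not> Q \<xi>} \<subseteq> N \<and> emeasure (pmeas i) N = 0 \<and> N \<in> sets (pmeas i)" by (rule allI)
  from choice[OF this] obtain N where
    "\<forall>i. {\<xi> \<in> space (pmeas i). \<not> Q \<xi>} \<subseteq> N i \<and> emeasure (pmeas i) (N i) = 0 \<and> N i \<in> sets (pmeas i)" ..
  then have N: "{\<xi> \<in> space (pmeas i). \<not> Q \<xi>} \<subseteq> N i" "emeasure (pmeas i) (N i) = 0" "N i \<in> sets (pmeas i)" for i
    by simp_all
  \<comment> \<open>Each \<open>N i\<close> contains all paths violating \<open>Q\<close>, hence so
    does the intersection, which is null for every starting vertex.\<close>
  define F where "F = space (path_borel \<tau>) - (\<Inter>i. N i)"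
  have Fs: "F \<in> sets (path_borel \<tau>)"
    unfolding F_def using N(3) by (intro sets.Diff sets.top sets.finite_INT) (auto simp: sets_pmeas)
  have "emeasure (pmeas i) F = 1" for i
  proof -
    interpret prob_space "pmeas i" by (rule prob_space_pmeas)
    have "emeasure (pmeas i) (\<Inter>i. N i) \<le> emeasure (pmeas i) (N i)"
      by (rule emeasure_mono[OF INT_lower[OF UNIV_I, where B=N] N(3)])
    then have "emeasure (pmeas i) (\<Inter>i. N i) = 0" using N(2) by simp
    moreover have "(\<Inter>i. N i) \<in> sets (pmeas i)" using N(3) by (intro sets.finite_INT) (auto simp: sets_pmeas)
    ultimately have "emeasure (pmeas i) (space (pmeas i) - (\<Inter>i. N i)) = emeasure (pmeas i) (space (pmeas i))"
      by (intro emeasure_Diff_null_set) auto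
    then show ?thesis by (simp add: F_def space_pmeas emeasure_space_1[unfolded space_pmeas])
  qed
  then have "emeasure (path_measure \<tau>) F = (\<Sum>i\<in>UNIV. ennreal (stationary_vector \<tau> i))"
    by (simp add: emeasure_path_measure[OF Fs])
  also have "\<dots> = 1" using stationary_vector_props by (simp add: sum_ennreal less_imp_le)
  finally have F1: "emeasure (path_measure \<tau>) F = 1" .
  show thesis
  proof (rule that[OF Fs F1])
    show "Q \<xi>" if "\<xi> \<in> F" for \<xi>
      using that N(1) by (auto simp: F_def space_pmeas)
  qed
qed

end

sublocale markov_system \<subseteq> compact_gdms "induced_gdms \<tau>"
proof
  fix e assume e: "e \<in> edges (induced_gdms \<tau>)"
  then obtain i j where ij: "e = (i, j)" "(i, j) \<in> mrds_edges \<tau>"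
    by (cases e) (auto simp: induced_gdms_def)
  show "compact (gens (induced_gdms \<tau>) e)"
    using in_MRDS ij by (auto simp: MRDS_def induced_gdms_def)
  show "gens (induced_gdms \<tau>) e \<noteq> {}"
  proof
    assume "gens (induced_gdms \<tau>) e = {}"
    then have "AE f in \<tau> i j. False" using tau_support[of i j] by (simp add: induced_gdms_def ij)
    then have "emeasure (\<tau> i j) UNIV = 0" using AE_iff_measurable[of UNIV "\<tau> i j" "\<lambda>_. False"] by (simp add: space_tau sets_tau)
    with ij(2) show False by (simp add: mrds_edges_def)
  qed
next
  show "(i, j) \<in> (edges (induced_gdms \<tau>))\<^sup>*" for i j
    using irreducible by (simp add: induced_gdms_def)
  show "\<exists>j. (i, j) \<in> edges (induced_gdms \<tau>)" for i
  proof (rule ccontr)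
    assume "\<not> ?thesis"
    then have "(\<Sum>j\<in>UNIV. emeasure (\<tau> i j) UNIV) = 0"
      by (intro sum.neutral ballI tau_not_edge) (auto simp: induced_gdms_def)
    then show False using sum_tau[of i] by simp
  qed
qed


section \<open>Hitting the neighbourhoods of the minimal sets\<close>

lemma measurable_app_pair: "(\<lambda>p. app (fst p) (snd p)) \<in> borel_measurable (borel \<Otimes>\<^sub>M borel)"
  using borel_measurable_continuous_onI[OF continuous_on_app_pair[of UNIV]] by (simp add: borel_prod)

lemma measurable_traj_pair:
  "(\<lambda>p. traj (fst p) n (snd p)) \<in> borel_measurable (path_borel \<tau> \<Otimes>\<^sub>M borel)"
proof (induction n)
  case (Suc n)
  have "(\<lambda>p. (fst (fst p n), traj (fst p) n (snd p))) \<in> path_borel \<tau> \<Otimes>\<^sub>M borel \<rightarrow>\<^sub>M borel \<Otimes>\<^sub>M borel"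
    by (intro measurable_Pair Suc measurable_compose[OF measurable_fst measurable_path_fst])
  from measurable_compose[OF this measurable_app_pair] show ?case by simp
qed simp

lemma measurable_path_snd_UNIV:
  fixes \<tau> :: "'v::finite \<Rightarrow> 'v \<Rightarrow> rat_plus measure"
  shows "(\<lambda>\<xi>. snd (\<xi> n)) \<in> path_borel \<tau> \<rightarrow>\<^sub>M count_space UNIV"
  by (rule measurable_compose[OF measurable_path_snd]) simp

lemma measurable_traj: "(\<lambda>\<xi>. traj \<xi> n z) \<in> borel_measurable (path_borel \<tau>)"
proof -
  have "(\<lambda>\<xi>. (\<xi>, z)) \<in> path_borel \<tau> \<rightarrow>\<^sub>M path_borel \<tau> \<Otimes>\<^sub>M borel" by simp
  from measurable_compose[OF this measurable_traj_pair] show ?thesis by simp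
qed

lemma traj_case_nat: "traj (case_nat x \<xi>) (Suc n) z = traj \<xi> n (app (fst x) z)"
  by (induction n) simp_all

lemma sphere_area_null:
  assumes J: "closed J" and ae: "AE z in lborel. Finite z \<notin> J"
  shows "J \<in> null_sets sphere_area"
proof -
  define D where "D = density lborel (\<lambda>z. ennreal (4 / (1 + (cmod z)\<^sup>2)\<^sup>2))"
  have mF: "Finite \<in> D \<rightarrow>\<^sub>M borel"
    unfolding D_def using borel_measurable_continuous_onI[OF continuous_on_Finite[of UNIV]] by simp
  have Jb: "J \<in> sets borel" using J by (rule borel_closed)
  have "AE z in D. Finite z \<notin> J" unfolding D_def using ae by (subst AE_density) auto
  then have "emeasure D (Finite -` J \<inter> space D) = 0"
    using measurable_sets[OF mF Jb] by (subst (asm) AE_iff_measurable[of "Finite -` J \<inter> space D"]) auto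
  then have "emeasure sphere_area J = 0"
    unfolding sphere_area_def D_def[symmetric] using mF Jb by (simp add: emeasure_distr)
  then show ?thesis using Jb by (auto simp: null_sets_def sphere_area_def)
qed

locale mean_stable_system = markov_system \<tau> + contracting_gdms "induced_gdms \<tau>" C r c
  for \<tau> :: "'v::finite \<Rightarrow> 'v \<Rightarrow> rat_plus measure" and C r c :: real
begin

abbreviation "target \<equiv> near_minimal (induced_gdms \<tau>) r"

text \<open>Measurability is joint in the path and the starting point, as required for exchanging
  them by Fubini; it rests on the target being open.\<close>

lemma pred_hits: "Measurable.pred (path_borel \<tau> \<Otimes>\<^sub>M borel) (\<lambda>p. hits (fst p) (snd p))"
  unfolding hits_def
proof (rule pred_intros_countable)
  fix n
  have "(\<lambda>p. (\<lambda>e p. traj (fst p) n (snd p) \<in> target (fst e)) (snd (fst p n)) p)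
     \<in> path_borel \<tau> \<Otimes>\<^sub>M borel \<rightarrow>\<^sub>M count_space UNIV"
  proof (rule measurable_compose_countable[OF _ measurable_compose[OF measurable_fst measurable_path_snd_UNIV]])
    fix e :: "'v \<times> 'v"
    show "Measurable.pred (path_borel \<tau> \<Otimes>\<^sub>M borel) (\<lambda>p. traj (fst p) n (snd p) \<in> target (fst e))"
      using measurable_sets[OF measurable_traj_pair borel_open[OF open_near_minimal]]
      by (simp add: pred_def vimage_def Int_def conj_commute)
  qed
  then show "Measurable.pred (path_borel \<tau> \<Otimes>\<^sub>M borel) (\<lambda>p. traj (fst p) n (snd p) \<in> target (fst (snd (fst p n))))"
    by simp
qed

lemma pred_hits_section: "Measurable.pred (path_borel \<tau>) (\<lambda>\<xi>. hits \<xi> z)"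
proof -
  have "(\<lambda>\<xi>. (\<xi>, z)) \<in> path_borel \<tau> \<rightarrow>\<^sub>M path_borel \<tau> \<Otimes>\<^sub>M borel" by simp
  from measurable_compose[OF this pred_hits] show ?thesis by simp
qed

lemma sets_not_hits: "{\<xi> \<in> space (path_borel \<tau>). \<not> hits \<xi> z} \<in> sets (path_borel \<tau>)"
  using pred_hits_section[of z] by measurable

lemma hits_case_nat: "hits (case_nat x \<xi>) z \<longleftrightarrow> z \<in> target (fst (snd x)) \<or> hits \<xi> (app (fst x) z)"
proof
  assume "hits (case_nat x \<xi>) z"
  then obtain n where n: "traj (case_nat x \<xi>) n z \<in> target (fst (snd (case_nat x \<xi> n)))" by (auto simp: hits_def)
  show "z \<in> target (fst (snd x)) \<or> hits \<xi> (app (fst x) z)"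
  proof (cases n)
    case 0
    then show ?thesis using n by simp
  next
    case (Suc m)
    then show ?thesis using n unfolding Suc traj_case_nat by (auto simp: hits_def)
  qed
next
  assume "z \<in> target (fst (snd x)) \<or> hits \<xi> (app (fst x) z)"
  then show "hits (case_nat x \<xi>) z"
  proof
    assume "z \<in> target (fst (snd x))"
    then show ?thesis unfolding hits_def by (intro exI[of _ 0]) simp
  next
    assume "hits \<xi> (app (fst x) z)"
    then obtain n where "traj \<xi> n (app (fst x) z) \<in> target (fst (snd (\<xi> n)))" by (auto simp: hits_def)
    then show ?thesis unfolding hits_def by (intro exI[of _ "Suc n"]) (simp only: traj_case_nat nat.case)
  qed
qed

section \<open>The probability of never entering the target\<close>

definition miss :: "riemann_sphere \<Rightarrow> 'v \<Rightarrow> real" where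
  "miss z i = measure (pmeas i) {\<xi> \<in> space (path_borel \<tau>). \<not> hits \<xi> z}"

lemma emeasure_miss: "emeasure (pmeas i) {\<xi> \<in> space (path_borel \<tau>). \<not> hits \<xi> z} = ennreal (miss z i)"
proof -
  interpret prob_space "pmeas i" by (rule prob_space_pmeas)
  show ?thesis by (simp add: miss_def emeasure_eq_measure)
qed

lemma miss_bounds: "0 \<le> miss z i" "miss z i \<le> 1"
  unfolding miss_def using prob_space.prob_le_1[OF prob_space_pmeas] by auto

lemma cons_section_not_hits:
  "cons_section {\<xi> \<in> space (path_borel \<tau>). \<not> hits \<xi> z} i y \<subseteq>
     (if z \<in> target i then {} else {\<xi> \<in> space (path_borel \<tau>). \<not> hits \<xi> (app (fst y) z)})"
  by (auto simp: cons_section_def hits_case_nat)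

lemma miss_step: "ennreal (miss z i) \<le> (\<integral>\<^sup>+y. ennreal (miss (app (fst y) z) (snd y)) \<partial>step_measure i)"
  unfolding emeasure_miss[symmetric] emeasure_pmeas_cons[OF sets_not_hits, of i z]
  by (intro nn_integral_mono emeasure_mono subset_trans[OF cons_section_not_hits])
     (auto simp: sets_pmeas intro: sets_not_hits)

lemma miss_target: "z \<in> target i \<Longrightarrow> miss z i = 0"
proof -
  assume z: "z \<in> target i"
  have "cons_section {\<xi> \<in> space (path_borel \<tau>). \<not> hits \<xi> z} i y = {}" for y
    using cons_section_not_hits[of z i y] z by auto
  then have "ennreal (miss z i) = 0"
    unfolding emeasure_miss[symmetric] emeasure_pmeas_cons[OF sets_not_hits, of i z] by simp
  then show ?thesis using miss_bounds(1)[of z i] by simp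
qed

lemma tau_support_pos:
  assumes "f \<in> topological_support (\<tau> i j)" "open A" "f \<in> A"
  shows "0 < measure (\<tau> i j) A"
proof -
  have "0 < emeasure (\<tau> i j) A" using assms by (auto simp: topological_support_def)
  then show ?thesis using finite_measure.emeasure_eq_measure[OF finite_measure_tau] by (metis ennreal_0 ennreal_less_zero_iff)
qed

text \<open>
  If \<open>m\<close> bounds the miss probability everywhere, then near each point it is bounded by
  \<open>(1 - \<epsilon>) m\<close>, because the target is reached along some word with positive probability.
  By compactness the bound \<open>m\<close> improves by a factor, so the supremum vanishes.
\<close>

lemma miss_local_decrease:
  assumes bound: "\<And>z i. miss z i \<le> m"
    and "path_map (induced_gdms \<tau>) n i j h" "h z \<in> target j"
  shows "\<exists>\<epsilon>>0. \<exists>G. open G \<and> z \<in> G \<and> (\<forall>z'\<in>G. miss z' i \<le> (1 - \<epsilon>) * m)"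
  using assms(2,3)
proof (induction n arbitrary: i h z)
  case 0
  have "0 \<le> m" using bound[of z i] miss_bounds(1)[of z i] by linarith
  \<comment> \<open>The miss probability vanishes on the target, which is open; 1/2 is an arbitrary
    value below 1.\<close>
  with 0 show ?case
    by (intro exI[of _ "1/2"] conjI exI[of _ "target i"]) (auto simp: open_near_minimal miss_target)
next
  case (Suc n)
  from Suc.prems(1) obtain k f g where g: "(i, k) \<in> edges (induced_gdms \<tau>)" "f \<in> gens (induced_gdms \<tau>) (i, k)"
    "path_map (induced_gdms \<tau>) n k j g" "h = g \<circ> app f" unfolding path_map_Suc_iff by blast
  have k: "k \<in> succs i" and f: "f \<in> topological_support (\<tau> i k)"
    using g(1,2) by (auto simp: induced_gdms_def succs_def)
  obtain \<epsilon> G where G: "\<epsilon> > 0" "open G" "app f z \<in> G" "\<And>z'. z' \<in> G \<Longrightarrow> miss z' k \<le> (1 - \<epsilon>) * m"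
    using Suc.IH[OF g(3), of "app f z"] Suc.prems(2) g(4) by auto
  \<comment> \<open>Joint continuity allows both \<open>f\<close> and \<open>z\<close> to vary, in
    \<open>A\<close> and \<open>B\<close>; the set \<open>A\<close> has positive mass because
    \<open>f\<close> belongs to the support.\<close>
  have "open ((\<lambda>p. app (fst p) (snd p)) -` G)"
    by (intro open_vimage G(2) continuous_on_app_pair)
  moreover have "(f, z) \<in> (\<lambda>p. app (fst p) (snd p)) -` G" using G(3) by simp
  ultimately obtain A B where "open A" "open B" "(f, z) \<in> A \<times> B" "A \<times> B \<subseteq> (\<lambda>p. app (fst p) (snd p)) -` G"
    by (rule open_prod_elim)
  then have AB: "open A" "open B" "f \<in> A" "z \<in> B" "A \<times> B \<subseteq> (\<lambda>p. app (fst p) (snd p)) -` G" by auto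
  define a where "a = measure (\<tau> i k) A"
  have a: "a > 0" unfolding a_def by (rule tau_support_pos[OF f AB(1,3)])
  interpret step: prob_space "step_measure i" by (rule prob_space_step)
  have rect: "A \<times> {k} \<in> sets (step_measure i)" "measure (step_measure i) (A \<times> {k}) = a"
    using emeasure_step_rect[OF borel_open[OF AB(1)] k] by (auto simp: a_def measure_def)
  \<comment> \<open>With probability \<open>a\<close> the first step falls into
    \<open>A \<times> {k}\<close>, after which the improved bound holds; otherwise the bound
    \<open>m\<close> is used.\<close>
  have "miss z' i \<le> (1 - \<epsilon> * a) * m" if z': "z' \<in> B" for z'
  proof -
    have m0: "0 \<le> m" using bound[of z i] miss_bounds(1)[of z i] by linarith
    have m1: "0 \<le> (1 - \<epsilon>) * m" using G(3,4) miss_bounds(1) order_trans by blast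
    have le: "ennreal (miss (app (fst y) z') (snd y)) \<le>
       ennreal ((1 - \<epsilon>) * m) * indicator (A \<times> {k}) y + ennreal m * indicator (space (step_measure i) - A \<times> {k}) y"
      if y: "y \<in> space (step_measure i)" for y
    proof (cases "y \<in> A \<times> {k}")
      case True
      then have "app (fst y) z' \<in> G" using AB(5) z' by auto
      with True G(4) y show ?thesis by (auto intro!: ennreal_leI)
    next
      case False
      then show ?thesis using y bound by (auto intro!: ennreal_leI)
    qed
    have "ennreal (miss z' i) \<le> (\<integral>\<^sup>+y. ennreal ((1 - \<epsilon>) * m) * indicator (A \<times> {k}) y +
        ennreal m * indicator (space (step_measure i) - A \<times> {k}) y \<partial>step_measure i)"
      by (rule order_trans[OF miss_step]) (intro nn_integral_mono le)
    also have "\<dots> = ennreal ((1 - \<epsilon>) * m) * emeasure (step_measure i) (A \<times> {k}) +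
        ennreal m * emeasure (step_measure i) (space (step_measure i) - A \<times> {k})"
      using rect(1) by (subst nn_integral_add) (auto simp: nn_integral_cmult_indicator)
    also have "\<dots> = ennreal ((1 - \<epsilon>) * m) * ennreal a + ennreal m * ennreal (1 - a)"
      using rect by (simp add: step.emeasure_eq_measure step.prob_compl)
    also have "\<dots> = ennreal ((1 - \<epsilon>) * m * a + m * (1 - a))"
    proof -
      have "a \<le> 1" using step.prob_le_1[of "A \<times> {k}"] rect(2) by simp
      then show ?thesis using a m0 m1 by (simp add: ennreal_mult' [symmetric] ennreal_plus[symmetric] del: ennreal_plus)
    qed
    \<comment> \<open>\<open>ennreal\<close> cuts negative numbers off at 0, which accounts for the
      second alternative; it is excluded next.\<close>
    finally have "miss z' i \<le> (1 - \<epsilon>) * m * a + m * (1 - a) \<or> (1 - \<epsilon>) * m * a + m * (1 - a) < 0"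
      by (metis ennreal_le_iff not_le)
    moreover have "0 \<le> (1 - \<epsilon>) * m * a + m * (1 - a)"
      using step.prob_le_1[of "A \<times> {k}"] rect(2) a
      by (intro add_nonneg_nonneg mult_nonneg_nonneg[OF m1] mult_nonneg_nonneg[OF m0]) auto
    ultimately show ?thesis by (simp add: algebra_simps)
  qed
  then show ?case using AB(2,4) G(1) a by (intro exI[of _ "\<epsilon> * a"] conjI exI[of _ B]) auto
qed

lemma miss_eq_0: "miss z i = 0"
proof -
  define m where "m = (SUP p. miss (fst p) (snd p))"
  have bdd: "bdd_above (range (\<lambda>p. miss (fst p) (snd p)))"
    by (intro bdd_aboveI[of _ 1]) (auto simp: miss_bounds)
  have bound: "miss z i \<le> m" for z i
    unfolding m_def using cSUP_upper[OF _ bdd, of "(z, i)"] by simp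
  have m0: "0 \<le> m" using bound[of z i] miss_bounds(1)[of z i] by linarith
  have "\<exists>\<epsilon>>0. \<forall>z. miss z i \<le> (1 - \<epsilon>) * m" for i
  proof -
    have "\<exists>\<epsilon> G. \<epsilon> > 0 \<and> open G \<and> z \<in> G \<and> (\<forall>z'\<in>G. miss z' i \<le> (1 - \<epsilon>) * m)" for z
      using ex_path_to_near_minimal[of i z] miss_local_decrease[OF bound] by metis
    then obtain \<epsilon> G where G: "\<And>z. \<epsilon> z > 0" "\<And>z. open (G z)" "\<And>z. z \<in> G z"
      "\<And>z z'. z' \<in> G z \<Longrightarrow> miss z' i \<le> (1 - \<epsilon> z) * m" by metis
    \<comment> \<open>The gain \<epsilon> depends on the point; a finite subcover leaves a positive
      minimum.\<close>
    obtain D where D: "finite D" "UNIV \<subseteq> (\<Union>z\<in>D. G z)"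
      by (rule compactE_image[OF compact_UNIV_sphere, of UNIV G]) (use G(2,3) in auto)
    have ne: "D \<noteq> {}" using D(2) by auto
    have Mpos: "0 < Min (\<epsilon> ` D)" using D(1) ne G(1) by simp
    have "miss z i \<le> (1 - Min (\<epsilon> ` D)) * m" for z
    proof -
      obtain w where w: "w \<in> D" "z \<in> G w" using D(2) by blast
      have "Min (\<epsilon> ` D) \<le> \<epsilon> w" using D(1) w(1) by simp
      then have "(1 - \<epsilon> w) * m \<le> (1 - Min (\<epsilon> ` D)) * m" using m0 by (intro mult_right_mono) auto
      with G(4)[OF w(2)] show ?thesis by linarith
    qed
    with Mpos show ?thesis by blast
  qed
  then have "\<exists>\<epsilon>>0. \<forall>i. \<forall>z. miss z i \<le> (1 - \<epsilon>) * m"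
  proof (rule finite_pos_choice)
    fix i d d' assume "\<forall>z. miss z i \<le> (1 - d) * m" "d' \<le> d"
    moreover from this(2) have "(1 - d) * m \<le> (1 - d') * m" using m0 by (intro mult_right_mono) auto
    ultimately show "\<forall>z. miss z i \<le> (1 - d') * m" by (meson order_trans)
  qed
  then obtain \<epsilon> where \<epsilon>: "\<epsilon> > 0" "\<And>z i. miss z i \<le> (1 - \<epsilon>) * m" by blast
  have "m \<le> (1 - \<epsilon>) * m" unfolding m_def[of] by (rule cSUP_least) (use \<epsilon>(2) in \<open>auto simp: m_def\<close>)
  then have "\<epsilon> * m \<le> 0" by (simp add: algebra_simps)
  then have "m \<le> 0" using \<epsilon>(1) by (simp add: mult_le_0_iff)
  with bound[of z i] miss_bounds(1)[of z i] show ?thesis by linarith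
qed

lemma AE_hits: "AE \<xi> in pmeas i. hits \<xi> z"
  using emeasure_miss[of i z] sets_not_hits[of z]
  by (subst AE_iff_measurable[OF _ refl]) (auto simp: space_pmeas sets_pmeas miss_eq_0)

lemma AE_regular_hits: "AE \<xi> in pmeas i. regular_path (induced_gdms \<tau>) \<xi> \<and> hits \<xi> z"
  using AE_pmeas_regular[of i] AE_hits[of z i] by eventually_elim simp

section \<open>The consequences of mean stability\<close>

lemma exponential_contraction:
  obtains F where "F \<in> sets (path_borel \<tau>)" "emeasure (path_measure \<tau>) F = 1"
    "\<And>\<xi>. \<xi> \<in> F \<Longrightarrow> \<exists>\<rho>>0. \<exists>K>0. \<forall>n\<ge>1. diameter (traj \<xi> n ` ball z \<rho>) \<le> K * c ^ n"
proof -
  obtain F where F: "F \<in> sets (path_borel \<tau>)" "emeasure (path_measure \<tau>) F = 1"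
    "\<And>\<xi>. \<xi> \<in> F \<Longrightarrow> regular_path (induced_gdms \<tau>) \<xi> \<and> hits \<xi> z"
    using path_measure_full[OF AE_regular_hits, of z] by metis
  show thesis
  proof (rule that[OF F(1,2)])
    fix \<xi> assume "\<xi> \<in> F"
    then have r: "regular_path (induced_gdms \<tau>) \<xi>" "hits \<xi> z" using F(3) by auto
    show "\<exists>\<rho>>0. \<exists>K>0. \<forall>n\<ge>1. diameter (traj \<xi> n ` ball z \<rho>) \<le> K * c ^ n"
    proof (rule hits_imp_contraction[OF r])
      fix \<rho> K assume \<rho>: "\<rho> > 0" "K > 0"
        "\<And>n x y. x \<in> ball z \<rho> \<Longrightarrow> y \<in> ball z \<rho> \<Longrightarrow> dist (traj \<xi> n x) (traj \<xi> n y) \<le> K * c ^ n"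
      have "diameter (traj \<xi> n ` ball z \<rho>) \<le> K * c ^ n" for n
        unfolding diameter_def using \<rho> by (auto intro!: cSUP_least)
      with \<rho>(1,2) show ?thesis by blast
    qed
  qed
qed

lemma convergence_to_minimal_set:
  obtains F where "F \<in> sets (path_borel \<tau>)" "emeasure (path_measure \<tau>) F = 1"
    "\<And>\<xi>. \<xi> \<in> F \<Longrightarrow> \<exists>L. minimal_set (induced_gdms \<tau>) L \<and> tends_to \<xi> z L"
proof -
  obtain F where F: "F \<in> sets (path_borel \<tau>)" "emeasure (path_measure \<tau>) F = 1"
    "\<And>\<xi>. \<xi> \<in> F \<Longrightarrow> regular_path (induced_gdms \<tau>) \<xi> \<and> hits \<xi> z"
    using path_measure_full[OF AE_regular_hits, of z] by metis
  show thesis by (rule that[OF F(1,2)]) (meson F(3) hits_imp_tends_to)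
qed

lemma path_julia_null:
  obtains F where "F \<in> sets (path_borel \<tau>)" "emeasure (path_measure \<tau>) F = 1"
    "\<And>\<xi>. \<xi> \<in> F \<Longrightarrow> path_julia \<xi> \<in> null_sets sphere_area"
proof -
  have "AE \<xi> in pmeas i. path_julia \<xi> \<in> null_sets sphere_area" for i
  proof -
    interpret P: prob_space "pmeas i" by (rule prob_space_pmeas)
    interpret PL: pair_sigma_finite "pmeas i" "lborel :: complex measure" ..
    have "(\<lambda>p. (fst p, Finite (snd p))) \<in> pmeas i \<Otimes>\<^sub>M lborel \<rightarrow>\<^sub>M path_borel \<tau> \<Otimes>\<^sub>M borel"
    proof (rule measurable_Pair)
      show "fst \<in> pmeas i \<Otimes>\<^sub>M lborel \<rightarrow>\<^sub>M path_borel \<tau>"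
        using measurable_fst[of "pmeas i" lborel] by (simp add: measurable_cong_sets[OF refl sets_pmeas])
      have "Finite \<in> borel_measurable lborel"
        using borel_measurable_continuous_onI[OF continuous_on_Finite[of UNIV]] by simp
      from measurable_compose[OF measurable_snd this] show "(\<lambda>p. Finite (snd p)) \<in> pmeas i \<Otimes>\<^sub>M lborel \<rightarrow>\<^sub>M borel" .
    qed
    from measurable_compose[OF this pred_hits]
    have "Measurable.pred (pmeas i \<Otimes>\<^sub>M lborel) (\<lambda>p. hits (fst p) (Finite (snd p)))" by simp
    then have "{p \<in> space (pmeas i \<Otimes>\<^sub>M lborel). hits (fst p) (Finite (snd p))} \<in> sets (pmeas i \<Otimes>\<^sub>M lborel)"
      by measurable
    \<comment> \<open>For every starting point almost every path hits, hence for almost every path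
      almost every point of the plane does. The point at infinity carries no area.\<close>
    from PL.AE_commute[OF this] have "AE \<xi> in pmeas i. AE z in lborel. hits \<xi> (Finite z)"
      using AE_hits by simp
    with AE_pmeas_regular[of i] show ?thesis
    proof eventually_elim
      case (elim \<xi>)
      have "closed (path_julia \<xi>)" unfolding path_julia_def by (simp add: open_fatou_set closed_Compl)
      moreover have "AE z in lborel. Finite z \<notin> path_julia \<xi>"
        using elim(2) by eventually_elim (use elim(1) hits_imp_not_julia in blast)
      ultimately show ?case by (rule sphere_area_null)
    qed
  qed
  then show thesis using path_measure_full that by metis
qed

section \<open>The events of convergence to a minimal set and their probabilities\<close>

lemma pred_tends_to: "Measurable.pred (path_borel \<tau>) (\<lambda>\<xi>. tends_to \<xi> z L)"
proof -
  define X where "X = (\<lambda>n \<xi>. infdist (traj \<xi> (Suc n) z) (L (snd (snd (\<xi> n :: rat_plus \<times> 'v \<times> 'v)))))"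
  have X: "X n \<in> borel_measurable (path_borel \<tau>)" for n
  proof -
    have "(\<lambda>\<xi>. (\<lambda>e \<xi>. infdist (traj \<xi> (Suc n) z) (L (snd e))) (snd (\<xi> n)) \<xi>) \<in> borel_measurable (path_borel \<tau>)"
    proof (rule measurable_compose_countable[OF _ measurable_path_snd_UNIV])
      fix e :: "'v \<times> 'v"
      have "(\<lambda>x. infdist x (L (snd e))) \<in> borel_measurable borel"
        by (intro borel_measurable_continuous_onI continuous_on_infdist continuous_on_id)
      from measurable_compose[OF measurable_traj this]
      show "(\<lambda>\<xi>. infdist (traj \<xi> (Suc n) z) (L (snd e))) \<in> borel_measurable (path_borel \<tau>)" .
    qed
    then show ?thesis by (simp add: X_def)
  qed
  have eq: "tends_to \<xi> z L \<longleftrightarrow> (\<forall>k. \<exists>N. \<forall>n. N \<le> n \<longrightarrow> X n \<xi> < 1 / real (Suc k))" for \<xi>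
  proof
    assume "tends_to \<xi> z L"
    then have "(\<lambda>n. X n \<xi>) \<longlonglongrightarrow> 0" by (simp add: tends_to_def X_def)
    then have "\<forall>\<^sub>F n in sequentially. X n \<xi> < 1 / real (Suc k)" for k by (rule order_tendstoD) simp
    then show "\<forall>k. \<exists>N. \<forall>n. N \<le> n \<longrightarrow> X n \<xi> < 1 / real (Suc k)" by (simp add: eventually_sequentially)
  next
    assume A: "\<forall>k. \<exists>N. \<forall>n. N \<le> n \<longrightarrow> X n \<xi> < 1 / real (Suc k)"
    have "(\<lambda>n. X n \<xi>) \<longlonglongrightarrow> 0"
    proof (rule LIMSEQ_I)
      fix e :: real assume "e > 0"
      then obtain k where k: "1 / real (Suc k) < e" using nat_approx_posE by blast
      obtain N where "\<And>n. N \<le> n \<Longrightarrow> X n \<xi> < 1 / real (Suc k)" using A by blast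
      with k show "\<exists>N. \<forall>n\<ge>N. norm (X n \<xi> - 0) < e"
        by (intro exI[of _ N]) (force simp: X_def infdist_nonneg)
    qed
    then show "tends_to \<xi> z L" by (simp add: tends_to_def X_def)
  qed
  have "Measurable.pred (path_borel \<tau>) (\<lambda>\<xi>. X n \<xi> < a)" for n a
    using X[of n] by measurable
  then show ?thesis unfolding eq
    by (intro pred_intros_countable pred_intros_logic) auto
qed

lemma sets_tends_to: "{\<xi> \<in> space (path_borel \<tau>). tends_to \<xi> z L} \<in> sets (path_borel \<tau>)"
  using pred_tends_to[of z L] by (simp add: pred_def)

lemma TT_eq: "TT \<tau> L z i = measure (pmeas i) {\<xi> \<in> space (path_borel \<tau>). tends_to \<xi> z L}"
  by (simp add: TT_def path_measure_from_eq)

text \<open>A path that hits from \<open>z\<close> contracts a whole ball about \<open>z\<close>, so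
  all points of the ball agree on whether they tend to \<open>L\<close>. Along a sequence converging
  to \<open>z\<close> the indicators of the events are therefore almost surely eventually
  constant.\<close>

lemma continuous_on_TT: "continuous_on UNIV (\<lambda>z. TT \<tau> L z i)"
  unfolding continuous_on_sequentially comp_def
proof (intro ballI allI impI, elim conjE)
  fix z :: riemann_sphere and x :: "nat \<Rightarrow> riemann_sphere" assume x: "x \<longlonglongrightarrow> z"
  interpret P: prob_space "pmeas i" by (rule prob_space_pmeas)
  define A where "A = (\<lambda>z. {\<xi> \<in> space (path_borel \<tau>). tends_to \<xi> z L})"
  have A: "A z \<in> sets (pmeas i)" for z unfolding A_def sets_pmeas by (rule sets_tends_to)
  have "(\<lambda>n. \<integral>\<xi>. indicator (A (x n)) \<xi> \<partial>pmeas i) \<longlonglongrightarrow> (\<integral>\<xi>. indicator (A z) \<xi> \<partial>pmeas i :: real)"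
  proof (rule integral_dominated_convergence[where w="\<lambda>_. 1"])
    show "AE \<xi> in pmeas i. (\<lambda>n. indicator (A (x n)) \<xi>) \<longlonglongrightarrow> (indicator (A z) \<xi> :: real)"
      using AE_regular_hits[of z i]
    proof eventually_elim
      case (elim \<xi>)
      then have r: "regular_path (induced_gdms \<tau>) \<xi>" "hits \<xi> z" by auto
      show ?case
      proof (rule hits_imp_contraction[OF r])
        fix \<rho> K assume \<rho>: "\<rho> > 0" "K > 0"
          "\<And>n x y. x \<in> ball z \<rho> \<Longrightarrow> y \<in> ball z \<rho> \<Longrightarrow> dist (traj \<xi> n x) (traj \<xi> n y) \<le> K * c ^ n"
        have "\<forall>\<^sub>F n in sequentially. dist (x n) z < \<rho>" using x \<rho>(1) by (rule tendstoD)
        then have "\<forall>\<^sub>F n in sequentially. (indicator (A z) \<xi> :: real) = indicator (A (x n)) \<xi>"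
        proof eventually_elim
          case (elim n)
          then have b: "x n \<in> ball z \<rho>" "z \<in> ball z \<rho>" using \<rho>(1) by (auto simp: dist_commute)
          have "tends_to \<xi> z L \<longleftrightarrow> tends_to \<xi> (x n) L"
            using tends_to_cong[OF \<rho>(3)[OF b]] tends_to_cong[OF \<rho>(3)[OF b(2,1)]] by blast
          then show ?case by (simp add: A_def indicator_def)
        qed
        then show ?thesis by (rule Lim_transform_eventually[OF tendsto_const])
      qed
    qed
  qed (use A in \<open>auto simp: indicator_def\<close>)
  then show "(\<lambda>n. TT \<tau> L (x n) i) \<longlonglongrightarrow> TT \<tau> L z i"
    using A by (simp add: TT_eq A_def)
qed

lemma continuous_map_TT:
  "continuous_map (prod_topology euclidean (discrete_topology UNIV)) euclideanreal (\<lambda>(z, i). TT \<tau> L z i)"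
  unfolding continuous_map_def
proof (intro conjI allI impI)
  fix U :: "real set" assume "openin euclideanreal U"
  then have U: "open U" by simp
  show "openin (prod_topology euclidean (discrete_topology UNIV))
    {x \<in> topspace (prod_topology euclidean (discrete_topology UNIV)). (case x of (z, i) \<Rightarrow> TT \<tau> L z i) \<in> U}"
    unfolding openin_prod_topology_alt
  proof (intro allI impI)
    fix z i assume "(z, i) \<in> {x \<in> topspace (prod_topology euclidean (discrete_topology UNIV)). (case x of (z, i) \<Rightarrow> TT \<tau> L z i) \<in> U}"
    then have "TT \<tau> L z i \<in> U" by simp
    moreover have "open ((\<lambda>z. TT \<tau> L z i) -` U)" by (rule open_vimage[OF U continuous_on_TT])
    ultimately show "\<exists>V W. openin euclidean V \<and> openin (discrete_topology UNIV) W \<and> z \<in> V \<and> i \<in> W \<and>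
      V \<times> W \<subseteq> {x \<in> topspace (prod_topology euclidean (discrete_topology UNIV)). (case x of (z, i) \<Rightarrow> TT \<tau> L z i) \<in> U}"
      by (intro exI[of _ "(\<lambda>z. TT \<tau> L z i) -` U"] exI[of _ "{i}"]) auto
  qed
qed simp

lemma continuous_on_TT_avg: "continuous_on UNIV (TT_avg \<tau> L)"
  unfolding TT_avg_def[abs_def] by (intro continuous_intros continuous_on_TT)

text \<open>The events for different minimal sets are disjoint by \<open>tends_to_unique\<close>,
  and hitting paths belong to one of them.\<close>

lemma sum_TT: "(\<Sum>L | minimal_set (induced_gdms \<tau>) L. TT \<tau> L z i) = 1"
proof -
  interpret P: prob_space "pmeas i" by (rule prob_space_pmeas)
  define A where "A = (\<lambda>L. {\<xi> \<in> space (path_borel \<tau>). tends_to \<xi> z L})"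
  define M where "M = {L. minimal_set (induced_gdms \<tau>) L}"
  have A: "A L \<in> sets (pmeas i)" for L unfolding A_def sets_pmeas by (rule sets_tends_to)
  have fin: "finite M" unfolding M_def by (rule finite_minimal_sets)
  have disj: "disjoint_family_on A M"
    unfolding disjoint_family_on_def A_def M_def using tends_to_unique by blast
  have "(\<Sum>L\<in>M. TT \<tau> L z i) = (\<Sum>L\<in>M. measure (pmeas i) (A L))" by (simp add: TT_eq A_def)
  also have "\<dots> = measure (pmeas i) (\<Union>L\<in>M. A L)"
    using A by (intro P.finite_measure_finite_Union[symmetric] fin disj) auto
  also have "\<dots> = 1"
  proof (subst P.prob_eq_1)
    show "(\<Union>L\<in>M. A L) \<in> sets (pmeas i)" using A fin by auto
    have "AE \<xi> in pmeas i. \<xi> \<in> space (pmeas i)" by (rule AE_space)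
    with AE_regular_hits[of z i] show "AE \<xi> in pmeas i. \<xi> \<in> (\<Union>L\<in>M. A L)"
    proof eventually_elim
      case (elim \<xi>)
      then obtain L where "minimal_set (induced_gdms \<tau>) L" "tends_to \<xi> z L"
        by (elim conjE) (rule hits_imp_tends_to)
      with elim(2) show ?case by (auto simp: M_def A_def space_pmeas)
    qed
  qed
  finally show ?thesis by (simp add: M_def)
qed

lemma sum_TT_avg:
  assumes "bij_betw Ls {1..l::nat} {L. minimal_set (induced_gdms \<tau>) L}"
  shows "(\<Sum>k=1..l. TT_avg \<tau> (Ls k) z) = 1"
proof -
  have "(\<Sum>k=1..l. TT_avg \<tau> (Ls k) z) = (\<Sum>L | minimal_set (induced_gdms \<tau>) L. TT_avg \<tau> L z)"
    by (rule sum.reindex_bij_betw[OF assms])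
  also have "\<dots> = (\<Sum>i\<in>UNIV. stationary_vector \<tau> i * (\<Sum>L | minimal_set (induced_gdms \<tau>) L. TT \<tau> L z i))"
    unfolding TT_avg_def sum_distrib_left by (rule sum.swap)
  also have "\<dots> = 1" by (simp add: sum_TT stationary_vector_props)
  finally show ?thesis .
qed

end

lemma (in markov_system) mean_stable_imp_system:
  assumes "mean_stable (induced_gdms \<tau>)"
  obtains C r c where "mean_stable_system \<tau> C r c" "0 < c" "c < 1"
    "\<And>L. minimal_set (induced_gdms \<tau>) L \<Longrightarrow> attracting (induced_gdms \<tau>) L"
proof -
  obtain N U W where T: "trapping (induced_gdms \<tau>) N U W" using mean_stable_imp_trapping[OF assms] by metis
  obtain C r c where C: "C > 0" "r > 0" "0 < c" "c < 1"
    "\<And>i x y n j h. x \<in> U i \<Longrightarrow> dist x y < r \<Longrightarrow> path_map (induced_gdms \<tau>) n i j h \<Longrightarrow> dist (h x) (h y) \<le> C * c ^ n"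
    using contraction[OF T] by metis
  show thesis
  proof (rule that[OF _ C(3,4)])
    show "mean_stable_system \<tau> C r c"
    proof (intro mean_stable_system.intro markov_system_axioms contracting_gdms.intro compact_gdms_axioms contracting_gdms_axioms.intro)
      fix L y i x n j h
      assume "minimal_set (induced_gdms \<tau>) L" "y \<in> L i" "dist y x < r" "path_map (induced_gdms \<tau>) n i j h"
      then show "dist (h y) (h x) \<le> C * c ^ n"
        using minimal_set_subset_trapping[OF T] C(5) by blast
    qed (use C in auto)
    show "attracting (induced_gdms \<tau>) L" if "minimal_set (induced_gdms \<tau>) L" for L
      by (rule minimal_set_attracting[OF T that])
  qed
qed

text \<open>Mean stability lets some word carry each point into \<open>W\<close>, inside a Fatou
  set, so no point has all its images in Julia sets.\<close>

lemma kernel_julia_empty: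
  assumes "mean_stable S"
  shows "kernel_julia S i = {}"
proof -
  obtain W where "\<forall>i. closure (W i) \<subseteq> fatou S i" "\<forall>z i. \<exists>j. \<exists>h\<in>word_maps S i j. h z \<in> W j"
    using assms unfolding mean_stable_def by blast
  then have "\<exists>j. \<exists>h\<in>word_maps S i j. h z \<in> fatou S j" for z
    by (meson closure_subset subsetD)
  then show ?thesis by (fastforce simp: kernel_julia_def julia_def)
qed

theorem mainTheorem1:
  fixes \<tau> :: "'v::finite \<Rightarrow> 'v \<Rightarrow> rat_plus measure"
  assumes "\<tau> \<in> MRDS UNIV"
    and "mean_stable (induced_gdms \<tau>)"
  shows
    "(\<exists>c::real. 0 < c \<and> c < 1 \<and>
        (\<forall>z. \<exists>F\<in>sets (path_borel \<tau>). emeasure (path_measure \<tau>) F = 1 \<and>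
          (\<forall>\<xi>\<in>F. \<exists>r>0. \<exists>K>0. \<forall>n\<ge>1. diameter (traj \<xi> n ` ball z r) \<le> K * c ^ n))) \<and>
     (\<forall>z. \<exists>F\<in>sets (path_borel \<tau>). emeasure (path_measure \<tau>) F = 1 \<and>
        (\<forall>\<xi>\<in>F. \<exists>L. minimal_set (induced_gdms \<tau>) L \<and> attracting (induced_gdms \<tau>) L \<and>
          tends_to \<xi> z L)) \<and>
     (\<forall>i. kernel_julia (induced_gdms \<tau>) i = {}) \<and>
     (\<exists>G\<in>sets (path_borel \<tau>). emeasure (path_measure \<tau>) G = 1 \<and>
        (\<forall>\<xi>\<in>G. path_julia \<xi> \<in> null_sets sphere_area)) \<and>
     (finite {L. minimal_set (induced_gdms \<tau>) L} \<and>
      (\<forall>L. minimal_set (induced_gdms \<tau>) L \<longrightarrow>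
         attracting (induced_gdms \<tau>) L \<and>
         continuous_map (prod_topology euclidean (discrete_topology UNIV)) euclideanreal
           (\<lambda>(z, i). TT \<tau> L z i) \<and>
         continuous_on UNIV (TT_avg \<tau> L))) \<and>
     (\<forall>(l::nat) Ls. bij_betw Ls {1..l} {L. minimal_set (induced_gdms \<tau>) L} \<longrightarrow>
        (\<forall>z. (\<Sum>k=1..l. TT_avg \<tau> (Ls k) z) = 1))"
proof -
  interpret markov_system \<tau> by (rule markov_system.intro[OF assms(1)])
  obtain C r c where c: "mean_stable_system \<tau> C r c" "0 < c" "c < 1" and
    att: "\<And>L. minimal_set (induced_gdms \<tau>) L \<Longrightarrow> attracting (induced_gdms \<tau>) L"
    using mean_stable_imp_system[OF assms(2)] by metis
  interpret mean_stable_system \<tau> C r c by (rule c(1))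
  show ?thesis
  proof (intro conjI allI impI)
    show "\<exists>c::real. 0 < c \<and> c < 1 \<and>
        (\<forall>z. \<exists>F\<in>sets (path_borel \<tau>). emeasure (path_measure \<tau>) F = 1 \<and>
          (\<forall>\<xi>\<in>F. \<exists>r>0. \<exists>K>0. \<forall>n\<ge>1. diameter (traj \<xi> n ` ball z r) \<le> K * c ^ n))"
      using c(2,3) exponential_contraction by (intro exI[of _ c]) metis
    show "\<exists>F\<in>sets (path_borel \<tau>). emeasure (path_measure \<tau>) F = 1 \<and>
        (\<forall>\<xi>\<in>F. \<exists>L. minimal_set (induced_gdms \<tau>) L \<and> attracting (induced_gdms \<tau>) L \<and> tends_to \<xi> z L)" for z
      using convergence_to_minimal_set[of z] att by metis
    show "kernel_julia (induced_gdms \<tau>) i = {}" for i by (rule kernel_julia_empty[OF assms(2)])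
    show "\<exists>G\<in>sets (path_borel \<tau>). emeasure (path_measure \<tau>) G = 1 \<and>
        (\<forall>\<xi>\<in>G. path_julia \<xi> \<in> null_sets sphere_area)"
      using path_julia_null by metis
    show "finite {L. minimal_set (induced_gdms \<tau>) L}" by (rule finite_minimal_sets)
  qed (use att continuous_map_TT continuous_on_TT_avg sum_TT_avg in auto)
qed

end
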